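(* Let $k$ be a field of characteristic $0$, $R = k[t_1, \dots, t_n]$, and $x_1, \dots, x_m \in (k^* )^n$. Let $N > 0$ and suppose there exists a nonzero $P \in R$ with total degree $\deg(P) < (N/n)^{m/n}$ such that $P(x) = 0$ for all $x \in X(N)$. Then there exists a prime ideal $\mathfrak{p} \subset \mathfrak{m}$ of some height $n'$ such that $\operatorname{rank}(\operatorname{Stab}_X(\mathfrak{p})) = m'$ with $m'/m + n'/n > 1$.
   Context: $X(N) = \{\prod_{i=1}^m x_i^{a_i} : a_i \in \mathbf{Z},\ 0 \le a_i \le N\} \subset (k^* )^n$, products taken coordinatewise; for $a \in \mathbf{Z}^m$ write $x^a = \prod_i x_i^{a_i}$. $\mathfrak{m} = (t_1 - 1, \dots, t_n - 1)$. An element $z \in (k^* )^n$ acts on $R$ by $(z \cdot f)(t) = f(z_1t_1, \dots, z_nt_n)$, and $\operatorname{Stab}_X(\mathfrak{p}) = \{a \in \mathbf{Z}^m : x^a \cdot \mathfrak{p} = \mathfrak{p}\}$. *)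

theory Defs
  imports "HOL-Analysis.Analysis" "HOL-Library.Poly_Mapping"
begin

type_synonym ('n, 'k) mpoly = "('n \<Rightarrow>\<^sub>0 nat) \<Rightarrow>\<^sub>0 'k"

definition Var :: "'n \<Rightarrow> ('n, 'k::{zero,one}) mpoly" where
  "Var j = Poly_Mapping.single (Poly_Mapping.single j 1) 1"

definition mono_eval :: "('n::finite \<Rightarrow>\<^sub>0 nat) \<Rightarrow> ('n \<Rightarrow> 'k::comm_semiring_1) \<Rightarrow> 'k" where
  "mono_eval \<alpha> z = (\<Prod>j\<in>UNIV. z j ^ Poly_Mapping.lookup \<alpha> j)"

definition mpoly_eval :: "('n::finite, 'k::comm_semiring_1) mpoly \<Rightarrow> ('n \<Rightarrow> 'k) \<Rightarrow> 'k" where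
  "mpoly_eval P z = (\<Sum>\<alpha>\<in>Poly_Mapping.keys P. Poly_Mapping.lookup P \<alpha> * mono_eval \<alpha> z)"

text \<open>total degree (0 for the zero polynomial)\<close>
definition tdeg :: "('n::finite, 'k::zero) mpoly \<Rightarrow> nat" where
  "tdeg P = Max (insert 0 ((\<lambda>\<alpha>. \<Sum>j\<in>UNIV. Poly_Mapping.lookup \<alpha> j) ` Poly_Mapping.keys P))"

text \<open>(z . f)(t) = f(z_1 t_1, ..., z_n t_n): the coefficient of t^alpha is scaled by z^alpha\<close>
definition act :: "('n::finite \<Rightarrow> 'k::comm_semiring_1) \<Rightarrow> ('n, 'k) mpoly \<Rightarrow> ('n, 'k) mpoly" where
  "act z P = (\<Sum>\<alpha>\<in>Poly_Mapping.keys P. Poly_Mapping.single \<alpha> (Poly_Mapping.lookup P \<alpha> * mono_eval \<alpha> z))"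

definition is_ideal :: "'a::comm_ring_1 set \<Rightarrow> bool" where
  "is_ideal I \<longleftrightarrow> 0 \<in> I \<and> (\<forall>a\<in>I. \<forall>b\<in>I. a + b \<in> I) \<and> (\<forall>a\<in>I. \<forall>r. r * a \<in> I)"

definition ideal_gen :: "'a::comm_ring_1 set \<Rightarrow> 'a set" where
  "ideal_gen S = \<Inter>{I. is_ideal I \<and> S \<subseteq> I}"

definition prime_ideal :: "'a::comm_ring_1 set \<Rightarrow> bool" where
  "prime_ideal p \<longleftrightarrow> is_ideal p \<and> p \<noteq> UNIV \<and> (\<forall>a b. a * b \<in> p \<longrightarrow> a \<in> p \<or> b \<in> p)"

definition prime_chain :: "(nat \<Rightarrow> 'a::comm_ring_1 set) \<Rightarrow> nat \<Rightarrow> bool" where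
  "prime_chain c r \<longleftrightarrow> (\<forall>i\<le>r. prime_ideal (c i)) \<and> (\<forall>i<r. c i \<subset> c (Suc i))"

definition has_height :: "'a::comm_ring_1 set \<Rightarrow> nat \<Rightarrow> bool" where
  "has_height p h \<longleftrightarrow> (\<exists>c. prime_chain c h \<and> c h = p) \<and>
     (\<forall>c r. prime_chain c r \<and> c r = p \<longrightarrow> r \<le> h)"

definition maxm :: "('n::finite, 'k::comm_ring_1) mpoly set" where
  "maxm = ideal_gen (range (\<lambda>j. Var j - 1))"

definition xpow :: "('m::finite \<Rightarrow> 'n \<Rightarrow> 'k::field) \<Rightarrow> ('m \<Rightarrow> int) \<Rightarrow> 'n \<Rightarrow> 'k" where
  "xpow x a = (\<lambda>j. \<Prod>i\<in>UNIV. (x i j) powi (a i))"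

definition Xset :: "('m::finite \<Rightarrow> 'n \<Rightarrow> 'k::field) \<Rightarrow> nat \<Rightarrow> ('n \<Rightarrow> 'k) set" where
  "Xset x N = {xpow x a | a. \<forall>i. 0 \<le> a i \<and> a i \<le> int N}"

definition Stab :: "('m::finite \<Rightarrow> 'n::finite \<Rightarrow> 'k::field) \<Rightarrow> ('n, 'k) mpoly set \<Rightarrow> ('m \<Rightarrow> int) set" where
  "Stab x p = {a. act (xpow x a) ` p = p}"

definition int_indep :: "('m \<Rightarrow> int) set \<Rightarrow> bool" where
  "int_indep S \<longleftrightarrow> finite S \<and>
     (\<forall>c. (\<forall>i. (\<Sum>s\<in>S. c s * s i) = 0) \<longrightarrow> (\<forall>s\<in>S. c s = 0))"

definition has_rank :: "('m \<Rightarrow> int) set \<Rightarrow> nat \<Rightarrow> bool" where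
  "has_rank G r \<longleftrightarrow> (\<exists>S\<subseteq>G. int_indep S \<and> card S = r) \<and>
     (\<forall>S\<subseteq>G. int_indep S \<longrightarrow> card S \<le> r)"

end

theory Submission
  imports Defs "HOL-Computational_Algebra.Polynomial"
begin

text \<open>
  Translates of \<open>P\<close> by small exponents still vanish on a large part of \<open>X(N)\<close>. Enlarging the set of
  translates in \<open>n\<close> steps, the least codimension of a prime that contains them and lies in the ideal of
  one of the remaining points must repeat, since it stays between \<open>1\<close> and \<open>n\<close>. At a repetition one
  finds a prime \<open>q\<close> of codimension \<open>c\<close> all of whose translates \<open>x\<^bsup>-a\<^esup> q\<close> with
  \<open>0 \<le> a\<^sub>i \<le> \<lfloor>N/n\<rfloor>\<close> are minimal over one family of polynomials of degree at most \<open>deg P\<close>.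
  By Bezout's inequality there are at most \<open>(deg P)\<^bsup>c\<^esup>\<close> of them, while there are at least
  \<open>(\<lfloor>N/n\<rfloor> + 1)\<^bsup>m-m'\<^esup>\<close> classes modulo the stabiliser.

  The codimension of a prime \<open>p\<close> is measured by the largest set \<open>S\<close> of variables with
  \<open>k[S] \<inter> p = 0\<close>. That a prime minimal over \<open>r\<close> polynomials has codimension at most \<open>r\<close> is
  shown by comparing, as \<open>j\<close> grows, the rank over \<open>k[S]\<close> modulo the \<open>j\<close>-th differential power of the
  prime with the rank modulo the \<open>j\<close>-th power of the \<open>r\<close> polynomials. Bezout's inequality follows
  by intersecting with generic members of the family one at a time and comparing growth rates of the
  spaces of polynomials of bounded degree modulo primes.
\<close>

section \<open>Ideals and ranks over a domain\<close>

text \<open>The bound \<open>D ^ c\<close>, with \<open>D = deg P\<close>, concerns minimal primes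
  of one codimension \<open>c\<close>, although the family may also have minimal primes of other
  codimensions. Generic sections cope with this provided that every component left after
  \<open>i\<close> of them has codimension exactly \<open>i\<close>; this is Krull's height theorem,
  which is why it is proved here. Degrees of varieties are never defined: a prime of dimension
  \<open>e\<close> carries any number \<open>w\<close> such that its Hilbert function, up to a
  shift, dominates \<open>w\<close> times a binomial coefficient of degree \<open>e\<close>. Only
  such lower bounds are passed on, from the components back to the zero ideal, where the count of
  all monomials forces \<open>w <= 1\<close>. Ranks over \<open>k[S]\<close> are handled by clearing
  denominators; no fraction field or localised ring is constructed. The exponent \<open>m/n\<close>
  in the hypothesis turns the two counts into \<open>m - m' < m c / n\<close>, and since
  \<open>floor(N/n) + 1 > N/n\<close>, rounding costs nothing. Finally \<open>q\<close> lies in the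
  ideal of some point \<open>x^b\<close>; its translate by \<open>b\<close> lies in the ideal of the
  identity and has the same stabiliser and codimension.\<close>

lemma is_idealD:
  assumes "is_ideal J"
  shows ideal_zero: "0 \<in> J"
    and ideal_add: "a \<in> J \<Longrightarrow> b \<in> J \<Longrightarrow> a + b \<in> J"
    and ideal_mult_left: "a \<in> J \<Longrightarrow> r * a \<in> J"
    and ideal_mult_right: "a \<in> J \<Longrightarrow> a * r \<in> J"
  using assms by (auto simp: is_ideal_def) (metis mult.commute)

lemma ideal_uminus: "is_ideal J \<Longrightarrow> a \<in> J \<Longrightarrow> - a \<in> J"
  using ideal_mult_left[of J a "- 1"] by simp

lemma ideal_diff: "is_ideal J \<Longrightarrow> a \<in> J \<Longrightarrow> b \<in> J \<Longrightarrow> a - b \<in> J"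
  using ideal_add[of J a "- b"] ideal_uminus[of J b] by simp

lemma ideal_sum: "is_ideal J \<Longrightarrow> (\<And>i. i \<in> I \<Longrightarrow> f i \<in> J) \<Longrightarrow> sum f I \<in> J"
  by (induction I rule: infinite_finite_induct) (auto simp: ideal_zero ideal_add)

lemma ideal_diff_iff: "is_ideal J \<Longrightarrow> a - b \<in> J \<Longrightarrow> a \<in> J \<longleftrightarrow> b \<in> J"
  using ideal_add[of J "a - b" b] ideal_diff[of J a "a - b"] by auto

lemma prime_idealD:
  assumes "prime_ideal p"
  shows prime_ideal_ideal: "is_ideal p"
    and prime_ideal_multD: "a * b \<in> p \<Longrightarrow> a \<in> p \<or> b \<in> p"
    and prime_ideal_one: "1 \<notin> p"
proof -
  show id: "is_ideal p" and "a * b \<in> p \<Longrightarrow> a \<in> p \<or> b \<in> p"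
    using assms by (auto simp: prime_ideal_def)
  show "1 \<notin> p"
    using assms ideal_mult_left[OF id, of 1] by (auto simp: prime_ideal_def)
qed

lemma prime_ideal_prodD:
  "prime_ideal p \<Longrightarrow> prod f I \<in> p \<Longrightarrow> \<exists>i\<in>I. f i \<in> p"
proof (induction I rule: infinite_finite_induct)
  case (insert i I)
  then show ?case using prime_ideal_multD[of p "f i" "prod f I"] by auto
qed (auto simp: prime_ideal_one)

lemma cancel_pow:
  fixes J :: "'a::comm_ring_1 set"
  assumes "\<And>h. g * h \<in> J \<Longrightarrow> h \<in> J" "g ^ m * h \<in> J"
  shows "h \<in> J"
  using assms(2)
proof (induction m)
  case (Suc m)
  then show ?case using assms(1)[of "g ^ m * h"] by (simp add: mult.assoc)
qed simp

text \<open>In the applications \<open>B\<close> is \<open>k[S]\<close> inside the polynomial ring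
  (the constants when \<open>S\<close> is empty) or the ring of integers. What is wanted are ranks
  over its fraction field.\<close>

locale subdomain =
  fixes B :: "'a::comm_ring_1 set"
  assumes zero_mem: "0 \<in> B" and one_mem: "1 \<in> B"
    and add_mem: "a \<in> B \<Longrightarrow> b \<in> B \<Longrightarrow> a + b \<in> B"
    and mult_mem: "a \<in> B \<Longrightarrow> b \<in> B \<Longrightarrow> a * b \<in> B"
    and uminus_mem: "a \<in> B \<Longrightarrow> - a \<in> B"
    and no_zero_div: "a \<in> B \<Longrightarrow> b \<in> B \<Longrightarrow> a * b = 0 \<Longrightarrow> a = 0 \<or> b = 0"
begin

lemma diff_mem: "a \<in> B \<Longrightarrow> b \<in> B \<Longrightarrow> a - b \<in> B"
  using add_mem[of a "- b"] uminus_mem[of b] by simp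

lemma sum_mem: "(\<And>i. i \<in> I \<Longrightarrow> f i \<in> B) \<Longrightarrow> sum f I \<in> B"
  by (induction I rule: infinite_finite_induct) (auto simp: zero_mem add_mem)

lemma pow_mem: "a \<in> B \<Longrightarrow> a ^ n \<in> B"
  by (induction n) (auto simp: one_mem mult_mem)

lemma pow_nonzero: "a \<in> B \<Longrightarrow> a \<noteq> 0 \<Longrightarrow> a ^ n \<noteq> 0"
proof (induction n)
  case (Suc n)
  then show ?case using no_zero_div[of a "a ^ n"] pow_mem[of a n] by auto
qed auto

text \<open>Gaussian elimination without division: with pivot \<open>a k l\<close>, row
  \<open>i\<close> becomes \<open>a k l\<close> times itself minus \<open>a i l\<close> times row
  \<open>k\<close>, which clears column \<open>l\<close>. One row and one column disappear.\<close>

lemma lin_dep: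
  assumes "finite L" "finite I" "card L < card I" "\<And>i l. i \<in> I \<Longrightarrow> l \<in> L \<Longrightarrow> a i l \<in> B"
  shows "\<exists>c. (\<forall>i\<in>I. c i \<in> B) \<and> (\<exists>i\<in>I. c i \<noteq> 0) \<and> (\<forall>l\<in>L. (\<Sum>i\<in>I. c i * a i l) = 0)"
  using assms
proof (induction L arbitrary: I a rule: finite_induct)
  case empty
  then have "I \<noteq> {}" by auto
  then show ?case using one_mem by (intro exI[of _ "\<lambda>_. 1"]) auto
next
  case (insert l L)
  show ?case
  proof (cases "\<forall>i\<in>I. a i l = 0")
    case True
    have "card L < card I" using insert by auto
    moreover have aB: "\<And>i l. i \<in> I \<Longrightarrow> l \<in> L \<Longrightarrow> a i l \<in> B" using insert.prems(3) by simp
    ultimately have "\<exists>c. (\<forall>i\<in>I. c i \<in> B) \<and> (\<exists>i\<in>I. c i \<noteq> 0) \<and> (\<forall>l\<in>L. (\<Sum>i\<in>I. c i * a i l) = 0)"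
      by (rule insert.IH[OF insert.prems(1)])
    then obtain c where "\<forall>i\<in>I. c i \<in> B" "\<exists>i\<in>I. c i \<noteq> 0" "\<forall>l\<in>L. (\<Sum>i\<in>I. c i * a i l) = 0" by blast
    then show ?thesis using True by (intro exI[of _ c]) auto
  next
    case False
    then obtain k where k: "k \<in> I" "a k l \<noteq> 0" by auto
    define I' where "I' = I - {k}"
    have fI': "finite I'" and kI': "k \<notin> I'" and I: "I = insert k I'" using insert k by (auto simp: I'_def)
    have "card L < card I'" using insert fI' kI' by (auto simp: I)
    moreover have "\<And>i l'. i \<in> I' \<Longrightarrow> l' \<in> L \<Longrightarrow> a k l * a i l' - a i l * a k l' \<in> B"
      using insert.prems(3) k by (auto simp: I intro!: diff_mem mult_mem)
    ultimately have "\<exists>c. (\<forall>i\<in>I'. c i \<in> B) \<and> (\<exists>i\<in>I'. c i \<noteq> 0) \<and>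
      (\<forall>l'\<in>L. (\<Sum>i\<in>I'. c i * (a k l * a i l' - a i l * a k l')) = 0)"
      by (rule insert.IH[OF fI'])
    then obtain c where c: "\<forall>i\<in>I'. c i \<in> B" "\<exists>i\<in>I'. c i \<noteq> 0"
      "\<forall>l'\<in>L. (\<Sum>i\<in>I'. c i * (a k l * a i l' - a i l * a k l')) = 0" by blast
    \<comment> \<open>The dependency of the reduced rows is pulled back: the other coefficients pick
      up the pivot as a factor, and the coefficient of the pivot row is dictated by column
      \<open>l\<close>.\<close>
    define d where "d i = (if i = k then - (\<Sum>i\<in>I'. c i * a i l) else c i * a k l)" for i
    have sum_d: "(\<Sum>i\<in>I. d i * a i l') = (\<Sum>i\<in>I'. c i * (a k l * a i l' - a i l * a k l'))" for l'
    proof -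
      have "(\<Sum>i\<in>I. d i * a i l') = d k * a k l' + (\<Sum>i\<in>I'. d i * a i l')"
        using fI' kI' by (simp add: I)
      also have "(\<Sum>i\<in>I'. d i * a i l') = (\<Sum>i\<in>I'. c i * a k l * a i l')"
        using kI' by (intro sum.cong) (auto simp: d_def)
      also have "d k * a k l' + \<dots> = (\<Sum>i\<in>I'. c i * (a k l * a i l' - a i l * a k l'))"
        by (simp add: d_def algebra_simps sum_distrib_left sum_distrib_right sum_subtractf)
      finally show ?thesis .
    qed
    show ?thesis
    proof (intro exI[of _ d] conjI)
      show "\<forall>i\<in>I. d i \<in> B"
        using c(1) insert.prems(3) k by (auto simp: d_def I intro!: uminus_mem sum_mem mult_mem)
      from c(2) obtain i where i: "i \<in> I'" "c i \<noteq> 0" by auto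
      then have "d i \<noteq> 0"
        using kI' k c(1) no_zero_div[of "c i" "a k l"] insert.prems(3) by (auto simp: d_def)
      then show "\<exists>i\<in>I. d i \<noteq> 0" using i by (auto simp: I)
      show "\<forall>l'\<in>insert l L. (\<Sum>i\<in>I. d i * a i l') = 0"
        using c(3) by (auto simp: sum_d algebra_simps)
    qed
  qed
qed

definition span :: "'a set \<Rightarrow> 'a set" where
  "span X = {\<Sum>x\<in>X. c x * x | c. \<forall>x\<in>X. c x \<in> B}"

text \<open>With \<open>F\<close> the fraction field of \<open>B\<close>, these are the elements
  whose image in the quotient by \<open>J\<close>, tensored with \<open>F\<close>, lies in the
  \<open>F\<close>-span of \<open>X\<close>. Once every element belongs to it, the quotient has rank
  at most \<open>card X\<close>.\<close>

definition torsion_span :: "'a set \<Rightarrow> 'a set \<Rightarrow> 'a set" where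
  "torsion_span X J = {h. \<exists>b\<in>B. b \<noteq> 0 \<and> (\<exists>u\<in>span X. b * h - u \<in> J)}"

lemma span_zero: "0 \<in> span X"
  unfolding span_def using zero_mem by (auto intro!: exI[of _ "\<lambda>_. 0"])

lemma span_add: "u \<in> span X \<Longrightarrow> v \<in> span X \<Longrightarrow> u + v \<in> span X"
proof -
  assume "u \<in> span X" "v \<in> span X"
  then obtain c d where "u = (\<Sum>x\<in>X. c x * x)" "v = (\<Sum>x\<in>X. d x * x)"
    "\<forall>x\<in>X. c x \<in> B" "\<forall>x\<in>X. d x \<in> B" by (auto simp: span_def)
  then show ?thesis unfolding span_def
    by (intro CollectI exI[of _ "\<lambda>x. c x + d x"]) (auto simp: sum.distrib algebra_simps add_mem)
qed

lemma span_scale: "b \<in> B \<Longrightarrow> u \<in> span X \<Longrightarrow> b * u \<in> span X"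
proof -
  assume b: "b \<in> B" and "u \<in> span X"
  then obtain c where "u = (\<Sum>x\<in>X. c x * x)" "\<forall>x\<in>X. c x \<in> B" by (auto simp: span_def)
  then show ?thesis unfolding span_def
    by (intro CollectI exI[of _ "\<lambda>x. b * c x"]) (auto simp: sum_distrib_left mult.assoc b mult_mem)
qed

lemma span_base: "finite X \<Longrightarrow> x \<in> X \<Longrightarrow> x \<in> span X"
  unfolding span_def using zero_mem one_mem
  by (intro CollectI exI[of _ "\<lambda>y. if y = x then 1 else 0"]) (auto simp: sum.remove[of X x])

lemma span_sum: "(\<And>i. i \<in> I \<Longrightarrow> f i \<in> span X) \<Longrightarrow> sum f I \<in> span X"
  by (induction I rule: infinite_finite_induct) (auto simp: span_zero span_add)

lemma span_image_mult:
  assumes "finite Y" "(\<lambda>x. f * x) ` X \<subseteq> Y" "u \<in> span X"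
  shows "f * u \<in> span Y"
proof -
  obtain c where c: "u = (\<Sum>x\<in>X. c x * x)" "\<forall>x\<in>X. c x \<in> B" using assms(3) by (auto simp: span_def)
  have "f * u = (\<Sum>x\<in>X. c x * (f * x))" by (simp add: c sum_distrib_left mult_ac)
  also have "\<dots> \<in> span Y"
    using assms c by (intro span_sum span_scale span_base) auto
  finally show ?thesis .
qed

lemma span_mono:
  assumes "finite Y" "X \<subseteq> Y" "u \<in> span X"
  shows "u \<in> span Y"
  using span_image_mult[of Y 1 X u] assms by auto

lemma torsion_span_add:
  assumes J: "is_ideal J" and g: "g \<in> torsion_span X J" and h: "h \<in> torsion_span X J"
  shows "g + h \<in> torsion_span X J"
proof -
  from g h obtain b u c v where b: "b \<in> B" "b \<noteq> 0" "u \<in> span X" "b * g - u \<in> J"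
    and c: "c \<in> B" "c \<noteq> 0" "v \<in> span X" "c * h - v \<in> J"
    by (auto simp: torsion_span_def)
  have "b * c * (g + h) - (c * u + b * v) = c * (b * g - u) + b * (c * h - v)"
    by (simp add: algebra_simps)
  also have "\<dots> \<in> J" using b c by (intro ideal_add[OF J] ideal_mult_left[OF J])
  finally show ?thesis unfolding torsion_span_def
    using b c no_zero_div[of b c]
    by (intro CollectI bexI[of _ "b * c"] conjI bexI[of _ "c * u + b * v"])
       (auto intro: mult_mem span_add span_scale)
qed

lemma torsion_span_ideal: "is_ideal J \<Longrightarrow> h \<in> J \<Longrightarrow> h \<in> torsion_span X J"
  unfolding torsion_span_def using one_mem span_zero
  by (intro CollectI bexI[of _ 1] conjI bexI[of _ 0]) auto

lemma torsion_span_sum: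
  "is_ideal J \<Longrightarrow> (\<And>i. i \<in> I \<Longrightarrow> f i \<in> torsion_span X J) \<Longrightarrow> sum f I \<in> torsion_span X J"
  by (induction I rule: infinite_finite_induct)
     (auto intro: torsion_span_add torsion_span_ideal ideal_zero)

lemma torsion_span_scale:
  assumes J: "is_ideal J" and g: "g \<in> torsion_span X J" and c: "c \<in> B"
  shows "c * g \<in> torsion_span X J"
proof -
  from g obtain b u where b: "b \<in> B" "b \<noteq> 0" "u \<in> span X" "b * g - u \<in> J"
    by (auto simp: torsion_span_def)
  have "b * (c * g) - c * u = c * (b * g - u)" by (simp add: algebra_simps)
  also have "\<dots> \<in> J" using b by (intro ideal_mult_left[OF J])
  finally show ?thesis unfolding torsion_span_def using b c span_scale by blast
qed

lemma torsion_span_base: "is_ideal J \<Longrightarrow> u \<in> span X \<Longrightarrow> u \<in> torsion_span X J"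
  unfolding torsion_span_def using one_mem
  by (intro CollectI bexI[of _ 1] conjI bexI[of _ u]) (auto simp: ideal_zero)

lemma torsion_span_div:
  assumes "b \<in> B" "b \<noteq> 0" "b * h \<in> torsion_span X J"
  shows "h \<in> torsion_span X J"
proof -
  from assms obtain c u where c: "c \<in> B" "c \<noteq> 0" "u \<in> span X" "c * (b * h) - u \<in> J"
    by (auto simp: torsion_span_def)
  then show ?thesis unfolding torsion_span_def using assms no_zero_div[of c b]
    by (intro CollectI bexI[of _ "c * b"] conjI bexI[of _ u]) (auto intro: mult_mem simp: mult.assoc)
qed

text \<open>After clearing denominators each \<open>b i * v i\<close> is a combination of
  \<open>X\<close> modulo \<open>J\<close>, and a relation between the rows of coefficients becomes
  a relation between the \<open>v i\<close>.\<close>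

lemma rank_bound:
  assumes J: "is_ideal J" and fin: "finite X" "finite I" and card: "card X < card I"
    and v: "\<And>i. i \<in> I \<Longrightarrow> v i \<in> torsion_span X J"
  shows "\<exists>c. (\<forall>i\<in>I. c i \<in> B) \<and> (\<exists>i\<in>I. c i \<noteq> 0) \<and> (\<Sum>i\<in>I. c i * v i) \<in> J"
proof -
  have "\<exists>b a. b \<in> B \<and> b \<noteq> 0 \<and> (\<forall>x\<in>X. a x \<in> B) \<and> b * v i - (\<Sum>x\<in>X. a x * x) \<in> J" if "i \<in> I" for i
    using v[OF that] unfolding torsion_span_def span_def by blast
  then obtain b a where ba: "\<And>i. i \<in> I \<Longrightarrow> b i \<in> B \<and> b i \<noteq> 0 \<and> (\<forall>x\<in>X. a i x \<in> B) \<and> b i * v i - (\<Sum>x\<in>X. a i x * x) \<in> J"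
    by metis
  obtain c where c: "\<forall>i\<in>I. c i \<in> B" "\<exists>i\<in>I. c i \<noteq> 0" "\<forall>x\<in>X. (\<Sum>i\<in>I. c i * a i x) = 0"
    using lin_dep[OF fin card, of a] ba by blast
  have "(\<Sum>i\<in>I. c i * b i * v i) = (\<Sum>i\<in>I. c i * (b i * v i - (\<Sum>x\<in>X. a i x * x))) + (\<Sum>i\<in>I. \<Sum>x\<in>X. c i * a i x * x)"
    by (simp add: algebra_simps sum_subtractf sum_distrib_left)
  also have "(\<Sum>i\<in>I. \<Sum>x\<in>X. c i * a i x * x) = (\<Sum>x\<in>X. (\<Sum>i\<in>I. c i * a i x) * x)"
    by (subst sum.swap) (simp add: sum_distrib_right)
  also have "\<dots> = 0" using c(3) by simp
  also have "(\<Sum>i\<in>I. c i * (b i * v i - (\<Sum>x\<in>X. a i x * x))) + 0 \<in> J"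
    using ba by (auto intro!: ideal_sum[OF J] ideal_mult_left[OF J])
  finally have "(\<Sum>i\<in>I. c i * b i * v i) \<in> J" .
  moreover have "\<forall>i\<in>I. c i * b i \<in> B" using c ba by (auto intro: mult_mem)
  moreover have "\<exists>i\<in>I. c i * b i \<noteq> 0" using c ba no_zero_div by blast
  ultimately show ?thesis by (intro exI[of _ "\<lambda>i. c i * b i"]) auto
qed

text \<open>In a finite-dimensional algebra over a field a non-zero-divisor is a unit. The powers of
  \<open>g\<close> satisfy a relation modulo \<open>J\<close>; cancelling the lowest power that
  occurs leaves a nonzero constant term congruent to a multiple of \<open>g\<close>.\<close>

lemma invertible_up_to_torsion:
  assumes J: "is_ideal J" and X: "finite X" "\<And>h. h \<in> torsion_span X J"
    and g: "\<And>h. g * h \<in> J \<Longrightarrow> h \<in> J"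
  shows "\<exists>b\<in>B. b \<noteq> 0 \<and> (\<exists>g'. b - g * g' \<in> J)"
proof -
  obtain c where c: "\<forall>i\<in>{..card X}. c i \<in> B" "\<exists>i\<in>{..card X}. c i \<noteq> 0" "(\<Sum>i\<in>{..card X}. c i * g ^ i) \<in> J"
    using rank_bound[OF J X(1), of "{..card X}" "\<lambda>i. g ^ i"] X(2) by auto
  define m where "m = (LEAST i. i \<le> card X \<and> c i \<noteq> 0)"
  have m: "m \<le> card X" "c m \<noteq> 0"
    using LeastI_ex[of "\<lambda>i. i \<le> card X \<and> c i \<noteq> 0"] c(2) by (auto simp: m_def)
  have below: "c i = 0" if "i < m" for i
    using not_less_Least[of i "\<lambda>i. i \<le> card X \<and> c i \<noteq> 0"] that m by (auto simp: m_def)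
  define r where "r = (\<Sum>i\<in>{m<..card X}. c i * g ^ (i - Suc m))"
  have "(\<Sum>i\<in>{..card X}. c i * g ^ i) = (\<Sum>i\<in>{m..card X}. c i * g ^ i)"
    using below by (intro sum.mono_neutral_right) auto
  also have "\<dots> = c m * g ^ m + (\<Sum>i\<in>{m<..card X}. c i * g ^ i)"
    using m by (simp add: sum.head)
  also have "(\<Sum>i\<in>{m<..card X}. c i * g ^ i) = g ^ Suc m * r"
    unfolding r_def sum_distrib_left
  proof (intro sum.cong refl)
    fix i assume "i \<in> {m<..card X}"
    then have "g ^ i = g ^ Suc m * g ^ (i - Suc m)" by (subst power_add[symmetric]) auto
    then show "c i * g ^ i = g ^ Suc m * (c i * g ^ (i - Suc m))" by (simp add: mult_ac)
  qed
  finally have "g ^ m * (c m - g * (- r)) \<in> J" using c(3) by (simp add: algebra_simps)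
  then have "c m - g * (- r) \<in> J" using cancel_pow[of g J m] g by blast
  then show ?thesis using m c(1) by (intro bexI[of _ "c m"] conjI exI[of _ "- r"]) simp_all
qed

end

text \<open>In the local ring at \<open>q\<close> every element of the maximal ideal is nilpotent
  modulo \<open>J\<close>. Otherwise an ideal containing \<open>J\<close> and maximal among those
  avoiding the multiplicative set of all \<open>g * a ^ k\<close> would be a prime inside
  \<open>q\<close> that misses \<open>a\<close>, against minimality.\<close>

lemma min_prime_power:
  fixes J :: "'a::comm_ring_1 set"
  assumes q: "prime_ideal q" and J: "is_ideal J" "J \<subseteq> q"
    and minimal: "\<And>p. prime_ideal p \<Longrightarrow> J \<subseteq> p \<Longrightarrow> p \<subseteq> q \<Longrightarrow> p = q"
    and a: "a \<in> q"
  shows "\<exists>g k. g \<notin> q \<and> g * a ^ k \<in> J"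
proof (rule ccontr)
  assume no: "\<nexists>g k. g \<notin> q \<and> g * a ^ k \<in> J"
  define U where "U = {g * a ^ k | g k. g \<notin> q}"
  have U_mult: "u * v \<in> U" if uv: "u \<in> U" "v \<in> U" for u v
  proof -
    obtain g k h l where gh: "u = g * a ^ k" "v = h * a ^ l" "g \<notin> q" "h \<notin> q" using uv by (auto simp: U_def)
    then have "u * v = (g * h) * a ^ (k + l)" by (simp add: power_add mult_ac)
    moreover have "g * h \<notin> q" using gh prime_ideal_multD[OF q] by blast
    ultimately show ?thesis unfolding U_def by blast
  qed
  define \<A> where "\<A> = {I. is_ideal I \<and> J \<subseteq> I \<and> I \<inter> U = {}}"
  have "\<exists>p\<in>\<A>. \<forall>I\<in>\<A>. p \<subseteq> I \<longrightarrow> I = p"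
  proof (rule subset_Zorn_nonempty)
    show "\<A> \<noteq> {}" using no J by (auto simp: \<A>_def U_def intro!: exI[of _ J])
    fix \<C> assume C: "\<C> \<noteq> {}" "subset.chain \<A> \<C>"
    then have sub: "I \<in> \<A>" if "I \<in> \<C>" for I using that by (auto simp: subset.chain_def)
    have "is_ideal (\<Union>\<C>)"
      unfolding is_ideal_def
    proof (intro conjI ballI allI)
      obtain I where "I \<in> \<C>" using C(1) by blast
      then show "0 \<in> \<Union>\<C>" using sub[of I] ideal_zero[of I] by (auto simp: \<A>_def)
      show "r * b \<in> \<Union>\<C>" if "b \<in> \<Union>\<C>" for b r
        using that sub by (auto simp: \<A>_def intro: ideal_mult_left)
      fix b c assume "b \<in> \<Union>\<C>" "c \<in> \<Union>\<C>"
      then obtain I I' where I: "I \<in> \<C>" "b \<in> I" "I' \<in> \<C>" "c \<in> I'" by auto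
      then have "I \<subseteq> I' \<or> I' \<subseteq> I" using C(2) by (auto simp: subset.chain_def)
      then show "b + c \<in> \<Union>\<C>"
      proof
        assume "I \<subseteq> I'"
        then show ?thesis using I sub[of I'] by (auto simp: \<A>_def intro!: bexI[of _ I'] ideal_add)
      next
        assume "I' \<subseteq> I"
        then show ?thesis using I sub[of I] by (auto simp: \<A>_def intro!: bexI[of _ I] ideal_add)
      qed
    qed
    then show "\<Union>\<C> \<in> \<A>" using C sub unfolding \<A>_def by blast
  qed
  then obtain p where p: "p \<in> \<A>" and pmax: "\<And>I. I \<in> \<A> \<Longrightarrow> p \<subseteq> I \<Longrightarrow> I = p" by blast
  have pid: "is_ideal p" "J \<subseteq> p" "p \<inter> U = {}" using p by (auto simp: \<A>_def)
  have one_U: "1 \<in> U" unfolding U_def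
    by (intro CollectI exI[of _ 1] exI[of _ 0]) (auto simp: prime_ideal_one[OF q])
  have hit: "\<exists>u\<in>U. \<exists>r. u - r * b \<in> p" if b: "b \<notin> p" for b
  proof -
    define I where "I = {c + r * b | c r. c \<in> p}"
    have "is_ideal I" unfolding is_ideal_def
    proof (intro conjI ballI allI)
      show "0 \<in> I" unfolding I_def using ideal_zero[OF pid(1)]
        by (intro CollectI exI[of _ 0]) auto
      fix u v assume "u \<in> I" "v \<in> I"
      then obtain c r d s where "u = c + r * b" "v = d + s * b" "c \<in> p" "d \<in> p" by (auto simp: I_def)
      then have "u + v = (c + d) + (r + s) * b" "c + d \<in> p" by (auto simp: algebra_simps ideal_add[OF pid(1)])
      then show "u + v \<in> I" unfolding I_def by blast
    next
      fix u t assume "u \<in> I"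
      then obtain c r where "u = c + r * b" "c \<in> p" by (auto simp: I_def)
      then have "t * u = t * c + (t * r) * b" "t * c \<in> p" by (auto simp: distrib_left mult.assoc intro: ideal_mult_left[OF pid(1)])
      then show "t * u \<in> I" unfolding I_def by blast
    qed
    moreover have "p \<subseteq> I"
    proof
      fix c assume "c \<in> p"
      then show "c \<in> I" unfolding I_def by (intro CollectI exI[of _ c] exI[of _ 0]) auto
    qed
    moreover have "b \<in> I" unfolding I_def using ideal_zero[OF pid(1)]
      by (intro CollectI exI[of _ 0] exI[of _ 1]) auto
    ultimately have "I \<inter> U \<noteq> {}" using pmax[of I] b pid(2) unfolding \<A>_def by blast
    then obtain u c r where "u \<in> U" "u = c + r * b" "c \<in> p" unfolding I_def by blast
    then show ?thesis by (intro bexI[of _ u] exI[of _ r]) auto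
  qed
  have "prime_ideal p"
    unfolding prime_ideal_def
  proof (intro conjI allI impI)
    show "is_ideal p" by fact
    show "p \<noteq> UNIV" using pid(3) one_U by auto
    fix b c assume bc: "b * c \<in> p"
    show "b \<in> p \<or> c \<in> p"
    proof (rule ccontr)
      assume "\<not> (b \<in> p \<or> c \<in> p)"
      then obtain u r v s where u: "u \<in> U" "u - r * b \<in> p" and v: "v \<in> U" "v - s * c \<in> p"
        using hit by metis
      \<comment> \<open>By maximality, adjoining \<open>b\<close> or \<open>c\<close> to
        \<open>p\<close> meets \<open>U\<close>. The product of the two elements met is in
        \<open>U\<close> and, since \<open>b * c\<close> is in \<open>p\<close>, also in
        \<open>p\<close>.\<close>
      have "u * v = v * (u - r * b) + r * b * (v - s * c) + r * s * (b * c)" by (simp add: algebra_simps)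
      also have "\<dots> \<in> p"
        by (intro ideal_add[OF pid(1)] ideal_mult_left[OF pid(1) u(2)] ideal_mult_left[OF pid(1) v(2)] ideal_mult_left[OF pid(1) bc])
      finally show False using U_mult u v pid(3) by blast
    qed
  qed
  moreover have "p \<subseteq> q"
  proof
    fix g assume g: "g \<in> p"
    show "g \<in> q"
    proof (rule ccontr)
      assume "g \<notin> q"
      then have "g * a ^ 0 \<in> U" unfolding U_def by blast
      then show False using g pid(3) by auto
    qed
  qed
  ultimately have "p = q" using minimal pid(2) by blast
  moreover have "1 * a ^ 1 \<in> U" unfolding U_def using prime_ideal_one[OF q] by blast
  ultimately show False using a pid(3) by auto
qed

section \<open>Differential powers and the number of generators\<close>

lemma sum_choose_diag: "(\<Sum>w\<le>s. (w + m) choose m) = (s + Suc m) choose Suc m"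
  by (induction s) simp_all

lemma card_bounded_sum:
  assumes "finite T"
  shows "finite {a::'i \<Rightarrow> nat. (\<forall>i. i \<notin> T \<longrightarrow> a i = 0) \<and> sum a T \<le> s} \<and>
    card {a::'i \<Rightarrow> nat. (\<forall>i. i \<notin> T \<longrightarrow> a i = 0) \<and> sum a T \<le> s} = (s + card T) choose card T"
  using assms
proof (induction T arbitrary: s rule: finite_induct)
  case empty
  have "{a::'i \<Rightarrow> nat. (\<forall>i. i \<notin> {} \<longrightarrow> a i = 0) \<and> sum a {} \<le> s} = {\<lambda>_. 0}" by auto
  then show ?case by simp
next
  case (insert t T)
  define A where "A T s = {a::'i \<Rightarrow> nat. (\<forall>i. i \<notin> T \<longrightarrow> a i = 0) \<and> sum a T \<le> s}" for T s
  have IH: "finite (A T s)" "card (A T s) = (s + card T) choose card T" for s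
    using insert.IH by (auto simp: A_def)
  have upd: "sum (a(t := v)) T = sum a T" for a :: "'i \<Rightarrow> nat" and v
    using insert by (intro sum.cong) auto
  have "bij_betw (\<lambda>(v, a). a(t := v)) (SIGMA v:{..s}. A T (s - v)) (A (insert t T) s)"
  proof (rule bij_betw_byWitness[where f' = "\<lambda>a. (a t, a(t := 0))"])
    show "\<forall>x\<in>SIGMA v:{..s}. A T (s - v). (\<lambda>a. (a t, a(t := 0))) ((\<lambda>(v, a). a(t := v)) x) = x"
      using insert by (auto simp: A_def fun_eq_iff)
    show "(\<lambda>(v, a). a(t := v)) ` (SIGMA v:{..s}. A T (s - v)) \<subseteq> A (insert t T) s"
      using insert upd by (auto simp: A_def)
    show "(\<lambda>a. (a t, a(t := 0))) ` A (insert t T) s \<subseteq> (SIGMA v:{..s}. A T (s - v))"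
      using insert upd by (auto simp: A_def)
  qed auto
  moreover have "finite (SIGMA v:{..s}. A T (s - v))" using IH by auto
  moreover have "card (SIGMA v:{..s}. A T (s - v)) = (\<Sum>v\<le>s. (s - v + card T) choose card T)"
    using IH by (subst card_SigmaI) auto
  moreover have "(\<Sum>v\<le>s. (s - v + card T) choose card T) = (\<Sum>w\<le>s. (w + card T) choose card T)"
    by (rule sum.reindex_bij_witness[of _ "\<lambda>w. s - w" "\<lambda>w. s - w"]) auto
  ultimately have "finite (A (insert t T) s) \<and> card (A (insert t T) s) = (s + card (insert t T)) choose card (insert t T)"
    using insert by (auto simp: bij_betw_finite bij_betw_same_card[symmetric] sum_choose_diag)
  then show ?case by (simp add: A_def)
qed

text \<open>A model of the local ring at \<open>q\<close>: the \<open>\<phi> i\<close> act as local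
  parameters and the \<open>D i\<close> as \<open>B\<close>-linear derivations, with a diagonal
  Jacobian whose entries lie outside \<open>q\<close>. It is used with \<open>B = k[S]\<close>,
  \<open>T\<close> the complement of \<open>S\<close>, and \<open>D i\<close> the derivative in
  \<open>t_i\<close>.\<close>

locale height_setup = subdomain B for B :: "'a::comm_ring_1 set" +
  fixes q :: "'a set" and T :: "'i set" and \<phi> :: "'i \<Rightarrow> 'a" and D :: "'i \<Rightarrow> 'a \<Rightarrow> 'a"
  assumes prime: "prime_ideal q"
    and B_inter: "b \<in> B \<Longrightarrow> b \<in> q \<Longrightarrow> b = 0"
    and fin_T: "finite T"
    and \<phi>_mem: "i \<in> T \<Longrightarrow> \<phi> i \<in> q"
    and D_add: "D i (g + h) = D i g + D i h"
    and D_mult: "D i (g * h) = g * D i h + h * D i g"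
    and D_const: "i \<in> T \<Longrightarrow> b \<in> B \<Longrightarrow> D i b = 0"
    and D_other: "i \<in> T \<Longrightarrow> j \<in> T \<Longrightarrow> i \<noteq> j \<Longrightarrow> D i (\<phi> j) = 0"
    and D_self: "i \<in> T \<Longrightarrow> D i (\<phi> i) \<notin> q"
    and char_0: "b \<in> B \<Longrightarrow> of_nat (Suc n) * b = 0 \<Longrightarrow> b = 0"
begin

lemmas q_ideal = prime_ideal_ideal[OF prime]

lemma D_zero: "D i 0 = 0"
  using D_add[of i 0 0] by simp

lemma D_sum: "D i (sum f I) = (\<Sum>x\<in>I. D i (f x))"
  by (induction I rule: infinite_finite_induct) (auto simp: D_zero D_add)

lemma D_power: "D i (g ^ n) = of_nat n * g ^ (n - 1) * D i g"
proof (induction n)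
  case 0
  have "D i (1 * 1) = 1 * D i 1 + 1 * D i 1" by (rule D_mult)
  then show ?case by simp
next
  case (Suc n)
  then show ?case by (cases n) (auto simp: D_mult algebra_simps)
qed

text \<open>Differential powers of \<open>q\<close>: unlike ordinary powers they are visibly saturated with respect
  to the complement of \<open>q\<close>.\<close>

primrec dpow :: "nat \<Rightarrow> 'a set" where
  "dpow 0 = UNIV"
| "dpow (Suc j) = {h \<in> q. \<forall>i\<in>T. D i h \<in> dpow j}"

lemma dpow_ideal_decreasing: "is_ideal (dpow j) \<and> dpow (Suc j) \<subseteq> dpow j"
proof (induction j)
  case 0
  then show ?case by (auto simp: is_ideal_def)
next
  case (Suc j)
  note J = conjunct1[OF Suc]
  have "is_ideal (dpow (Suc j))"
    unfolding is_ideal_def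
  proof (intro conjI ballI allI)
    show "0 \<in> dpow (Suc j)" by (simp add: ideal_zero[OF q_ideal] D_zero ideal_zero[OF J])
    fix g h assume g: "g \<in> dpow (Suc j)"
    show "g + h \<in> dpow (Suc j)" if "h \<in> dpow (Suc j)"
      using g that by (auto simp: D_add intro: ideal_add[OF q_ideal] ideal_add[OF J])
    have "g \<in> dpow j" using g Suc by blast
    then show "r * g \<in> dpow (Suc j)" for r
      using g ideal_mult_left[OF q_ideal, of g r] ideal_mult_left[OF J] ideal_mult_right[OF J, of g]
      by (auto simp: D_mult intro!: ideal_add[OF J])
  qed
  then show ?case using Suc by auto
qed

lemmas dpow_ideal = conjunct1[OF dpow_ideal_decreasing]

text \<open>By the Leibniz rule \<open>D i (a * h)\<close> has two terms: the induction hypothesis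
  covers \<open>a * D i h\<close>, and the other one has the factor \<open>h\<close> itself.\<close>

lemma dpow_mult: "a \<in> q \<Longrightarrow> h \<in> dpow j \<Longrightarrow> a * h \<in> dpow (Suc j)"
proof (induction j arbitrary: h)
  case 0
  then show ?case by (auto intro: ideal_mult_right[OF q_ideal])
next
  case (Suc j)
  have "a * D i h \<in> dpow (Suc j)" if "i \<in> T" for i using Suc that by auto
  moreover have "h * D i a \<in> dpow (Suc j)" for i
    using Suc.prems ideal_mult_right[OF dpow_ideal] by blast
  ultimately have "D i (a * h) \<in> dpow (Suc j)" if "i \<in> T" for i
    using that unfolding D_mult by (intro ideal_add[OF dpow_ideal])
  then show ?case using Suc.prems ideal_mult_right[OF q_ideal] by (subst dpow.simps) auto
qed

text \<open>In \<open>g * D i h = D i (g * h) - h * D i g\<close> the last term is harmless, because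
  \<open>h\<close> is already known to lie one level lower.\<close>

lemma dpow_saturated: "g \<notin> q \<Longrightarrow> g * h \<in> dpow j \<Longrightarrow> h \<in> dpow j"
proof (induction j arbitrary: h)
  case (Suc j)
  have h: "h \<in> q" using Suc.prems prime_ideal_multD[OF prime, of g h] by auto
  have "g * h \<in> dpow j" using Suc.prems dpow_ideal_decreasing by blast
  then have hj: "h \<in> dpow j" using Suc by blast
  have "D i h \<in> dpow j" if i: "i \<in> T" for i
  proof -
    have "g * D i h = D i (g * h) - h * D i g" by (simp add: D_mult)
    also have "\<dots> \<in> dpow j"
      using Suc.prems(2) i hj by (intro ideal_diff[OF dpow_ideal] ideal_mult_right[OF dpow_ideal]) auto
    finally show ?thesis using Suc by blast
  qed
  then show ?case using h by simp
qed simp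

definition expo :: "nat \<Rightarrow> ('i \<Rightarrow> nat) set" where
  "expo j = {a. (\<forall>i. i \<notin> T \<longrightarrow> a i = 0) \<and> sum a T < j}"

definition phi_pow :: "('i \<Rightarrow> nat) \<Rightarrow> 'a" where
  "phi_pow a = (\<Prod>i\<in>T. \<phi> i ^ a i)"

lemma expo_finite_card: "finite (expo (Suc j)) \<and> card (expo (Suc j)) = (j + card T) choose card T"
  using card_bounded_sum[OF fin_T, of j] by (simp add: expo_def less_Suc_eq_le)

lemma expo_finite: "finite (expo j)"
  using expo_finite_card by (cases j) (auto simp: expo_def)

lemma D_phi_pow:
  assumes i: "i \<in> T"
  shows "D i (phi_pow a) = of_nat (a i) * phi_pow (a(i := a i - 1)) * D i (\<phi> i)"
proof -
  have D_prod: "D i (\<Prod>j\<in>T'. \<phi> j ^ a j) = 0" if "finite T'" "T' \<subseteq> T - {i}" for T'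
    using that
  proof (induction T' rule: finite_induct)
    case empty
    then show ?case using D_const[OF i one_mem] by simp
  next
    case (insert j T')
    then show ?case using D_other[OF i, of j] by (auto simp: D_mult D_power)
  qed
  have rest: "(\<Prod>j\<in>T - {i}. \<phi> j ^ (a(i := v)) j) = (\<Prod>j\<in>T - {i}. \<phi> j ^ a j)" for v
    by (intro prod.cong) auto
  have "phi_pow a = \<phi> i ^ a i * (\<Prod>j\<in>T - {i}. \<phi> j ^ a j)"
    unfolding phi_pow_def using fin_T i by (rule prod.remove)
  moreover have "phi_pow (a(i := a i - 1)) = \<phi> i ^ (a i - 1) * (\<Prod>j\<in>T - {i}. \<phi> j ^ a j)"
    unfolding phi_pow_def using fin_T i by (subst prod.remove[of T i]) (auto simp only: rest fun_upd_same)
  ultimately show ?thesis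
    using D_prod[of "T - {i}"] fin_T by (simp add: D_mult D_power mult_ac)
qed

text \<open>Applying \<open>D i\<close> lowers the level by one and, up to the factor
  \<open>D i (\<phi> i)\<close>, which saturation removes, produces a combination of the same kind.
  Characteristic zero then kills every coefficient whose exponent at \<open>i\<close> is positive.
  The constant term that remains lies in both \<open>B\<close> and \<open>q\<close>.\<close>

lemma phi_pow_independent:
  assumes "\<And>a. b a \<in> B" "(\<Sum>a\<in>expo j. b a * phi_pow a) \<in> dpow j" "a \<in> expo j"
  shows "b a = 0"
  using assms
proof (induction j arbitrary: b a)
  case 0
  then show ?case by (simp add: expo_def)
next
  case (Suc j)
  have pos: "b a = 0" if a: "a \<in> expo (Suc j)" "a i > 0" and i: "i \<in> T" for a i
  proof -
    \<comment> \<open>The coefficient of \<open>phi_pow a\<close> in the derivative once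
      \<open>D i (\<phi> i)\<close> is taken out: it stems from the exponent vector that is larger
      by one at \<open>i\<close>.\<close>
    define b' where "b' a = of_nat (Suc (a i)) * b (a(i := Suc (a i)))" for a
    have "D i (\<Sum>a\<in>expo (Suc j). b a * phi_pow a) = (\<Sum>a\<in>expo (Suc j). b a * of_nat (a i) * phi_pow (a(i := a i - 1)) * D i (\<phi> i))"
      unfolding D_sum
      by (intro sum.cong refl) (simp add: D_mult D_const[OF i] Suc.prems(1) D_phi_pow[OF i] mult_ac)
    also have "\<dots> = (\<Sum>a\<in>{a\<in>expo (Suc j). a i > 0}. b a * of_nat (a i) * phi_pow (a(i := a i - 1)) * D i (\<phi> i))"
      using expo_finite by (intro sum.mono_neutral_right) auto
    also have "\<dots> = (\<Sum>a\<in>expo j. b' a * phi_pow a * D i (\<phi> i))"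
    proof (rule sum.reindex_bij_witness[of _ "\<lambda>a. a(i := Suc (a i))" "\<lambda>a. a(i := a i - 1)"])
      have upd: "sum (a(i := v)) T = v + sum a (T - {i})" for a :: "'i \<Rightarrow> nat" and v
      proof -
        have "sum (a(i := v)) (T - {i}) = sum a (T - {i})" by (intro sum.cong) auto
        then show ?thesis using fin_T i by (subst sum.remove[of T i]) auto
      qed
      have sT: "sum a T = a i + sum a (T - {i})" for a :: "'i \<Rightarrow> nat" using fin_T i by (rule sum.remove)
      show "a(i := a i - 1) \<in> expo j" if "a \<in> {a\<in>expo (Suc j). a i > 0}" for a
        using that i by (auto simp: expo_def upd sT)
      show "a(i := Suc (a i)) \<in> {a\<in>expo (Suc j). a i > 0}" if "a \<in> expo j" for a
        using that i by (auto simp: expo_def upd sT)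
    qed (auto simp: b'_def fun_eq_iff mult_ac)
    finally have "D i (\<Sum>a\<in>expo (Suc j). b a * phi_pow a) = D i (\<phi> i) * (\<Sum>a\<in>expo j. b' a * phi_pow a)"
      by (simp add: sum_distrib_left mult_ac)
    then have "D i (\<phi> i) * (\<Sum>a\<in>expo j. b' a * phi_pow a) \<in> dpow j" using Suc.prems(2) i by auto
    then have in_j: "(\<Sum>a\<in>expo j. b' a * phi_pow a) \<in> dpow j" using dpow_saturated D_self[OF i] by blast
    have b'B: "b' a \<in> B" for a
      unfolding b'_def using Suc.prems(1) sum_mem[of "{..<Suc (a i)}" "\<lambda>_. 1"] one_mem by (intro mult_mem) auto
    have "a(i := a i - 1) \<in> expo j"
    proof -
      have "sum (a(i := a i - 1)) T < sum a T" using a i fin_T by (intro sum_strict_mono_ex1) auto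
      then show ?thesis using a i by (auto simp: expo_def)
    qed
    then have "b' (a(i := a i - 1)) = 0" using Suc.IH[OF b'B in_j] by blast
    then have "of_nat (Suc (a i - 1)) * b a = 0" using a by (simp add: b'_def)
    then show "b a = 0" using char_0 Suc.prems(1) by blast
  qed
  have zero: "(\<lambda>_. 0) \<in> expo (Suc j)" by (auto simp: expo_def)
  have nz: "b a = 0" if a: "a \<in> expo (Suc j)" "a \<noteq> (\<lambda>_. 0)" for a
  proof -
    obtain i where i: "a i > 0" using a(2) by (auto simp: fun_eq_iff)
    then have "i \<in> T" using a(1) by (auto simp: expo_def)
    then show ?thesis using pos a(1) i by blast
  qed
  have "(\<Sum>a\<in>expo (Suc j). b a * phi_pow a) = b (\<lambda>_. 0) * phi_pow (\<lambda>_. 0)"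
    using expo_finite zero nz by (subst sum.remove[of _ "\<lambda>_. 0"]) auto
  then have "b (\<lambda>_. 0) \<in> q" using Suc.prems(2) by (simp add: phi_pow_def)
  then show ?case using nz B_inter Suc.prems by blast
qed

text \<open>\<open>E j\<close> is the \<open>j\<close>-th power of the ideal generated by
  \<open>fs\<close>, extended to the local ring at \<open>q\<close> and contracted back, with
  \<open>g\<close> in the role of the denominator. Elements outside \<open>q\<close> thereby become
  cancellable modulo \<open>E (Suc j)\<close>, as \<open>invertible_up_to_torsion\<close>
  requires.\<close>

context
  fixes fs :: "'a list" and E :: "nat \<Rightarrow> 'a set"
  assumes fs: "set fs \<subseteq> q"
    and E_0: "E 0 = UNIV"
    and E_Suc: "\<And>j. E (Suc j) = {h. \<exists>g. g \<notin> q \<and> (\<exists>r. (\<forall>i. r i \<in> E j) \<and> g * h = (\<Sum>i<length fs. fs ! i * r i))}"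
begin

lemma E_SucI:
  assumes "g \<notin> q" "\<And>i. r i \<in> E j" "g * h = (\<Sum>i<length fs. fs ! i * r i)"
  shows "h \<in> E (Suc j)"
  unfolding E_Suc using assms by (intro CollectI exI[of _ g] conjI exI[of _ r]) auto

lemma E_ideal: "is_ideal (E j)"
proof (induction j)
  case 0
  then show ?case by (simp add: E_0 is_ideal_def)
next
  case (Suc j)
  show ?case unfolding is_ideal_def
  proof (intro conjI ballI allI)
    show "0 \<in> E (Suc j)" unfolding E_Suc
      using prime_ideal_one[OF prime] ideal_zero[OF Suc] by (intro CollectI exI[of _ 1] conjI exI[of _ "\<lambda>_. 0"]) auto
    fix h assume "h \<in> E (Suc j)"
    then obtain g r where g: "g \<notin> q" "\<forall>i. r i \<in> E j" "g * h = (\<Sum>i<length fs. fs ! i * r i)"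
      by (auto simp: E_Suc)
    have "g * (c * h) = (\<Sum>i<length fs. fs ! i * (c * r i))" for c
    proof -
      have "g * (c * h) = c * (g * h)" by (simp add: mult_ac)
      also have "\<dots> = (\<Sum>i<length fs. fs ! i * (c * r i))"
        unfolding g(3) sum_distrib_left by (simp add: mult_ac)
      finally show ?thesis .
    qed
    then show "c * h \<in> E (Suc j)" for c
      using g ideal_mult_left[OF Suc] by (intro E_SucI[of g "\<lambda>i. c * r i"]) auto
    fix h' assume "h' \<in> E (Suc j)"
    then obtain g' r' where g': "g' \<notin> q" "\<forall>i. r' i \<in> E j" "g' * h' = (\<Sum>i<length fs. fs ! i * r' i)"
      by (auto simp: E_Suc)
    have "g * g' * (h + h') = g' * (g * h) + g * (g' * h')" by (simp add: algebra_simps)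
    also have "\<dots> = (\<Sum>i<length fs. fs ! i * (g' * r i + g * r' i))"
      unfolding g(3) g'(3) by (simp add: sum_distrib_left sum.distrib algebra_simps)
    finally have "g * g' * (h + h') = (\<Sum>i<length fs. fs ! i * (g' * r i + g * r' i))" .
    moreover have "g * g' \<notin> q" using g g' prime_ideal_multD[OF prime] by blast
    moreover have "\<forall>i. g' * r i + g * r' i \<in> E j" using g g' ideal_mult_left[OF Suc] ideal_add[OF Suc] by blast
    ultimately show "h + h' \<in> E (Suc j)" by (intro E_SucI[of "g * g'" "\<lambda>i. g' * r i + g * r' i"]) auto
  qed
qed

lemma E_dpow: "E j \<subseteq> dpow j"
proof (induction j)
  case (Suc j)
  show ?case
  proof
    fix h assume "h \<in> E (Suc j)"
    then obtain g r where g: "g \<notin> q" "\<forall>i. r i \<in> E j" "g * h = (\<Sum>i<length fs. fs ! i * r i)"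
      by (auto simp: E_Suc)
    have "fs ! i * r i \<in> dpow (Suc j)" if "i < length fs" for i
      using that fs g Suc by (intro dpow_mult) (auto simp: subset_iff)
    then have "g * h \<in> dpow (Suc j)" unfolding g(3) by (intro ideal_sum[OF dpow_ideal]) auto
    then show "h \<in> dpow (Suc j)" using dpow_saturated g by blast
  qed
qed simp

lemma E_mult: "a \<in> E 1 \<Longrightarrow> h \<in> E j \<Longrightarrow> a * h \<in> E (Suc j)"
proof -
  assume a: "a \<in> E 1" and h: "h \<in> E j"
  then obtain g r where g: "g \<notin> q" "g * a = (\<Sum>i<length fs. fs ! i * r i)"
    by (auto simp: E_Suc E_0)
  have "g * (a * h) = g * a * h" by (simp add: mult.assoc)
  also have "\<dots> = (\<Sum>i<length fs. fs ! i * (r i * h))" unfolding g(2) sum_distrib_right by (simp add: mult_ac)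
  finally have "g * (a * h) = (\<Sum>i<length fs. fs ! i * (r i * h))" .
  moreover have "\<forall>i. r i * h \<in> E j" using h ideal_mult_left[OF E_ideal] by blast
  ultimately show ?thesis using g(1) by (intro E_SucI[of g "\<lambda>i. r i * h"]) auto
qed

lemma E_gen: "i < length fs \<Longrightarrow> h \<in> E j \<Longrightarrow> fs ! i * h \<in> E (Suc j)"
proof -
  assume i: "i < length fs" and h: "h \<in> E j"
  define r where "r k = (if k = i then h else 0)" for k
  have "(\<Sum>k<length fs. fs ! k * r k) = fs ! i * h"
    using i by (simp add: r_def if_distrib cong: if_cong)
  moreover have "\<forall>k. r k \<in> E j" using h ideal_zero[OF E_ideal] by (auto simp: r_def)
  ultimately show ?thesis unfolding E_Suc using prime_ideal_one[OF prime]
    by (intro CollectI exI[of _ 1] conjI exI[of _ r]) auto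
qed

lemma E_saturated: "g \<notin> q \<Longrightarrow> g * h \<in> E (Suc j) \<Longrightarrow> h \<in> E (Suc j)"
proof -
  assume g: "g \<notin> q" and "g * h \<in> E (Suc j)"
  then obtain g' r where g': "g' \<notin> q" "\<forall>i. r i \<in> E j" "g' * (g * h) = (\<Sum>i<length fs. fs ! i * r i)"
    by (auto simp: E_Suc)
  moreover have "g' * g \<notin> q" using g g' prime_ideal_multD[OF prime] by blast
  ultimately show ?thesis unfolding E_Suc by (auto simp: mult.assoc intro!: exI[of _ "g' * g"])
qed

context
  fixes X :: "'a set"
  assumes fin_X: "finite X" and X_span: "\<And>h. h \<in> torsion_span X (E 1)"
begin

text \<open>The inverse modulo \<open>E 1\<close> lifts to every level:
  \<open>(b - g * g') ^ j\<close> lies in \<open>E j\<close> and equals \<open>b ^ j\<close> minus a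
  multiple of \<open>g\<close>.\<close>

lemma E_invert:
  assumes g: "g \<notin> q"
  shows "\<exists>b\<in>B. b \<noteq> 0 \<and> (\<exists>g'. b - g * g' \<in> E j)"
proof -
  obtain b g' where b: "b \<in> B" "b \<noteq> 0" "b - g * g' \<in> E 1"
    using invertible_up_to_torsion[OF E_ideal fin_X X_span, of g] E_saturated[OF g] by auto
  have "\<exists>g'. b ^ j - g * g' \<in> E j" 
  proof (induction j)
    case 0
    then show ?case by (simp add: E_0)
  next
    case (Suc j)
    then obtain g'' where g'': "b ^ j - g * g'' \<in> E j" by blast
    have "(b - g * g') * (b ^ j - g * g'') = b ^ Suc j - g * (g'' * b + g' * b ^ j - g * g' * g'')"
      by (simp add: algebra_simps)
    then show ?case using E_mult[OF b(3) g''] by metis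
  qed
  then show ?thesis using b pow_mem pow_nonzero by blast
qed

text \<open>Bounding each exponent by \<open>j\<close> separately takes in more monomials than
  bounding their degree, but gives the plain count \<open>j ^ length fs * card X\<close>, and only
  the order of growth in \<open>j\<close> matters.\<close>

definition gens :: "nat \<Rightarrow> 'a set" where
  "gens j = (\<lambda>(\<beta>, e). (\<Prod>i<length fs. fs ! i ^ \<beta> i) * e) ` (({..<length fs} \<rightarrow>\<^sub>E {..<j}) \<times> X)"

lemma gens_card: "finite (gens j) \<and> card (gens j) \<le> j ^ length fs * card X"
proof -
  have "finite ({..<length fs} \<rightarrow>\<^sub>E {..<j})" by (intro finite_PiE) auto
  moreover have "card ({..<length fs} \<rightarrow>\<^sub>E {..<j}) = j ^ length fs" by (simp add: card_PiE)
  ultimately show ?thesis unfolding gens_def using fin_X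
    by (auto simp: card_cartesian_product intro!: order_trans[OF card_image_le])
qed

lemma gens_base: "X \<subseteq> gens (Suc j)"
proof
  fix e assume "e \<in> X"
  then show "e \<in> gens (Suc j)" unfolding gens_def
    by (intro image_eqI[of _ _ "(\<lambda>i\<in>{..<length fs}. 0, e)"]) auto
qed

lemma gens_step:
  assumes "i < length fs"
  shows "(\<lambda>x. fs ! i * x) ` gens j \<subseteq> gens (Suc j)"
proof
  fix y assume "y \<in> (\<lambda>x. fs ! i * x) ` gens j"
  then obtain \<beta> e where \<beta>: "\<beta> \<in> {..<length fs} \<rightarrow>\<^sub>E {..<j}" and e: "e \<in> X"
    and y: "y = fs ! i * ((\<Prod>k<length fs. fs ! k ^ \<beta> k) * e)" by (auto simp: gens_def)
  define \<gamma> where "\<gamma> = \<beta>(i := Suc (\<beta> i))"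
  have "(\<Prod>k<length fs. fs ! k ^ \<gamma> k) = fs ! i ^ \<gamma> i * (\<Prod>k\<in>{..<length fs} - {i}. fs ! k ^ \<gamma> k)"
    using assms by (intro prod.remove) auto
  also have "(\<Prod>k\<in>{..<length fs} - {i}. fs ! k ^ \<gamma> k) = (\<Prod>k\<in>{..<length fs} - {i}. fs ! k ^ \<beta> k)"
    by (intro prod.cong) (auto simp: \<gamma>_def)
  also have "fs ! i ^ \<gamma> i * \<dots> = fs ! i * (\<Prod>k<length fs. fs ! k ^ \<beta> k)"
    using assms by (subst prod.remove[of "{..<length fs}" i]) (auto simp: \<gamma>_def mult_ac)
  finally have "y = (\<Prod>k<length fs. fs ! k ^ \<gamma> k) * e" by (simp add: y mult_ac)
  moreover have "\<gamma> \<in> {..<length fs} \<rightarrow>\<^sub>E {..<Suc j}"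
    using \<beta> assms by (auto simp: \<gamma>_def PiE_iff extensional_def intro: less_SucI)
  ultimately show "y \<in> gens (Suc j)" using e unfolding gens_def by (intro image_eqI[of _ _ "(\<gamma>, e)"]) auto
qed

text \<open>Modulo \<open>E 1\<close> every \<open>h\<close> reduces to \<open>span X\<close>. The
  error is, once its denominator \<open>g\<close> is inverted up to torsion, a combination of
  members of \<open>fs\<close> whose cofactors fall under the induction hypothesis.\<close>

lemma gens_span: "h \<in> torsion_span (gens j) (E j)"
proof (induction j arbitrary: h)
  case 0
  show ?case by (rule torsion_span_ideal[OF E_ideal]) (simp add: E_0)
next
  case (Suc j)
  note fg = conjunct1[OF gens_card]
  obtain b u where b: "b \<in> B" "b \<noteq> 0" "u \<in> span X" "b * h - u \<in> E 1"
    using X_span[of h] by (auto simp: torsion_span_def)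
  define h1 where "h1 = b * h - u"
  obtain g r where g: "g \<notin> q" "g * h1 = (\<Sum>i<length fs. fs ! i * r i)"
    using b(4) by (auto simp: h1_def E_Suc E_0)
  obtain c g' where c: "c \<in> B" "c \<noteq> 0" "c - g * g' \<in> E (Suc j)" using E_invert[OF g(1)] by blast
  have step: "fs ! i * x \<in> torsion_span (gens (Suc j)) (E (Suc j))" if i: "i < length fs" for i x
  proof -
    obtain d v where d: "d \<in> B" "d \<noteq> 0" "v \<in> span (gens j)" "d * x - v \<in> E j"
      using Suc[of x] by (auto simp: torsion_span_def)
    have "d * (fs ! i * x) - fs ! i * v = fs ! i * (d * x - v)" by (simp add: algebra_simps)
    also have "\<dots> \<in> E (Suc j)" using E_gen[OF i d(4)] .
    finally have "d * (fs ! i * x) - fs ! i * v \<in> E (Suc j)" .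
    moreover have "fs ! i * v \<in> span (gens (Suc j))"
      using span_image_mult[OF fg gens_step[OF i] d(3)] .
    ultimately show ?thesis unfolding torsion_span_def using d by blast
  qed
  have "c * h1 = (c - g * g') * h1 + g' * (g * h1)" by (simp add: algebra_simps)
  also have "g' * (g * h1) = (\<Sum>i<length fs. fs ! i * (g' * r i))"
    unfolding g(2) by (simp add: sum_distrib_left mult_ac)
  also have "(c - g * g') * h1 + \<dots> \<in> torsion_span (gens (Suc j)) (E (Suc j))"
    using c(3) by (intro torsion_span_add[OF E_ideal] torsion_span_sum[OF E_ideal] step
        torsion_span_ideal[OF E_ideal] ideal_mult_right[OF E_ideal]) auto
  finally have "h1 \<in> torsion_span (gens (Suc j)) (E (Suc j))" using torsion_span_div[OF c(1,2)] by blast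
  moreover have "u \<in> torsion_span (gens (Suc j)) (E (Suc j))"
    using span_mono[OF fg gens_base b(3)] by (rule torsion_span_base[OF E_ideal])
  ultimately have "b * h \<in> torsion_span (gens (Suc j)) (E (Suc j))"
    using torsion_span_add[OF E_ideal, of h1 _ _ u] by (simp add: h1_def)
  then show ?case using torsion_span_div b by blast
qed

text \<open>The \<open>phi_pow a\<close> are independent over \<open>B\<close> modulo
  \<open>dpow j\<close>, hence modulo the smaller \<open>E j\<close>, where the rank is at most
  \<open>card (gens j)\<close>.\<close>

lemma expo_card_le: "card (expo j) \<le> j ^ length fs * card X"
proof (rule ccontr)
  assume "\<not> ?thesis"
  then have "card (gens j) < card (expo j)" using gens_card[of j] by linarith
  then obtain c where c: "\<forall>a\<in>expo j. c a \<in> B" "\<exists>a\<in>expo j. c a \<noteq> 0" "(\<Sum>a\<in>expo j. c a * phi_pow a) \<in> E j"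
    using rank_bound[OF E_ideal conjunct1[OF gens_card] expo_finite, of j j phi_pow j] gens_span by auto
  define b where "b a = (if a \<in> expo j then c a else 0)" for a
  have "(\<Sum>a\<in>expo j. b a * phi_pow a) = (\<Sum>a\<in>expo j. c a * phi_pow a)" by (intro sum.cong) (auto simp: b_def)
  then have "(\<Sum>a\<in>expo j. b a * phi_pow a) \<in> dpow j" using c(3) E_dpow by auto
  moreover have "b a \<in> B" for a using c(1) zero_mem by (auto simp: b_def)
  ultimately have "b a = 0" if "a \<in> expo j" for a using phi_pow_independent that by blast
  then show False using c(2) by (auto simp: b_def)
qed

lemma card_T_le: "card T \<le> length fs"
proof (rule ccontr)
  assume "\<not> ?thesis"
  then have less: "length fs < card T" by simp
  define c where "c = card T"
  \<comment> \<open>One more than \<open>c ^ c * card X\<close>, the largest value for which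
    \<open>(j / c) ^ c\<close> can stay below \<open>j ^ length fs * card X\<close> when
    \<open>length fs < c\<close>.\<close>
  define j where "j = Suc (c ^ c * card X)"
  have "c > 0" using less by (simp add: c_def)
  have "(real j / real c) ^ c \<le> (real (j - 1 + c) / real c) ^ c"
    using \<open>c > 0\<close> by (intro power_mono divide_right_mono) (auto simp: j_def)
  also have "\<dots> \<le> real ((j - 1 + c) choose c)" by (rule binomial_ge_n_over_k_pow_k) auto
  also have "(j - 1 + c) choose c = card (expo j)" using expo_finite_card[of "j - 1"] by (simp add: j_def c_def)
  also have "real \<dots> \<le> real (j ^ length fs * card X)" using expo_card_le[of j] by linarith
  finally have "real j ^ c \<le> real (c ^ c) * real (j ^ length fs * card X)"
    using \<open>c > 0\<close> by (simp add: power_divide field_simps)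
  then have "j ^ c \<le> c ^ c * (j ^ length fs * card X)"
    by (metis of_nat_le_iff of_nat_mult of_nat_power)
  moreover have "j ^ Suc (length fs) \<le> j ^ c" using less by (intro power_increasing) (auto simp: j_def c_def)
  ultimately have "j ^ Suc (length fs) \<le> c ^ c * (j ^ length fs * card X)" by linarith
  then have "j ^ length fs * j \<le> j ^ length fs * (c ^ c * card X)" by (simp only: power_Suc mult_ac)
  then have "j \<le> c ^ c * card X" by (simp add: j_def)
  then show False by (simp add: j_def)
qed

end

end

end

section \<open>Polynomials in finitely many variables\<close>

abbreviation lkp :: "('a \<Rightarrow>\<^sub>0 'b::zero) \<Rightarrow> 'a \<Rightarrow> 'b" where "lkp \<equiv> Poly_Mapping.lookup"
abbreviation sgl :: "'a \<Rightarrow> 'b::zero \<Rightarrow> 'a \<Rightarrow>\<^sub>0 'b" where "sgl \<equiv> Poly_Mapping.single"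
abbreviation keys :: "('a \<Rightarrow>\<^sub>0 'b::zero) \<Rightarrow> 'a set" where "keys \<equiv> Poly_Mapping.keys"
abbreviation cst :: "'k::zero \<Rightarrow> ('n, 'k) mpoly" where "cst \<equiv> sgl 0"

lemma mpoly_expand: "P = (\<Sum>\<alpha>\<in>keys P. sgl \<alpha> (lkp P \<alpha>))" for P :: "('n, 'k::comm_monoid_add) mpoly"
  by (rule poly_mapping_eqI)
     (simp add: lookup_sum lookup_single when_def in_keys_iff)

lemma mpoly_induct [case_names single add]:
  fixes P :: "('n, 'k::comm_monoid_add) mpoly"
  assumes "\<And>\<alpha> c. Q (sgl \<alpha> c)" "\<And>P R. Q P \<Longrightarrow> Q R \<Longrightarrow> Q (P + R)"
  shows "Q P"
proof -
  have "Q (\<Sum>\<alpha>\<in>K. sgl \<alpha> (f \<alpha>))" for K and f :: "_ \<Rightarrow> 'k"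
    using assms assms(1)[of 0 0] by (induction K rule: infinite_finite_induct) auto
  then show ?thesis using mpoly_expand[of P] by metis
qed

lemma monomial_induct [case_names zero add]:
  fixes \<alpha> :: "'n::finite \<Rightarrow>\<^sub>0 nat"
  assumes zero: "Q 0" and add: "\<And>i \<beta>. Q \<beta> \<Longrightarrow> Q (sgl i 1 + \<beta>)"
  shows "Q \<alpha>"
proof (induction "sum (lkp \<alpha>) UNIV" arbitrary: \<alpha>)
  case 0
  then have "\<alpha> = 0" by (intro poly_mapping_eqI) auto
  then show ?case using zero by simp
next
  case (Suc n)
  then obtain i where i: "lkp \<alpha> i \<noteq> 0" by (metis Suc_neq_Zero sum.neutral)
  define \<beta> where "\<beta> = \<alpha> - sgl i 1"
  have \<alpha>: "\<alpha> = sgl i 1 + \<beta>" using i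
    by (intro poly_mapping_eqI) (auto simp: \<beta>_def lookup_add lookup_minus lookup_single when_def)
  have "sum (lkp \<alpha>) UNIV = sum (lkp (sgl i (1::nat))) UNIV + sum (lkp \<beta>) UNIV"
    unfolding \<alpha> by (simp add: lookup_add sum.distrib)
  also have "sum (lkp (sgl i (1::nat))) UNIV = 1" by (simp add: lookup_single when_def)
  finally have "n = sum (lkp \<beta>) UNIV" using Suc.hyps(2) by simp
  then show ?case unfolding \<alpha> by (intro add Suc.hyps(1))
qed

lemma lookup_cst_mult: "lkp (cst c * P) \<alpha> = c * lkp P \<alpha>" for P :: "('n, 'k::comm_semiring_1) mpoly"
  by (simp flip: mult_map_scale_conv_mult add: map.rep_eq when_def)

text \<open>One construction yields three ring homomorphisms: the view as a polynomial in a single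
  variable, evaluation at a point, and the torus action.\<close>

locale mpoly_hom =
  fixes \<rho> :: "'k::comm_ring_1 \<Rightarrow> 'b::comm_ring_1" and \<mu> :: "('n \<Rightarrow>\<^sub>0 nat) \<Rightarrow> 'b"
  assumes \<rho>_add: "\<rho> (c + d) = \<rho> c + \<rho> d" and \<rho>_mult: "\<rho> (c * d) = \<rho> c * \<rho> d" and \<rho>_one: "\<rho> 1 = 1"
    and \<mu>_add: "\<mu> (\<alpha> + \<beta>) = \<mu> \<alpha> * \<mu> \<beta>" and \<mu>_zero: "\<mu> 0 = 1"
begin

definition hom :: "('n, 'k) mpoly \<Rightarrow> 'b" where
  "hom P = (\<Sum>\<alpha>\<in>keys P. \<rho> (lkp P \<alpha>) * \<mu> \<alpha>)"

lemma \<rho>_zero: "\<rho> 0 = 0"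
  using \<rho>_add[of 0 0] by simp

lemma hom_superset:
  "finite K \<Longrightarrow> keys P \<subseteq> K \<Longrightarrow> hom P = (\<Sum>\<alpha>\<in>K. \<rho> (lkp P \<alpha>) * \<mu> \<alpha>)"
  unfolding hom_def by (rule sum.mono_neutral_left) (auto simp: in_keys_iff \<rho>_zero)

lemma hom_add: "hom (P + Q) = hom P + hom Q"
proof -
  have "hom R = (\<Sum>\<alpha>\<in>keys P \<union> keys Q. \<rho> (lkp R \<alpha>) * \<mu> \<alpha>)" if "R \<in> {P, Q, P + Q}" for R
    using that Poly_Mapping.keys_add[of P Q] by (intro hom_superset) auto
  then show ?thesis by (simp add: lookup_add \<rho>_add distrib_right sum.distrib)
qed

lemma hom_single: "hom (sgl \<alpha> c) = \<rho> c * \<mu> \<alpha>"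
  using hom_superset[of "{\<alpha>}" "sgl \<alpha> c"] by simp

lemma hom_mult: "hom (P * Q) = hom P * hom Q"
proof (induction P rule: mpoly_induct)
  case (single \<alpha> c)
  show ?case
  proof (induction Q rule: mpoly_induct)
    case (single \<beta> d)
    then show ?case by (simp add: mult_single hom_single \<rho>_mult \<mu>_add mult_ac)
  qed (simp add: hom_add distrib_left)
next
  case (add P R)
  then show ?case by (simp add: distrib_right hom_add)
qed

lemma hom_one: "hom 1 = 1"
  using hom_single[of 0 1] by (simp add: \<rho>_one \<mu>_zero)

lemma hom_zero: "hom 0 = 0"
  by (simp add: hom_def)

end

lemma Var_power: "Var j ^ k = (sgl (sgl j k) 1 :: ('n, 'k::comm_semiring_1) mpoly)"
proof (induction k)
  case (Suc k)
  then show ?case by (simp add: Var_def mult_single flip: single_add)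
qed (simp add: Var_def)

section \<open>Subrings generated by a set of variables\<close>

definition poly_in :: "'n set \<Rightarrow> ('n, 'k::zero) mpoly set" where
  "poly_in S = {P. \<forall>\<alpha>\<in>keys P. \<forall>j. lkp \<alpha> j \<noteq> 0 \<longrightarrow> j \<in> S}"

lemma poly_in_mono: "S \<subseteq> S' \<Longrightarrow> poly_in S \<subseteq> poly_in S'"
  by (auto simp: poly_in_def)

lemma poly_in_UNIV: "P \<in> poly_in UNIV"
  by (simp add: poly_in_def)

lemma poly_in_single: "(\<And>j. lkp \<alpha> j \<noteq> 0 \<Longrightarrow> j \<in> S) \<Longrightarrow> sgl \<alpha> c \<in> poly_in S"
  by (auto simp: poly_in_def split: if_splits)

lemma poly_in_cst: "cst c \<in> poly_in S"
  by (rule poly_in_single) auto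

lemma poly_in_Var: "j \<in> S \<Longrightarrow> Var j \<in> poly_in S"
  unfolding Var_def by (rule poly_in_single) (auto simp: lookup_single when_def split: if_splits)

lemma poly_in_empty:
  assumes "P \<in> poly_in {}"
  shows "P = cst (lkp P 0)"
proof -
  have "\<alpha> = 0" if "\<alpha> \<in> keys P" for \<alpha> using that assms by (intro poly_mapping_eqI) (auto simp: poly_in_def)
  then show ?thesis by (intro poly_mapping_eqI) (auto simp: lookup_single when_def in_keys_iff)
qed

lemma poly_in_zero: "0 \<in> poly_in S" by (simp add: poly_in_def)

lemma poly_in_add: "P \<in> poly_in S \<Longrightarrow> Q \<in> poly_in S \<Longrightarrow> P + Q \<in> poly_in S"
  for P :: "('n, 'k::comm_ring_1) mpoly"
  using Poly_Mapping.keys_add[of P Q] unfolding poly_in_def by blast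

lemma poly_in_sum: "(\<And>i. i \<in> I \<Longrightarrow> f i \<in> poly_in S) \<Longrightarrow> sum f I \<in> poly_in S"
  for f :: "'i \<Rightarrow> ('n, 'k::comm_ring_1) mpoly"
  by (induction I rule: infinite_finite_induct) (auto simp: poly_in_zero poly_in_add)

lemma poly_in_uminus: "P \<in> poly_in S \<Longrightarrow> - P \<in> poly_in S" for P :: "('n, 'k::comm_ring_1) mpoly"
  unfolding poly_in_def by (simp add: in_keys_iff)

lemma poly_in_mult: "P \<in> poly_in S \<Longrightarrow> Q \<in> poly_in S \<Longrightarrow> P * Q \<in> poly_in S"
  for P :: "('n, 'k::comm_ring_1) mpoly"
  using Poly_Mapping.keys_mult[of P Q] unfolding poly_in_def by (fastforce simp: lookup_add)

section \<open>Singling out one variable\<close>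

definition drop_var :: "'n \<Rightarrow> ('n \<Rightarrow>\<^sub>0 nat) \<Rightarrow> ('n \<Rightarrow>\<^sub>0 nat)" where
  "drop_var s \<alpha> = Poly_Mapping.update s 0 \<alpha>"

lemma lookup_drop_var: "lkp (drop_var s \<alpha>) j = (if j = s then 0 else lkp \<alpha> j)"
  by (simp add: drop_var_def lookup_update)

lemma drop_var_plus: "drop_var s \<alpha> + sgl s (lkp \<alpha> s) = \<alpha>"
  by (rule poly_mapping_eqI) (auto simp: lookup_add lookup_drop_var lookup_single when_def)

lemma upoly_hom: "mpoly_hom (\<lambda>c::'k::comm_ring_1. [:cst c:]) (\<lambda>\<alpha>. monom (sgl (drop_var s \<alpha>) 1) (lkp \<alpha> s))"
proof -
  have add: "drop_var s (\<alpha> + \<beta>) = drop_var s \<alpha> + drop_var s \<beta>" for \<alpha> \<beta>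
    by (rule poly_mapping_eqI) (auto simp: lookup_add lookup_drop_var)
  have zero: "drop_var s 0 = 0" by (rule poly_mapping_eqI) (auto simp: lookup_drop_var)
  show ?thesis
    by unfold_locales
       (simp_all add: single_add mult_single mult_monom add zero lookup_add monom_0 one_pCons mult.commute)
qed

text \<open>The coefficients are free of \<open>t_s\<close> but stay in the full polynomial ring, so
  their membership in an ideal can be tested without changing rings.\<close>

definition upoly :: "'n \<Rightarrow> ('n, 'k::comm_ring_1) mpoly \<Rightarrow> ('n, 'k) mpoly poly" where
  "upoly s = mpoly_hom.hom (\<lambda>c. [:cst c:]) (\<lambda>\<alpha>. monom (sgl (drop_var s \<alpha>) 1) (lkp \<alpha> s))"

lemmas upoly_add = mpoly_hom.hom_add[OF upoly_hom, folded upoly_def]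
  and upoly_mult = mpoly_hom.hom_mult[OF upoly_hom, folded upoly_def]
  and upoly_zero = mpoly_hom.hom_zero[OF upoly_hom, folded upoly_def]

lemma upoly_single: "upoly s (sgl \<alpha> c) = monom (sgl (drop_var s \<alpha>) c) (lkp \<alpha> s)"
  unfolding upoly_def mpoly_hom.hom_single[OF upoly_hom] by (simp add: smult_monom mult_single)

lemma poly_upoly: "poly (upoly s P) (Var s) = P"
proof (induction P rule: mpoly_induct)
  case (single \<alpha> c)
  show ?case by (simp add: upoly_single poly_monom Var_power mult_single drop_var_plus)
qed (simp add: upoly_add)

lemma upoly_eq_0_iff: "upoly s P = 0 \<longleftrightarrow> P = 0"
  using poly_upoly[of s P] by (auto simp: upoly_zero)

lemma upoly_sum: "upoly s (sum f I) = (\<Sum>i\<in>I. upoly s (f i))"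
  by (induction I rule: infinite_finite_induct) (auto simp: upoly_zero upoly_add)

lemma coeff_upoly: "coeff (upoly s P) m = (\<Sum>\<alpha>\<in>keys P. if lkp \<alpha> s = m then sgl (drop_var s \<alpha>) (lkp P \<alpha>) else 0)"
proof -
  have "upoly s P = (\<Sum>\<alpha>\<in>keys P. monom (sgl (drop_var s \<alpha>) (lkp P \<alpha>)) (lkp \<alpha> s))"
    by (subst mpoly_expand[of P]) (simp add: upoly_sum upoly_single)
  then show ?thesis by (simp add: coeff_sum)
qed

lemma coeff_upoly_in: "P \<in> poly_in (insert s S) \<Longrightarrow> s \<notin> S \<Longrightarrow> coeff (upoly s P) m \<in> poly_in S"
  unfolding coeff_upoly
  by (intro poly_in_sum) (auto simp: poly_in_zero poly_in_def lookup_drop_var split: if_splits)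

lemma upoly_const:
  assumes "P \<in> poly_in S" "s \<notin> S"
  shows "upoly s P = [:P:]"
proof -
  have lk: "lkp \<alpha> s = 0" if "\<alpha> \<in> keys P" for \<alpha> using assms that by (auto simp: poly_in_def)
  then have dv: "drop_var s \<alpha> = \<alpha>" if "\<alpha> \<in> keys P" for \<alpha>
    using that by (intro poly_mapping_eqI) (auto simp: lookup_drop_var)
  have "upoly s P = (\<Sum>\<alpha>\<in>keys P. monom (sgl (drop_var s \<alpha>) (lkp P \<alpha>)) (lkp \<alpha> s))"
    by (subst mpoly_expand[of P]) (simp add: upoly_sum upoly_single)
  also have "\<dots> = (\<Sum>\<alpha>\<in>keys P. [:sgl \<alpha> (lkp P \<alpha>):])"
    by (intro sum.cong) (auto simp: lk dv monom_0)
  also have "\<dots> = [:\<Sum>\<alpha>\<in>keys P. sgl \<alpha> (lkp P \<alpha>):]"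
    by (rule poly_eqI) (auto simp: coeff_sum coeff_pCons split: nat.splits)
  finally show ?thesis using mpoly_expand[of P] by simp
qed

text \<open>Gauss's argument with the lowest coefficients outside \<open>p\<close>: in the
  coefficient of index \<open>i + j\<close> all products but one lie in \<open>p\<close>. Primality
  is asked for products of coefficients only, so that the zero ideal can be treated variable by
  variable before it is known to be prime.\<close>

lemma poly_coeffs_prime:
  fixes f g :: "'a::comm_ring_1 poly"
  assumes p: "is_ideal p" and fg: "\<And>m. coeff (f * g) m \<in> p"
    and pr: "\<And>i j. coeff f i * coeff g j \<in> p \<Longrightarrow> coeff f i \<in> p \<or> coeff g j \<in> p"
  shows "(\<forall>m. coeff f m \<in> p) \<or> (\<forall>m. coeff g m \<in> p)"
proof (rule ccontr)
  assume "\<not> ?thesis"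
  then have ex: "\<exists>m. coeff f m \<notin> p" "\<exists>m. coeff g m \<notin> p" by auto
  define i where "i = (LEAST m. coeff f m \<notin> p)"
  define j where "j = (LEAST m. coeff g m \<notin> p)"
  have ij: "coeff f i \<notin> p" "coeff g j \<notin> p"
    using LeastI_ex[OF ex(1)] LeastI_ex[OF ex(2)] by (auto simp: i_def j_def)
  have low: "coeff f m \<in> p" if "m < i" for m using that not_less_Least unfolding i_def by blast
  have low': "coeff g m \<in> p" if "m < j" for m using that not_less_Least unfolding j_def by blast
  have "coeff (f * g) (i + j) = coeff f i * coeff g (i + j - i) + (\<Sum>m\<in>{..i + j} - {i}. coeff f m * coeff g (i + j - m))"
    unfolding coeff_mult by (rule sum.remove) auto
  moreover have "(\<Sum>m\<in>{..i + j} - {i}. coeff f m * coeff g (i + j - m)) \<in> p"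
  proof (rule ideal_sum[OF p])
    fix m assume "m \<in> {..i + j} - {i}"
    then have "m < i \<or> i + j - m < j" by auto
    then show "coeff f m * coeff g (i + j - m) \<in> p"
      using low low' ideal_mult_left[OF p] ideal_mult_right[OF p] by blast
  qed
  ultimately have "coeff f i * coeff g j \<in> p"
    using fg[of "i + j"] ideal_diff[OF p] by (metis add_diff_cancel_left' add_diff_cancel_right')
  then show False using pr ij by blast
qed

lemma poly_in_no_zero_div:
  fixes P Q :: "('n::finite, 'k::field) mpoly"
  assumes "P \<in> poly_in S" "Q \<in> poly_in S" "P * Q = 0"
  shows "P = 0 \<or> Q = 0"
  using finite[of S] assms
proof (induction S arbitrary: P Q rule: finite_induct)
  case empty
  note const = poly_in_empty
  have "P * Q = cst (lkp P 0) * cst (lkp Q 0)" using const empty by metis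
  then have "lkp P 0 * lkp Q 0 = 0" using empty
    by (simp add: mult_single) (metis lookup_single_eq lookup_zero mult_eq_0_iff)
  then show ?case using const[of P] const[of Q] empty by auto
next
  case (insert s S)
  have zero: "is_ideal ({0} :: ('n, 'k) mpoly set)" by (simp add: is_ideal_def)
  have "upoly s P * upoly s Q = 0" using insert by (simp add: upoly_zero flip: upoly_mult)
  then have "(\<forall>m. coeff (upoly s P) m \<in> {0}) \<or> (\<forall>m. coeff (upoly s Q) m \<in> {0})"
    using insert by (intro poly_coeffs_prime[OF zero]) (auto intro: insert.IH coeff_upoly_in)
  then have "upoly s P = 0 \<or> upoly s Q = 0" by (auto simp: poly_eq_iff)
  then show ?case by (simp add: upoly_eq_0_iff)
qed

interpretation poly_in: subdomain "poly_in S :: ('n::finite, 'k::field) mpoly set" for S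
proof
  show "1 \<in> (poly_in S :: ('n, 'k) mpoly set)" by (simp add: poly_in_def)
qed (rule poly_in_zero poly_in_add poly_in_mult poly_in_uminus poly_in_no_zero_div; assumption)+

lemma mpoly_no_zero_div: "P * Q = 0 \<Longrightarrow> P = 0 \<or> Q = 0" for P :: "('n::finite, 'k::field) mpoly"
  using poly_in_no_zero_div[of P UNIV Q] poly_in_UNIV by blast

lemma prime_ideal_zero: "prime_ideal ({0} :: ('n::finite, 'k::field) mpoly set)"
proof -
  have "(1 :: ('n, 'k) mpoly) \<notin> {0}" by simp
  then have "({0} :: ('n, 'k) mpoly set) \<noteq> UNIV" by blast
  moreover have "\<forall>a b :: ('n, 'k) mpoly. a * b = 0 \<longrightarrow> a = 0 \<or> b = 0"
    by (intro allI impI mpoly_no_zero_div)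
  ultimately show ?thesis unfolding prime_ideal_def is_ideal_def by simp
qed

section \<open>Formal partial derivatives\<close>

definition pd :: "'n \<Rightarrow> ('n, 'k::comm_ring_1) mpoly \<Rightarrow> ('n, 'k) mpoly" where
  "pd s P = (\<Sum>\<alpha>\<in>keys P. sgl (\<alpha> - sgl s 1) (of_nat (lkp \<alpha> s) * lkp P \<alpha>))"

lemma pd_superset:
  "finite K \<Longrightarrow> keys P \<subseteq> K \<Longrightarrow> pd s P = (\<Sum>\<alpha>\<in>K. sgl (\<alpha> - sgl s 1) (of_nat (lkp \<alpha> s) * lkp P \<alpha>))"
  unfolding pd_def by (rule sum.mono_neutral_left) (auto simp: in_keys_iff)

lemma pd_add: "pd s (P + Q) = pd s P + pd s Q"
proof -
  have "pd s R = (\<Sum>\<alpha>\<in>keys P \<union> keys Q. sgl (\<alpha> - sgl s 1) (of_nat (lkp \<alpha> s) * lkp R \<alpha>))"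
    if "R \<in> {P, Q, P + Q}" for R
    using that Poly_Mapping.keys_add[of P Q] by (intro pd_superset) auto
  then show ?thesis by (simp add: lookup_add distrib_left single_add sum.distrib)
qed

lemma pd_single: "pd s (sgl \<alpha> c) = sgl (\<alpha> - sgl s 1) (of_nat (lkp \<alpha> s) * c)"
  using pd_superset[of "{\<alpha>}" "sgl \<alpha> c"] by simp

lemma pd_mult: "pd s (P * Q) = P * pd s Q + Q * pd s P"
proof (induction P rule: mpoly_induct)
  case (single \<alpha> c)
  show ?case
  proof (induction Q rule: mpoly_induct)
    case (single \<beta> d)
    \<comment> \<open>Subtraction of exponents is truncated, so moving it past
      \<open>\<gamma>\<close> takes a positive exponent in \<open>\<delta>\<close>; where that
      fails, the coefficient below is zero.\<close>
    have sub: "\<gamma> + \<delta> - sgl s 1 = \<gamma> + (\<delta> - sgl s 1)" if "lkp \<delta> s > 0" for \<gamma> \<delta> :: "'a \<Rightarrow>\<^sub>0 nat"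
      using that by (intro poly_mapping_eqI) (auto simp: lookup_add lookup_minus lookup_single when_def)
    have 1: "sgl (\<alpha> + \<beta> - sgl s 1) (of_nat (lkp \<beta> s) * (c * d)) = sgl (\<alpha> + (\<beta> - sgl s 1)) (of_nat (lkp \<beta> s) * (c * d))"
      by (cases "lkp \<beta> s = 0") (simp_all del: One_nat_def add: sub)
    have 2: "sgl (\<alpha> + \<beta> - sgl s 1) (of_nat (lkp \<alpha> s) * (c * d)) = sgl (\<beta> + (\<alpha> - sgl s 1)) (of_nat (lkp \<alpha> s) * (c * d))"
      unfolding add.commute[of \<alpha> \<beta>] by (cases "lkp \<alpha> s = 0") (simp_all del: One_nat_def add: sub)
    have "pd s (sgl \<alpha> c * sgl \<beta> d) = sgl (\<alpha> + \<beta> - sgl s 1) (of_nat (lkp \<beta> s) * (c * d)) + sgl (\<alpha> + \<beta> - sgl s 1) (of_nat (lkp \<alpha> s) * (c * d))"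
      by (simp add: mult_single pd_single lookup_add algebra_simps flip: single_add)
    then show ?case unfolding 1 2 by (simp add: pd_single mult_single mult_ac)
  qed (simp add: pd_add algebra_simps)
qed (simp add: pd_add algebra_simps)

lemma pd_const: "P \<in> poly_in S \<Longrightarrow> s \<notin> S \<Longrightarrow> pd s P = 0"
proof -
  assume "P \<in> poly_in S" "s \<notin> S"
  then have "lkp \<alpha> s = 0" if "\<alpha> \<in> keys P" for \<alpha> using that by (auto simp: poly_in_def)
  then show ?thesis unfolding pd_def by (intro sum.neutral) simp
qed

lemma pd_in: "P \<in> poly_in S \<Longrightarrow> pd s P \<in> poly_in S"
  unfolding pd_def
  by (intro poly_in_sum) (auto simp: poly_in_def lookup_minus split: if_splits)

lemma lookup_pd: "lkp (pd s P) \<beta> = of_nat (Suc (lkp \<beta> s)) * lkp P (\<beta> + sgl s 1)"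
proof -
  have "(if \<alpha> - sgl s 1 = \<beta> then of_nat (lkp \<alpha> s) * lkp P \<alpha> else 0) =
     (if \<alpha> = \<beta> + sgl s 1 then of_nat (lkp \<alpha> s) * lkp P \<alpha> else 0)" for \<alpha>
  proof (cases "lkp \<alpha> s = 0")
    case False
    then have "\<alpha> - sgl s 1 = \<beta> \<longleftrightarrow> \<alpha> = \<beta> + sgl s 1"
      by (auto simp: poly_mapping_eq_iff fun_eq_iff lookup_add lookup_minus lookup_single when_def)
    then show ?thesis by simp
  qed (auto simp: lookup_add)
  then have "lkp (pd s P) \<beta> = (\<Sum>\<alpha>\<in>keys P. if \<alpha> = \<beta> + sgl s 1 then of_nat (lkp \<alpha> s) * lkp P \<alpha> else 0)"
    by (simp add: pd_def lookup_sum lookup_single when_def)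
  then show ?thesis by (simp add: in_keys_iff lookup_add)
qed

section \<open>Codimension of primes\<close>

text \<open>The relation for \<open>t_i\<close> lowers the exponent of \<open>t_i\<close> at the
  price of its leading coefficient, a nonzero element of \<open>k[S]\<close>, which torsion absorbs.
  So the torsion span of finitely many monomials contains 1 and is closed under multiplication by
  every variable.\<close>

lemma finite_torsion_span:
  fixes J :: "('n::finite, 'k::field) mpoly set"
  assumes J: "is_ideal J" and alg: "\<And>i. i \<notin> S \<Longrightarrow> \<exists>\<psi>\<in>J. \<psi> \<in> poly_in (insert i S) \<and> \<psi> \<noteq> 0"
  shows "\<exists>X. finite X \<and> (\<forall>h. h \<in> poly_in.torsion_span S X J)"
proof -
  from alg obtain \<psi> where \<psi>: "\<And>i. i \<notin> S \<Longrightarrow> \<psi> i \<in> J \<and> \<psi> i \<in> poly_in (insert i S) \<and> \<psi> i \<noteq> 0" by metis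
  define \<delta> where "\<delta> i = degree (upoly i (\<psi> i))" for i
  define K where "K = {\<alpha>::'n \<Rightarrow>\<^sub>0 nat. \<forall>i. lkp \<alpha> i \<le> (if i \<in> S then 0 else \<delta> i)}"
  define X :: "('n, 'k) mpoly set" where "X = (\<lambda>\<alpha>. sgl \<alpha> 1) ` K"
  let ?Y = "poly_in.torsion_span S X J"
  have "finite (lkp ` K)"
  proof (rule finite_subset)
    show "lkp ` K \<subseteq> Pi\<^sub>E UNIV (\<lambda>i. {..(if i \<in> S then 0 else \<delta> i)})" by (auto simp: K_def PiE_iff)
    show "finite (Pi\<^sub>E (UNIV::'n set) (\<lambda>i. {..(if i \<in> S then 0 else \<delta> i)}))" by (intro finite_PiE) auto
  qed
  then have "finite K" by (rule finite_imageD) (auto intro!: inj_onI poly_mapping_eqI)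
  then have finX: "finite X" by (simp add: X_def)
  have base: "e \<in> ?Y" if "e \<in> X" for e
    using that finX by (intro poly_in.torsion_span_base[OF J] poly_in.span_base)
  have varX: "Var i * e \<in> ?Y" if e: "e \<in> X" for i e
  proof (cases "i \<in> S")
    case True
    then show ?thesis using base[OF e] by (intro poly_in.torsion_span_scale[OF J] poly_in_Var)
  next
    case False
    from e obtain \<alpha> where \<alpha>: "\<alpha> \<in> K" "e = sgl \<alpha> 1" by (auto simp: X_def)
    define \<gamma> where "\<gamma> = drop_var i \<alpha>"
    have inK: "\<gamma> + sgl i m \<in> K" if "m \<le> \<delta> i" for m
      using \<alpha>(1) that False by (auto simp: K_def \<gamma>_def lookup_add lookup_drop_var lookup_single when_def split: if_splits)
    have mono: "sgl \<gamma> 1 * Var i ^ m = sgl (\<gamma> + sgl i m) (1::'k)" for m by (simp add: Var_power mult_single)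
    have e_eq: "Var i * e = sgl \<gamma> 1 * Var i ^ Suc (lkp \<alpha> i)"
      using drop_var_plus[of i \<alpha>] mono[of "lkp \<alpha> i"] by (simp add: \<alpha>(2) \<gamma>_def mult_ac)
    show ?thesis
    proof (cases "lkp \<alpha> i < \<delta> i")
      case True
      then show ?thesis unfolding e_eq mono by (intro base) (auto simp: X_def intro!: inK)
    next
      case not_less: False
      then have deg: "lkp \<alpha> i = \<delta> i" using \<alpha>(1) False by (simp add: K_def) (metis antisym_conv2)
      define b where "b m = coeff (upoly i (\<psi> i)) m" for m
      have bB: "b m \<in> poly_in S" for m unfolding b_def using \<psi> False by (intro coeff_upoly_in) auto
      have bd: "b (\<delta> i) \<noteq> 0" using \<psi>[OF False] by (simp add: b_def \<delta>_def upoly_eq_0_iff)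
      have "\<psi> i = (\<Sum>m\<le>\<delta> i. b m * Var i ^ m)"
        using poly_upoly[of i "\<psi> i"] by (simp add: poly_altdef b_def \<delta>_def)
      also have "\<dots> = (\<Sum>m<\<delta> i. b m * Var i ^ m) + b (\<delta> i) * Var i ^ \<delta> i"
        by (simp flip: lessThan_Suc_atMost)
      finally have "b (\<delta> i) * (Var i * e) = sgl \<gamma> 1 * Var i * (\<psi> i - (\<Sum>m<\<delta> i. b m * Var i ^ m))"
        unfolding e_eq deg by (simp add: algebra_simps)
      also have "\<dots> = sgl \<gamma> 1 * Var i * \<psi> i + (\<Sum>m<\<delta> i. - b m * (sgl \<gamma> 1 * Var i ^ Suc m))"
        by (simp add: algebra_simps sum_distrib_left sum_negf)
      also have "\<dots> \<in> ?Y"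
      proof (intro poly_in.torsion_span_add[OF J] poly_in.torsion_span_sum[OF J])
        show "sgl \<gamma> 1 * Var i * \<psi> i \<in> ?Y"
          using \<psi>[OF False] by (intro poly_in.torsion_span_ideal[OF J] ideal_mult_left[OF J]) auto
        fix m assume "m \<in> {..<\<delta> i}"
        then show "- b m * (sgl \<gamma> 1 * Var i ^ Suc m) \<in> ?Y"
          unfolding mono using bB
          by (intro poly_in.torsion_span_scale[OF J] base poly_in_uminus) (auto simp: X_def intro!: inK)
      qed
      finally show ?thesis using poly_in.torsion_span_div bB bd by blast
    qed
  qed
  have var: "Var i * h \<in> ?Y" if h: "h \<in> ?Y" for i h
  proof -
    from h obtain b c where b: "b \<in> poly_in S" "b \<noteq> 0" "\<forall>x\<in>X. c x \<in> poly_in S" "b * h - (\<Sum>x\<in>X. c x * x) \<in> J"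
      unfolding poly_in.torsion_span_def poly_in.span_def by blast
    have "b * (Var i * h) = Var i * (b * h - (\<Sum>x\<in>X. c x * x)) + (\<Sum>x\<in>X. c x * (Var i * x))"
      by (simp add: algebra_simps sum_distrib_left)
    also have "\<dots> \<in> ?Y"
    proof (intro poly_in.torsion_span_add[OF J] poly_in.torsion_span_sum[OF J])
      show "Var i * (b * h - (\<Sum>x\<in>X. c x * x)) \<in> ?Y"
        using b(4) by (intro poly_in.torsion_span_ideal[OF J] ideal_mult_left[OF J])
      show "c x * (Var i * x) \<in> ?Y" if "x \<in> X" for x
        using b(3) that by (intro poly_in.torsion_span_scale[OF J varX]) auto
    qed
    finally show ?thesis using poly_in.torsion_span_div b by blast
  qed
  have mono: "sgl \<alpha> c \<in> ?Y" for \<alpha> c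
  proof (induction \<alpha> rule: monomial_induct)
    case zero
    have "sgl 0 1 \<in> X" unfolding X_def by (rule imageI) (simp add: K_def)
    then show ?case
      using poly_in.torsion_span_scale[OF J base poly_in_cst[of c], of "sgl 0 1"] by (simp add: mult_single)
  next
    case (add i \<beta>)
    then have "Var i * sgl \<beta> c \<in> ?Y" by (rule var)
    then show ?case by (simp add: Var_def mult_single)
  qed
  have "h \<in> ?Y" for h
    by (induction h rule: mpoly_induct) (auto intro: mono poly_in.torsion_span_add[OF J])
  then show ?thesis using finX by blast
qed

definition indep :: "'n set \<Rightarrow> ('n, 'k::zero) mpoly set \<Rightarrow> bool" where
  "indep S p \<longleftrightarrow> poly_in S \<inter> p \<subseteq> {0}"

text \<open>For a prime \<open>p\<close> this is the transcendence degree of the quotient: the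
  variables generate it, so a transcendence basis can be chosen among them.\<close>

definition tdeg_quot :: "('n::finite, 'k::zero) mpoly set \<Rightarrow> nat" where
  "tdeg_quot p = Max (card ` {S. indep S p})"

definition codim :: "('n::finite, 'k::zero) mpoly set \<Rightarrow> nat" where
  "codim p = CARD('n) - tdeg_quot p"

lemma indep_empty:
  fixes p :: "('n::finite, 'k::field) mpoly set"
  assumes p: "prime_ideal p"
  shows "indep {} p"
  unfolding indep_def
proof
  fix P assume P: "P \<in> poly_in {} \<inter> p"
  have eq: "P = cst (lkp P 0)" using P by (intro poly_in_empty) auto
  have "lkp P 0 = 0"
  proof (rule ccontr)
    assume "lkp P 0 \<noteq> 0"
    then have "cst (inverse (lkp P 0)) * P = 1" by (subst (2) eq) (simp add: mult_single)
    then show False using P prime_ideal_one[OF p] ideal_mult_left[OF prime_ideal_ideal[OF p]]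
      by (metis IntD2)
  qed
  then show "P \<in> {0}" using eq by simp
qed

lemma tdeg_quot_ge: "indep S p \<Longrightarrow> card S \<le> tdeg_quot p"
  unfolding tdeg_quot_def by (intro Max_ge) auto

lemma obtain_max_indep:
  fixes p :: "('n::finite, 'k::field) mpoly set"
  assumes p: "prime_ideal p"
  obtains S where "indep S p" "card S = tdeg_quot p"
    "\<And>i. i \<notin> S \<Longrightarrow> \<exists>\<psi>\<in>p. \<psi> \<in> poly_in (insert i S) \<and> \<psi> \<noteq> 0"
proof -
  have "tdeg_quot p \<in> card ` {S. indep S p}"
    unfolding tdeg_quot_def using indep_empty[OF p] by (intro Max_in) auto
  then obtain S where S: "indep S p" "card S = tdeg_quot p" by auto
  moreover have "\<exists>\<psi>\<in>p. \<psi> \<in> poly_in (insert i S) \<and> \<psi> \<noteq> 0" if "i \<notin> S" for i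
  proof -
    have "\<not> indep (insert i S) p" using tdeg_quot_ge[of "insert i S" p] S that by auto
    then show ?thesis by (auto simp: indep_def)
  qed
  ultimately show ?thesis using that by blast
qed

lemma tdeg_quot_le:
  fixes p :: "('n::finite, 'k::field) mpoly set"
  shows "prime_ideal p \<Longrightarrow> tdeg_quot p \<le> CARD('n)"
  using obtain_max_indep[of p] by (metis card_mono finite subset_UNIV)

lemma tdeg_quot_codim:
  fixes p :: "('n::finite, 'k::field) mpoly set"
  shows "prime_ideal p \<Longrightarrow> tdeg_quot p + codim p = CARD('n)"
  using tdeg_quot_le[of p] by (simp add: codim_def)

text \<open>A set \<open>S\<close> independent modulo \<open>q\<close> is independent modulo
  \<open>p\<close>. Were it also of maximal size there, the quotient by \<open>p\<close> would have
  finite rank over \<open>k[S]\<close>, and an element of \<open>q\<close> outside \<open>p\<close>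
  would divide some nonzero \<open>b\<close> of \<open>k[S]\<close> modulo \<open>p\<close>. Then
  \<open>b\<close> lies in \<open>q\<close>, against independence.\<close>

lemma codim_strict_mono:
  fixes p q :: "('n::finite, 'k::field) mpoly set"
  assumes p: "prime_ideal p" and q: "prime_ideal q" and pq: "p \<subset> q"
  shows "codim p < codim q"
proof -
  obtain S where S: "indep S q" "card S = tdeg_quot q" using obtain_max_indep[OF q] by blast
  have Sp: "indep S p" using S pq by (auto simp: indep_def)
  then have le: "tdeg_quot q \<le> tdeg_quot p" using tdeg_quot_ge S by metis
  have "tdeg_quot q \<noteq> tdeg_quot p"
  proof
    assume eq: "tdeg_quot q = tdeg_quot p"
    have alg: "\<exists>\<psi>\<in>p. \<psi> \<in> poly_in (insert i S) \<and> \<psi> \<noteq> 0" if "i \<notin> S" for i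
    proof -
      have "\<not> indep (insert i S) p" using tdeg_quot_ge[of "insert i S" p] S eq that by auto
      then show ?thesis by (auto simp: indep_def)
    qed
    obtain X where X: "finite X" "\<And>h. h \<in> poly_in.torsion_span S X p"
      using finite_torsion_span[OF prime_ideal_ideal[OF p] alg] by blast
    obtain f where f: "f \<in> q" "f \<notin> p" using pq by blast
    have cancel: "h \<in> p" if "f * h \<in> p" for h using prime_ideal_multD[OF p that] f by blast
    obtain b g where b: "b \<in> poly_in S" "b \<noteq> 0" "b - f * g \<in> p"
      using poly_in.invertible_up_to_torsion[OF prime_ideal_ideal[OF p] X cancel] by blast
    have "b \<in> q"
      using ideal_diff_iff[OF prime_ideal_ideal[OF q], of b "f * g"] b(3) pq ideal_mult_right[OF prime_ideal_ideal[OF q] f(1)] by blast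
    then show False using b S by (auto simp: indep_def)
  qed
  then show ?thesis using le tdeg_quot_codim[OF p] tdeg_quot_codim[OF q] by linarith
qed

lemma codim_zero: "codim ({0} :: ('n::finite, 'k::field) mpoly set) = 0"
proof -
  have "indep UNIV ({0} :: ('n, 'k) mpoly set)" by (auto simp: indep_def)
  from tdeg_quot_ge[OF this] show ?thesis by (simp add: codim_def)
qed

section \<open>Minimal primes, prime chains and height\<close>

definition minimal_prime :: "'a::comm_ring_1 set \<Rightarrow> 'a set \<Rightarrow> bool" where
  "minimal_prime G p \<longleftrightarrow> prime_ideal p \<and> G \<subseteq> p \<and> (\<forall>p'. prime_ideal p' \<longrightarrow> G \<subseteq> p' \<longrightarrow> p' \<subseteq> p \<longrightarrow> p' = p)"

text \<open>Among the primes between \<open>G\<close> and \<open>q\<close> one of least codimension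
  is minimal, by strict monotonicity.\<close>

lemma obtain_minimal_prime:
  fixes q :: "('n::finite, 'k::field) mpoly set"
  assumes "prime_ideal q" "G \<subseteq> q"
  obtains p where "minimal_prime G p" "p \<subseteq> q"
proof -
  obtain p where p: "prime_ideal p \<and> G \<subseteq> p \<and> p \<subseteq> q" and
    min: "\<And>p'. prime_ideal p' \<and> G \<subseteq> p' \<and> p' \<subseteq> q \<Longrightarrow> codim p \<le> codim p'"
    using ex_has_least_nat[of "\<lambda>p. prime_ideal p \<and> G \<subseteq> p \<and> p \<subseteq> q" q codim] assms by blast
  have "minimal_prime G p"
    unfolding minimal_prime_def
  proof (intro conjI allI impI)
    fix p' assume p': "prime_ideal p'" "G \<subseteq> p'" "p' \<subseteq> p"
    show "p' = p"
    proof (rule ccontr)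
      assume "p' \<noteq> p"
      then have "codim p' < codim p" using codim_strict_mono p p' by blast
      moreover have "codim p \<le> codim p'" using min p p' by blast
      ultimately show False by simp
    qed
  qed (use p in auto)
  then show ?thesis using that p by blast
qed

text \<open>One step down the chain frees a variable \<open>s\<close> outside \<open>S\<close>: the
  prime is replaced by the extension of its contraction to the ring without \<open>t_s\<close>, and
  \<open>S\<close> by \<open>insert s S\<close>, for which the assumptions hold again.\<close>

lemma chain_exists:
  fixes p :: "('n::finite, 'k::field) mpoly set"
  assumes "prime_ideal p" "indep S p" "\<And>i. i \<notin> S \<Longrightarrow> \<exists>\<psi>\<in>p. \<psi> \<in> poly_in (insert i S) \<and> \<psi> \<noteq> 0"
  shows "\<exists>c. prime_chain c (card (- S)) \<and> c (card (- S)) = p"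
  using assms
proof (induction "card (- S)" arbitrary: S p)
  case 0
  then show ?case by (intro exI[of _ "\<lambda>_. p"]) (auto simp: prime_chain_def)
next
  case (Suc r)
  then have "- S \<noteq> {}" by (metis card.empty nat.distinct(1))
  then obtain s where s: "s \<notin> S" by blast
  note P = prime_ideal_ideal[OF Suc.prems(1)]
  define p' where "p' = {f. \<forall>m. coeff (upoly s f) m \<in> p}"
  have p'p: "p' \<subseteq> p"
  proof
    fix f assume "f \<in> p'"
    then have "poly (upoly s f) (Var s) \<in> p" unfolding poly_altdef p'_def
      by (intro ideal_sum[OF P] ideal_mult_right[OF P]) auto
    then show "f \<in> p" by (simp add: poly_upoly)
  qed
  have ideal: "is_ideal p'" unfolding is_ideal_def
  proof (intro conjI ballI allI)
    show "0 \<in> p'" by (simp add: p'_def upoly_zero ideal_zero[OF P])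
    show "f + g \<in> p'" if "f \<in> p'" "g \<in> p'" for f g
      using that by (auto simp: p'_def upoly_add intro: ideal_add[OF P])
    show "g * f \<in> p'" if "f \<in> p'" for f g
      using that by (auto simp: p'_def upoly_mult coeff_mult intro!: ideal_sum[OF P] ideal_mult_left[OF P])
  qed
  have prime: "prime_ideal p'"
    unfolding prime_ideal_def
  proof (intro conjI allI impI ideal)
    show "p' \<noteq> UNIV" using p'p prime_ideal_one[OF Suc.prems(1)] by blast
    fix f g assume "f * g \<in> p'"
    then show "f \<in> p' \<or> g \<in> p'"
      unfolding p'_def mem_Collect_eq upoly_mult
      by (intro poly_coeffs_prime[OF P]) (auto dest: prime_ideal_multD[OF Suc.prems(1)])
  qed
  have ind: "indep (insert s S) p'" unfolding indep_def
  proof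
    fix f assume f: "f \<in> poly_in (insert s S) \<inter> p'"
    have "coeff (upoly s f) m = 0" for m
      using coeff_upoly_in[of f s S m] s f Suc.prems(2) by (auto simp: p'_def indep_def)
    then have "upoly s f = 0" by (simp add: poly_eq_iff)
    then show "f \<in> {0}" by (simp add: upoly_eq_0_iff)
  qed
  \<comment> \<open>A relation in the variables \<open>S\<close> and \<open>i\<close> does not
    involve \<open>t_s\<close>, so it is its own constant coefficient and survives in
    \<open>p'\<close>.\<close>
  have alg: "\<exists>\<psi>\<in>p'. \<psi> \<in> poly_in (insert i (insert s S)) \<and> \<psi> \<noteq> 0" if i: "i \<notin> insert s S" for i
  proof -
    obtain \<psi> where \<psi>: "\<psi> \<in> p" "\<psi> \<in> poly_in (insert i S)" "\<psi> \<noteq> 0" using Suc.prems(3) i by blast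
    have "upoly s \<psi> = [:\<psi>:]" using s i by (intro upoly_const[OF \<psi>(2)]) auto
    then have "\<psi> \<in> p'" using \<psi> ideal_zero[OF P] by (auto simp: p'_def coeff_pCons split: nat.splits)
    then show ?thesis using \<psi> poly_in_mono[of "insert i S" "insert i (insert s S)"] by blast
  qed
  have r: "r = card (- insert s S)"
  proof -
    have "- S = insert s (- insert s S)" using s by auto
    then have "card (- S) = Suc (card (- insert s S))" by (metis ComplD card_insert_disjoint finite insertI1)
    then show ?thesis using Suc.hyps(2) by simp
  qed
  obtain c where c: "prime_chain c r" "c r = p'" using Suc.hyps(1)[OF r prime ind alg] r by auto
  have "p' \<noteq> p"
  proof
    assume eq: "p' = p"
    obtain \<psi> where "\<psi> \<in> p" "\<psi> \<in> poly_in (insert s S)" "\<psi> \<noteq> 0" using Suc.prems(3) s by blast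
    then show False using ind eq by (auto simp: indep_def)
  qed
  then have "prime_chain (c(Suc r := p)) (Suc r)"
    using c p'p Suc.prems(1) by (auto simp: prime_chain_def less_Suc_eq le_Suc_eq)
  then show ?case unfolding Suc.hyps(2)[symmetric] by (intro exI[of _ "c(Suc r := p)"]) auto
qed

lemma prime_chain_codim:
  fixes c :: "nat \<Rightarrow> ('n::finite, 'k::field) mpoly set"
  shows "prime_chain c r \<Longrightarrow> r \<le> codim (c r)"
proof (induction r)
  case (Suc r)
  then have "prime_chain c r" by (auto simp: prime_chain_def)
  then have "r \<le> codim (c r)" by (rule Suc.IH)
  also have "codim (c r) < codim (c (Suc r))" using Suc.prems by (intro codim_strict_mono) (auto simp: prime_chain_def)
  finally show ?case by simp
qed simp

lemma has_height_codim:
  fixes p :: "('n::finite, 'k::field) mpoly set"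
  assumes p: "prime_ideal p"
  shows "has_height p (codim p)"
proof -
  obtain S where S: "indep S p" "card S = tdeg_quot p"
    "\<And>i. i \<notin> S \<Longrightarrow> \<exists>\<psi>\<in>p. \<psi> \<in> poly_in (insert i S) \<and> \<psi> \<noteq> 0" using obtain_max_indep[OF p] by blast
  have "card (- S) = codim p" using S(2) by (simp add: codim_def Compl_eq_Diff_UNIV card_Diff_subset)
  then show ?thesis using chain_exists[OF p S(1,3)] prime_chain_codim unfolding has_height_def by metis
qed

text \<open>For a relation of least degree in \<open>t_i\<close>, the derivative, if it were in
  \<open>q\<close>, would have smaller degree and hence vanish. In characteristic zero the relation
  would then be free of \<open>t_i\<close>, against the independence of \<open>S\<close>.\<close>

lemma obtain_separable:
  fixes q :: "('n::finite, 'k::field_char_0) mpoly set"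
  assumes q: "prime_ideal q" and S: "indep S q" and i: "i \<notin> S"
    and ex: "\<exists>\<psi>\<in>q. \<psi> \<in> poly_in (insert i S) \<and> \<psi> \<noteq> 0"
  shows "\<exists>\<phi>\<in>q. \<phi> \<in> poly_in (insert i S) \<and> \<phi> \<noteq> 0 \<and> pd i \<phi> \<notin> q"
proof -
  define Q where "Q m \<phi> \<longleftrightarrow> \<phi> \<in> q \<and> \<phi> \<in> poly_in (insert i S) \<and> \<phi> \<noteq> 0 \<and> (\<forall>\<alpha>\<in>keys \<phi>. lkp \<alpha> i \<le> m)" for m \<phi>
  have "\<exists>m. \<exists>\<phi>. Q m \<phi>"
  proof -
    obtain \<psi> where \<psi>: "\<psi> \<in> q" "\<psi> \<in> poly_in (insert i S)" "\<psi> \<noteq> 0" using ex by blast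
    have "\<forall>\<alpha>\<in>keys \<psi>. lkp \<alpha> i \<le> Max ((\<lambda>\<alpha>. lkp \<alpha> i) ` keys \<psi>)" by auto
    then show ?thesis using \<psi> unfolding Q_def by blast
  qed
  then obtain m where m: "\<exists>\<phi>. Q m \<phi>" and least: "\<And>m'. m' < m \<Longrightarrow> \<not> (\<exists>\<phi>. Q m' \<phi>)"
    using exists_least_iff[of "\<lambda>m. \<exists>\<phi>. Q m \<phi>"] by blast
  then obtain \<phi> where \<phi>: "Q m \<phi>" by blast
  have "pd i \<phi> \<notin> q"
  proof
    assume pdq: "pd i \<phi> \<in> q"
    have mpos: "m \<noteq> 0"
    proof
      assume "m = 0"
      have "j \<in> S" if "\<alpha> \<in> keys \<phi>" "lkp \<alpha> j \<noteq> 0" for \<alpha> j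
      proof -
        have "lkp \<alpha> i = 0" "j \<in> insert i S" using \<phi> \<open>m = 0\<close> that by (auto simp: Q_def poly_in_def)
        then show ?thesis using that(2) by auto
      qed
      then have "\<phi> \<in> poly_in S" by (simp add: poly_in_def)
      then show False using \<phi> S by (auto simp: Q_def indep_def)
    qed
    have bound: "lkp \<beta> i \<le> m - 1" if "\<beta> \<in> keys (pd i \<phi>)" for \<beta>
    proof -
      have "\<beta> + sgl i 1 \<in> keys \<phi>" using that by (auto simp: in_keys_iff lookup_pd)
      then have "lkp (\<beta> + sgl i 1) i \<le> m" using \<phi> by (auto simp: Q_def)
      then show ?thesis by (simp add: lookup_add)
    qed
    have "pd i \<phi> = 0"
    proof (rule ccontr)
      assume "pd i \<phi> \<noteq> 0"
      then have "Q (m - 1) (pd i \<phi>)" using pdq \<phi> pd_in bound by (auto simp: Q_def)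
      then show False using least[of "m - 1"] mpos by auto
    qed
    have "lkp \<alpha> i = 0" if "\<alpha> \<in> keys \<phi>" for \<alpha>
    proof (rule ccontr)
      assume nz: "lkp \<alpha> i \<noteq> 0"
      define \<beta> where "\<beta> = \<alpha> - sgl i 1"
      have \<alpha>: "\<alpha> = \<beta> + sgl i 1" using nz
        by (intro poly_mapping_eqI) (auto simp: \<beta>_def lookup_add lookup_minus lookup_single when_def)
      have "lkp (pd i \<phi>) \<beta> \<noteq> 0" using that unfolding lookup_pd \<alpha>[symmetric] by (simp add: in_keys_iff del: of_nat_Suc)
      then show False using \<open>pd i \<phi> = 0\<close> by simp
    qed
    then have "Q 0 \<phi>" using \<phi> by (auto simp: Q_def)
    then show False using least[of 0] mpos by auto
  qed
  then show ?thesis using \<phi> by (auto simp: Q_def)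
qed

text \<open>Krull's height theorem. The relations for the variables outside \<open>S\<close>, chosen
  with derivative outside \<open>q\<close>, are the parameters of \<open>height_setup\<close>; there
  is one for each such variable, so their number is the codimension.\<close>

theorem codim_le_generators:
  fixes q :: "('n::finite, 'k::field_char_0) mpoly set"
  assumes min: "minimal_prime (set fs) q"
  shows "codim q \<le> length fs"
proof -
  have q: "prime_ideal q" "set fs \<subseteq> q" using min by (auto simp: minimal_prime_def)
  obtain S where S: "indep S q" "card S = tdeg_quot q"
    "\<And>i. i \<notin> S \<Longrightarrow> \<exists>\<psi>\<in>q. \<psi> \<in> poly_in (insert i S) \<and> \<psi> \<noteq> 0" using obtain_max_indep[OF q(1)] by blast
  have "\<exists>\<phi>\<in>q. \<phi> \<in> poly_in (insert i S) \<and> \<phi> \<noteq> 0 \<and> pd i \<phi> \<notin> q" if "i \<in> - S" for i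
    using obtain_separable[OF q(1) S(1)] S(3) that by auto
  then obtain \<phi> where \<phi>: "\<And>i. i \<in> - S \<Longrightarrow> \<phi> i \<in> q \<and> \<phi> i \<in> poly_in (insert i S) \<and> \<phi> i \<noteq> 0 \<and> pd i (\<phi> i) \<notin> q"
    by metis
  interpret height_setup "poly_in S" q "- S" \<phi> pd
  proof
    show "b = 0" if "b \<in> poly_in S" "b \<in> q" for b using that S(1) by (auto simp: indep_def)
    show "pd i (\<phi> j) = 0" if "i \<in> - S" "j \<in> - S" "i \<noteq> j" for i j
      using \<phi>[OF that(2)] that by (intro pd_const[of _ "insert j S"]) auto
    show "b = 0" if "of_nat (Suc n) * b = 0" for b :: "('n, 'k) mpoly" and n
    proof (rule poly_mapping_eqI)
      fix \<alpha>
      have "of_nat (Suc n) * lkp b \<alpha> = lkp (cst (of_nat (Suc n)) * b) \<alpha>" by (rule lookup_cst_mult[symmetric])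
      also have "cst (of_nat (Suc n)) * b = 0" using that by (simp del: of_nat_Suc)
      finally show "lkp b \<alpha> = lkp 0 \<alpha>" by (simp del: of_nat_Suc)
    qed
    show "prime_ideal q" by (rule q)
    show "finite (- S)" by simp
    show "\<phi> i \<in> q" "pd i (\<phi> i) \<notin> q" if "i \<in> - S" for i using \<phi>[OF that] by auto
    show "pd i b = 0" if "i \<in> - S" "b \<in> poly_in S" for i b using that by (intro pd_const) auto
  qed (rule pd_add pd_mult)+
  define E where "E = rec_nat UNIV (\<lambda>_ Ej. {h. \<exists>g. g \<notin> q \<and> (\<exists>r. (\<forall>i. r i \<in> Ej) \<and> g * h = (\<Sum>i<length fs. fs ! i * r i))})"
  have E0: "E 0 = UNIV" and ES: "\<And>j. E (Suc j) = {h. \<exists>g. g \<notin> q \<and> (\<exists>r. (\<forall>i. r i \<in> E j) \<and> g * h = (\<Sum>i<length fs. fs ! i * r i))}"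
    by (auto simp: E_def)
  define J where "J = {h. \<exists>r. h = (\<Sum>i<length fs. fs ! i * r i)}"
  have J: "is_ideal J" unfolding is_ideal_def
  proof (intro conjI ballI allI)
    show "0 \<in> J" by (auto simp: J_def intro!: exI[of _ "\<lambda>_. 0"])
    fix g assume "g \<in> J"
    then obtain r where r: "g = (\<Sum>i<length fs. fs ! i * r i)" by (auto simp: J_def)
    show "c * g \<in> J" for c
      by (auto simp: J_def r sum_distrib_left mult_ac intro!: exI[of _ "\<lambda>i. c * r i"])
    fix h assume "h \<in> J"
    then obtain r' where r': "h = (\<Sum>i<length fs. fs ! i * r' i)" by (auto simp: J_def)
    show "g + h \<in> J"
      by (auto simp: J_def r r' sum.distrib distrib_left intro!: exI[of _ "\<lambda>i. r i + r' i"])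
  qed
  have fsJ: "set fs \<subseteq> J"
  proof
    fix f assume "f \<in> set fs"
    then obtain k where k: "k < length fs" "f = fs ! k" by (auto simp: in_set_conv_nth)
    then have "f = (\<Sum>i<length fs. fs ! i * (if i = k then 1 else 0))" by (simp add: if_distrib cong: if_cong)
    then show "f \<in> J" unfolding J_def by (intro CollectI exI[of _ "\<lambda>i. if i = k then 1 else 0"])
  qed
  have Jq: "J \<subseteq> q"
    using q(2) by (auto simp: J_def intro!: ideal_sum[OF q_ideal] ideal_mult_right[OF q_ideal])
  have E1: "h \<in> E 1 \<longleftrightarrow> (\<exists>g. g \<notin> q \<and> g * h \<in> J)" for h
    by (auto simp: ES E0 J_def)
  \<comment> \<open>Here the minimality of \<open>q\<close> enters: some power of
    \<open>\<phi> i\<close> lies in \<open>E 1\<close>, which is a relation for \<open>t_i\<close>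
    over \<open>k[S]\<close> and makes the rank modulo \<open>E 1\<close> finite.\<close>
  have alg: "\<exists>\<psi>\<in>E 1. \<psi> \<in> poly_in (insert i S) \<and> \<psi> \<noteq> 0" if i: "i \<notin> S" for i
  proof -
    obtain g k where g: "g \<notin> q" "g * \<phi> i ^ k \<in> J"
      using min_prime_power[OF q(1) J Jq, of "\<phi> i"] min fsJ \<phi>[of i] i
      unfolding minimal_prime_def by (metis ComplI order_trans)
    then show ?thesis using \<phi>[of i] i E1
      by (intro bexI[of _ "\<phi> i ^ k"]) (auto intro: poly_in.pow_mem dest: poly_in.pow_nonzero[where S=UNIV, OF poly_in_UNIV])
  qed
  have "is_ideal (E 1)" by (rule E_ideal[OF q(2) E0 ES])
  from finite_torsion_span[OF this alg] obtain X where X: "finite X" "\<And>h. h \<in> poly_in.torsion_span S X (E 1)" by blast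
  have "card (- S) \<le> length fs" using card_T_le[OF q(2) E0 ES X] .
  then show ?thesis using S(2) by (simp add: codim_def Compl_eq_Diff_UNIV card_Diff_subset)
qed

section \<open>Growth of polynomials of bounded degree\<close>

definition degle :: "nat \<Rightarrow> ('n::finite, 'k::zero) mpoly set" where
  "degle s = {P. \<forall>\<alpha>\<in>keys P. sum (lkp \<alpha>) UNIV \<le> s}"

lemma degle_mono: "s \<le> s' \<Longrightarrow> P \<in> degle s \<Longrightarrow> P \<in> degle s'"
  by (auto simp: degle_def intro: order_trans)

lemma degle_exists: "\<exists>s. P \<in> degle s"
proof -
  have "\<forall>\<alpha>\<in>keys P. sum (lkp \<alpha>) UNIV \<le> Max ((\<lambda>\<alpha>. sum (lkp \<alpha>) UNIV) ` keys P)" by auto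
  then show ?thesis unfolding degle_def by blast
qed

lemma degle_zero: "0 \<in> degle s" by (simp add: degle_def)

lemma degle_add: "P \<in> degle s \<Longrightarrow> Q \<in> degle s \<Longrightarrow> P + Q \<in> degle s"
  for P :: "('n::finite, 'k::comm_ring_1) mpoly"
  using Poly_Mapping.keys_add[of P Q] unfolding degle_def by blast

lemma degle_mult:
  fixes P Q :: "('n::finite, 'k::comm_ring_1) mpoly"
  assumes "P \<in> degle a" "Q \<in> degle b"
  shows "P * Q \<in> degle (a + b)"
  unfolding degle_def
proof (intro CollectI ballI)
  fix \<gamma> assume "\<gamma> \<in> keys (P * Q)"
  then obtain \<alpha> \<beta> where "\<gamma> = \<alpha> + \<beta>" "\<alpha> \<in> keys P" "\<beta> \<in> keys Q" using Poly_Mapping.keys_mult[of P Q] by auto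
  then show "sum (lkp \<gamma>) UNIV \<le> a + b"
    using assms by (auto simp: lookup_add sum.distrib degle_def intro: add_mono)
qed

lemma degle_scale: "P \<in> degle s \<Longrightarrow> cst c * P \<in> degle s" for P :: "('n::finite, 'k::comm_ring_1) mpoly"
  using degle_mult[of "cst c" 0 P s] by (auto simp: degle_def split: if_splits)

lemma card_monomials:
  shows finite_monomials: "finite {\<alpha>::'n::finite \<Rightarrow>\<^sub>0 nat. (\<forall>i. i \<notin> S \<longrightarrow> lkp \<alpha> i = 0) \<and> sum (lkp \<alpha>) S \<le> s}" (is "finite ?M")
    and "card {\<alpha>::'n::finite \<Rightarrow>\<^sub>0 nat. (\<forall>i. i \<notin> S \<longrightarrow> lkp \<alpha> i = 0) \<and> sum (lkp \<alpha>) S \<le> s} = (s + card S) choose card S"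
proof -
  let ?F = "{a::'n \<Rightarrow> nat. (\<forall>i. i \<notin> S \<longrightarrow> a i = 0) \<and> sum a S \<le> s}"
  have "bij_betw lkp ?M ?F"
  proof (rule bij_betw_byWitness[where f' = Abs_poly_mapping])
    show "Abs_poly_mapping ` ?F \<subseteq> ?M" by (auto simp: lookup_Abs_poly_mapping)
  qed (auto simp: lookup_Abs_poly_mapping lookup_inverse)
  then show "finite ?M" "card ?M = (s + card S) choose card S"
    using card_bounded_sum[of S s] by (auto simp: bij_betw_finite bij_betw_same_card)
qed

text \<open>\<open>N\<close> is a lower bound for the Hilbert function of the quotient by
  \<open>p\<close> at \<open>s\<close>. Explicit vectors are convenient, since lower bounds are all
  that is combined later.\<close>

definition free_mod :: "('n::finite, 'k::comm_ring_1) mpoly set \<Rightarrow> nat \<Rightarrow> nat \<Rightarrow> bool" where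
  "free_mod p s N \<longleftrightarrow> (\<exists>v. (\<forall>i<N. v i \<in> degle s) \<and>
     (\<forall>c. (\<Sum>i<N. cst (c i) * v i) \<in> p \<longrightarrow> (\<forall>i<N. c i = 0)))"

lemma free_modI:
  fixes p :: "('n::finite, 'k::comm_ring_1) mpoly set"
  assumes I: "finite I" and v: "\<And>i. i \<in> I \<Longrightarrow> v i \<in> degle s"
    and free: "\<And>c i. (\<Sum>i\<in>I. cst (c i) * v i) \<in> p \<Longrightarrow> i \<in> I \<Longrightarrow> c i = 0"
  shows "free_mod p s (card I)"
proof -
  obtain h where "bij_betw h {0..<card I} I" using ex_bij_betw_nat_finite[OF I] by blast
  then have h: "bij_betw h {..<card I} I" by (simp add: atLeast0LessThan)
  show ?thesis unfolding free_mod_def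
  proof (intro exI[of _ "v \<circ> h"] conjI allI impI)
    show "(v \<circ> h) i \<in> degle s" if "i < card I" for i
      using v bij_betwE[OF h] that by auto
    fix c :: "nat \<Rightarrow> 'k" and i assume s: "(\<Sum>i<card I. cst (c i) * (v \<circ> h) i) \<in> p" and i: "i < card I"
    define g where "g = the_inv_into {..<card I} h"
    have g: "g (h j) = j" if "j < card I" for j
      using h that by (auto simp: g_def bij_betw_def intro: the_inv_into_f_f)
    have "(\<Sum>x\<in>I. cst (c (g x)) * v x) = (\<Sum>i<card I. cst (c (g (h i))) * v (h i))"
      by (rule sum.reindex_bij_betw[OF h, symmetric])
    also have "\<dots> = (\<Sum>i<card I. cst (c i) * (v \<circ> h) i)" using g by (intro sum.cong) auto
    finally have "(\<Sum>x\<in>I. cst (c (g x)) * v x) \<in> p" using s by simp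
    then have "c (g (h i)) = 0" using free[of "\<lambda>x. c (g x)" "h i"] bij_betwE[OF h] i by auto
    then show "c i = 0" using g i by simp
  qed
qed

lemma free_mod_max_indep:
  fixes p :: "('n::finite, 'k::field) mpoly set"
  assumes S: "indep S p"
  shows "free_mod p s ((s + card S) choose card S)"
proof -
  let ?M = "{\<alpha>::'n::finite \<Rightarrow>\<^sub>0 nat. (\<forall>i. i \<notin> S \<longrightarrow> lkp \<alpha> i = 0) \<and> sum (lkp \<alpha>) S \<le> s}"
  have "free_mod p s (card ?M)"
  proof (rule free_modI[OF finite_monomials, of _ _ "\<lambda>\<alpha>. sgl \<alpha> 1"])
    show "sgl \<alpha> 1 \<in> degle s" if \<alpha>: "\<alpha> \<in> ?M" for \<alpha>
    proof -
      have "sum (lkp \<alpha>) UNIV = sum (lkp \<alpha>) S" using \<alpha> by (intro sum.mono_neutral_right) auto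
      then show ?thesis using \<alpha> by (auto simp: degle_def)
    qed
    fix c :: "_ \<Rightarrow> 'k" and \<alpha> assume sum: "(\<Sum>\<alpha>\<in>?M. cst (c \<alpha>) * sgl \<alpha> 1) \<in> p" and \<alpha>: "\<alpha> \<in> ?M"
    have "(\<Sum>\<alpha>\<in>?M. cst (c \<alpha>) * sgl \<alpha> 1) \<in> poly_in S"
      by (intro poly_in_sum poly_in_mult poly_in_cst poly_in_single) auto
    then have "(\<Sum>\<alpha>\<in>?M. cst (c \<alpha>) * sgl \<alpha> 1) = 0" using sum S by (auto simp: indep_def)
    then have "(\<Sum>\<alpha>\<in>?M. sgl \<alpha> (c \<alpha>)) = 0" by (simp add: mult_single)
    then have "lkp (\<Sum>\<alpha>\<in>?M. sgl \<alpha> (c \<alpha>)) \<alpha> = 0" by simp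
    then show "c \<alpha> = 0" using \<alpha> finite_monomials[of S s] by (simp add: lookup_sum lookup_single when_def)
  qed
  then show ?thesis unfolding card_monomials .
qed

lemma free_mod_zero_le:
  assumes "free_mod ({0} :: ('n::finite, 'k::field) mpoly set) s N"
  shows "N \<le> (s + CARD('n)) choose CARD('n)"
proof (rule ccontr)
  assume "\<not> ?thesis"
  then have less: "(s + CARD('n)) choose CARD('n) < N" by simp
  obtain v :: "nat \<Rightarrow> ('n, 'k) mpoly" where v: "\<forall>i<N. v i \<in> degle s"
    and free: "\<And>c. (\<Sum>i<N. cst (c i) * v i) \<in> {0} \<Longrightarrow> (\<forall>i<N. c i = 0)"
    using assms unfolding free_mod_def by blast
  define M where "M = {\<alpha>::'n \<Rightarrow>\<^sub>0 nat. sum (lkp \<alpha>) UNIV \<le> s}"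
  have M: "finite M" "card M = (s + CARD('n)) choose CARD('n)"
    using finite_monomials[of "UNIV :: 'n set" s] card_monomials(2)[of "UNIV :: 'n set" s] by (simp_all add: M_def)
  define X :: "('n, 'k) mpoly set" where "X = (\<lambda>\<alpha>. sgl \<alpha> 1) ` M"
  have X: "finite X" "card X \<le> (s + CARD('n)) choose CARD('n)"
    using M card_image_le[of M "\<lambda>\<alpha>. sgl \<alpha> (1::'k)"] by (auto simp: X_def)
  have J: "is_ideal ({0} :: ('n, 'k) mpoly set)" by (simp add: is_ideal_def)
  have "v i \<in> poly_in.torsion_span {} X {0}" if "i < N" for i
  proof (rule poly_in.torsion_span_base[OF J])
    have "v i = (\<Sum>\<alpha>\<in>keys (v i). cst (lkp (v i) \<alpha>) * sgl \<alpha> 1)"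
      using mpoly_expand[of "v i"] by (simp add: mult_single)
    also have "\<dots> \<in> poly_in.span {} X"
      using v that X(1) by (intro poly_in.span_sum poly_in.span_scale poly_in_cst poly_in.span_base)
        (auto simp: X_def M_def degle_def)
    finally show "v i \<in> poly_in.span {} X" .
  qed
  then obtain c where c: "\<forall>i\<in>{..<N}. c i \<in> poly_in {}" "\<exists>i\<in>{..<N}. c i \<noteq> 0" "(\<Sum>i\<in>{..<N}. c i * v i) \<in> {0}"
    using poly_in.rank_bound[OF J X(1), where S = "{}" and I = "{..<N}" and v = v] X(2) less by auto
  have const: "cst (lkp (c i) 0) = c i" if "i < N" for i
    by (rule poly_in_empty[symmetric]) (use c(1) that in simp)
  then have "(\<Sum>i<N. cst (lkp (c i) 0) * v i) = (\<Sum>i<N. c i * v i)" by (intro sum.cong) auto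
  then have "\<forall>i<N. lkp (c i) 0 = 0" using free[of "\<lambda>i. lkp (c i) 0"] c(3) by simp
  then have "c i = 0" if "i < N" for i using const[OF that] that by simp
  then show False using c(2) by auto
qed

text \<open>When \<open>e\<close> is the dimension of the variety of \<open>p\<close>, this makes
  \<open>w\<close> a lower bound for its degree. The shift \<open>C\<close> leaves the leading term
  alone and absorbs the degrees of auxiliary factors.\<close>

definition growth :: "('n::finite, 'k::comm_ring_1) mpoly set \<Rightarrow> nat \<Rightarrow> real \<Rightarrow> bool" where
  "growth p e w \<longleftrightarrow> (\<exists>C. \<forall>u. \<exists>N. free_mod p (u + C) N \<and> w * real ((u + e) choose e) \<le> real N)"

lemma growth_one:
  fixes p :: "('n::finite, 'k::field) mpoly set"
  assumes "prime_ideal p"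
  shows "growth p (tdeg_quot p) 1"
proof -
  obtain S where "indep S p" "card S = tdeg_quot p" using obtain_max_indep[OF assms] by blast
  then have "free_mod p (u + 0) ((u + tdeg_quot p) choose tdeg_quot p)" for u
    using free_mod_max_indep by force
  then show ?thesis unfolding growth_def
    by (intro exI[of _ 0] allI exI[of _ "(u + tdeg_quot p) choose tdeg_quot p" for u] conjI) auto
qed

lemma power_le_fact_choose: "(u + 1) ^ n \<le> fact n * ((u + n) choose n)" for u n :: nat
proof (induction n)
  case (Suc n)
  have "(u + 1) ^ Suc n \<le> (u + Suc n) * (fact n * ((u + n) choose n))"
    unfolding power_Suc using Suc by (intro mult_mono) auto
  also have "\<dots> = fact n * (Suc (u + n) * ((u + n) choose n))" by (simp only: add_Suc_right mult.left_commute)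
  also have "Suc (u + n) * ((u + n) choose n) = Suc n * (Suc (u + n) choose Suc n)"
    using Suc_times_binomial_eq[of "u + n" n] by (simp only: mult.commute)
  also have "fact n * \<dots> = fact (Suc n) * ((u + Suc n) choose Suc n)"
    by (simp only: fact_Suc of_nat_id add_Suc_right mult_ac)
  finally show ?case .
qed simp

text \<open>Affine space has degree one: comparison with the number of all monomials bounds
  \<open>w\<close> by \<open>((u + C + n) / (u + 1)) ^ n\<close> for every \<open>u\<close>, and
  this tends to 1.\<close>

lemma growth_zero_le:
  assumes "growth ({0} :: ('n::finite, 'k::field) mpoly set) CARD('n) w"
  shows "w \<le> 1"
proof -
  define n where "n = CARD('n)"
  obtain C where C: "\<And>u. \<exists>N. free_mod ({0} :: ('n, 'k) mpoly set) (u + C) N \<and> w * real ((u + n) choose n) \<le> real N"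
    using assms by (auto simp: growth_def n_def)
  have bound: "w \<le> (real (u + (C + n)) / real (u + 1)) ^ n" if w: "w > 0" for u
  proof -
    obtain N where N: "free_mod ({0} :: ('n, 'k) mpoly set) (u + C) N" "w * real ((u + n) choose n) \<le> real N"
      using C by blast
    have "real ((u + 1) ^ n) \<le> real (fact n * ((u + n) choose n))"
      using power_le_fact_choose[of u n] by (simp only: of_nat_le_iff)
    then have "real (u + 1) ^ n \<le> fact n * real ((u + n) choose n)"
      by (simp only: of_nat_power of_nat_mult of_nat_fact)
    then have "w * real (u + 1) ^ n \<le> w * (fact n * real ((u + n) choose n))"
      using w by (intro mult_left_mono) auto
    also have "\<dots> = fact n * (w * real ((u + n) choose n))" by simp
    also have "\<dots> \<le> fact n * real ((u + C + n) choose n)"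
      using N free_mod_zero_le[OF N(1)] by (intro mult_left_mono) (auto simp: n_def)
    also have "\<dots> \<le> real (u + (C + n)) ^ n"
    proof -
      have "((u + C + n) choose n) * fact n \<le> (u + C + n) ^ n" by (rule binomial_fact_pow)
      then have "real (((u + C + n) choose n) * fact n) \<le> real ((u + C + n) ^ n)" by (simp only: of_nat_le_iff)
      then show ?thesis by (simp add: mult_ac add_ac)
    qed
    finally show ?thesis by (simp add: power_divide field_simps)
  qed
  have "(\<lambda>u. real (u + (C + n)) / real (u + 1)) \<longlonglongrightarrow> 1"
  proof -
    have "(\<lambda>u. 1 + (real (C + n) - 1) / real (Suc u)) \<longlonglongrightarrow> 1 + 0"
      by (intro tendsto_add tendsto_const LIMSEQ_Suc[OF lim_const_over_n])
    moreover have "1 + (real (C + n) - 1) / real (Suc u) = real (u + (C + n)) / real (u + 1)" for u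
      by (simp add: field_simps)
    ultimately show ?thesis by simp
  qed
  then have "(\<lambda>u. (real (u + (C + n)) / real (u + 1)) ^ n) \<longlonglongrightarrow> 1 ^ n" by (rule tendsto_power)
  then show ?thesis using bound
    by (cases "w > 0") (auto intro: LIMSEQ_le_const)
qed

text \<open>By the hockey-stick sum the two outer binomial coefficients differ by \<open>D\<close>
  terms, each at most \<open>(u + e) choose e\<close>. For \<open>u < D\<close> there are only
  \<open>u + 1\<close> terms in all.\<close>

lemma choose_step:
  assumes "D > 0"
  shows "(u + Suc e) choose Suc e \<le> D * ((u + e) choose e) + (if D \<le> u then (u - D + Suc e) choose Suc e else 0)"
proof (cases "D \<le> u")
  case True
  have "(\<Sum>w\<le>u. (w + e) choose e) = (\<Sum>w\<le>u - D. (w + e) choose e) + (\<Sum>w\<in>{u - D<..u}. (w + e) choose e)"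
    by (subst sum.union_disjoint[symmetric]) (auto intro!: sum.cong)
  also have "(\<Sum>w\<in>{u - D<..u}. (w + e) choose e) \<le> (\<Sum>w\<in>{u - D<..u}. (u + e) choose e)"
    by (intro sum_mono binomial_right_mono) auto
  finally show ?thesis using True by (simp add: sum_choose_diag)
next
  case False
  have "(\<Sum>w\<le>u. (w + e) choose e) \<le> (\<Sum>w\<le>u. (u + e) choose e)"
    by (intro sum_mono binomial_right_mono) auto
  also have "\<dots> \<le> D * ((u + e) choose e)" using False by (simp add: mult_le_mono1 del: mult_Suc)
  finally show ?thesis using False by (simp add: sum_choose_diag)
qed

text \<open>Bezout for one hypersurface, in terms of lower bounds for degrees. Multiplication by
  \<open>f\<close> is injective modulo \<open>p0\<close> and costs degree \<open>D\<close>;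
  independent elements from the components of the section are added to its image through separators
  \<open>g p\<close>, which lie in every other prime of \<open>A\<close> but not in
  \<open>p\<close>. Repeating this from \<open>u - D\<close> to \<open>u\<close> produces the
  divisor \<open>D\<close>.\<close>

lemma growth_step:
  fixes p0 :: "('n::finite, 'k::field) mpoly set"
  assumes p0: "prime_ideal p0" and f: "f \<notin> p0" "f \<in> degle D" and D: "D > 0" and A: "finite A"
    and pr: "\<And>p. p \<in> A \<Longrightarrow> prime_ideal p \<and> p0 \<subseteq> p \<and> f \<in> p"
    and incomp: "\<And>p p'. p \<in> A \<Longrightarrow> p' \<in> A \<Longrightarrow> p \<noteq> p' \<Longrightarrow> \<not> p' \<subseteq> p"
    and gr: "\<And>p. p \<in> A \<Longrightarrow> growth p e (w p) \<and> 0 \<le> w p"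
  shows "growth p0 (Suc e) ((\<Sum>p\<in>A. w p) / real D)"
proof -
  note P0 = prime_ideal_ideal[OF p0]
  have "\<exists>g. g \<notin> p \<and> (\<forall>p'\<in>A - {p}. g \<in> p')" if p: "p \<in> A" for p
  proof -
    have "\<exists>a. a \<in> p' \<and> a \<notin> p" if "p' \<in> A - {p}" for p' using incomp[OF p, of p'] that by auto
    then obtain a where a: "\<And>p'. p' \<in> A - {p} \<Longrightarrow> a p' \<in> p' \<and> a p' \<notin> p" by metis
    have "prod a (A - {p}) \<notin> p" using prime_ideal_prodD[of p a "A - {p}"] pr[OF p] a by blast
    moreover have "prod a (A - {p}) \<in> p'" if "p' \<in> A - {p}" for p'
      using that a pr A by (subst prod.remove[of _ p']) (auto intro!: ideal_mult_right prime_ideal_ideal)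
    ultimately show ?thesis by blast
  qed
  then obtain g where g: "\<And>p. p \<in> A \<Longrightarrow> g p \<notin> p \<and> (\<forall>p'\<in>A - {p}. g p \<in> p')" by metis
  have "\<forall>p. \<exists>s. g p \<in> degle s" by (intro allI degle_exists)
  then obtain dg where dg: "\<And>p. g p \<in> degle (dg p)" by metis
  define C0 where "C0 = (\<Sum>p\<in>A. dg p)"
  have gC0: "g p \<in> degle C0" if "p \<in> A" for p
    using that A dg[of p] by (rule_tac degle_mono[of "dg p"]) (auto simp: C0_def intro: member_le_sum)
  obtain C where C: "\<And>p u. p \<in> A \<Longrightarrow> \<exists>N. free_mod p (u + C p) N \<and> w p * real ((u + e) choose e) \<le> real N"
    using gr unfolding growth_def by metis
  define C1 where "C1 = (\<Sum>p\<in>A. C p)"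
  have C1: "C p \<le> C1" if "p \<in> A" for p using that A by (auto simp: C1_def intro: member_le_sum)
  \<comment> \<open>One shift that covers the separators and all components, and stays the same
    along the recursion on \<open>u\<close>.\<close>
  define C' where "C' = C0 + C1"
  define W where "W = (\<Sum>p\<in>A. w p)"
  have W: "W \<ge> 0" using gr by (auto simp: W_def intro: sum_nonneg)
  have "\<exists>N. free_mod p0 (u + C') N \<and> W / real D * real ((u + Suc e) choose Suc e) \<le> real N" for u
  proof (induction u rule: less_induct)
    case (less u)
    \<comment> \<open>Multiples of \<open>f\<close> are available only for \<open>D \<le> u\<close>;
      below that their part of the family is empty.\<close>
    obtain N' where N': "N' = 0 \<or> D \<le> u \<and> free_mod p0 (u - D + C') N'"
      and le': "W / real D * real (if D \<le> u then (u - D + Suc e) choose Suc e else 0) \<le> real N'"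
    proof (cases "D \<le> u")
      case True
      then show ?thesis using less[of "u - D"] D that by auto
    next
      case False
      then show ?thesis using that[of 0] by auto
    qed
    obtain v' where v': "\<And>i. i < N' \<Longrightarrow> D \<le> u \<and> v' i \<in> degle (u - D + C')"
      and free': "\<And>c i. (\<Sum>i<N'. cst (c i) * v' i) \<in> p0 \<Longrightarrow> i < N' \<Longrightarrow> c i = 0"
    proof (cases "N' = 0")
      case True
      then show ?thesis using that by auto
    next
      case False
      then show ?thesis using N' that unfolding free_mod_def by blast
    qed
    have "\<forall>p\<in>A. \<exists>N. free_mod p (u + C p) N \<and> w p * real ((u + e) choose e) \<le> real N" using C by blast
    from bchoice[OF this] obtain N where
      N: "\<And>p. p \<in> A \<Longrightarrow> free_mod p (u + C p) (N p) \<and> w p * real ((u + e) choose e) \<le> real (N p)" by blast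
    have "\<forall>p\<in>A. \<exists>v. (\<forall>i<N p. v i \<in> degle (u + C p)) \<and> (\<forall>c. (\<Sum>i<N p. cst (c i) * v i) \<in> p \<longrightarrow> (\<forall>i<N p. c i = 0))"
      using N unfolding free_mod_def by blast
    from bchoice[OF this] obtain v where
      "\<forall>p\<in>A. (\<forall>i<N p. v p i \<in> degle (u + C p)) \<and> (\<forall>c. (\<Sum>i<N p. cst (c i) * v p i) \<in> p \<longrightarrow> (\<forall>i<N p. c i = 0))" ..
    then have v: "\<And>p i. p \<in> A \<Longrightarrow> i < N p \<Longrightarrow> v p i \<in> degle (u + C p)"
      and free: "\<And>p c i. p \<in> A \<Longrightarrow> (\<Sum>i<N p. cst (c i) * v p i) \<in> p \<Longrightarrow> i < N p \<Longrightarrow> c i = 0"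
      by auto
    define I where "I = {..<N'} <+> (SIGMA p:A. {..<N p})"
    define x where "x j = (case j of Inl i \<Rightarrow> f * v' i | Inr (p, i) \<Rightarrow> g p * v p i)" for j
    have cardI: "card I = N' + (\<Sum>p\<in>A. N p)" unfolding I_def using A by (simp add: card_Plus)
    have "free_mod p0 (u + C') (card I)"
    proof (rule free_modI[of I x])
      show "finite I" using A by (auto simp: I_def)
      show "x j \<in> degle (u + C')" if jI: "j \<in> I" for j
      proof (cases j)
        case (Inl i)
        then have "f * v' i \<in> degle (D + (u - D + C'))" "D \<le> u" using jI v' f(2) by (auto simp: I_def intro: degle_mult)
        then show ?thesis by (simp add: x_def Inl)
      next
        case (Inr pi)
        then obtain p i where pi: "pi = (p, i)" "p \<in> A" "i < N p" using jI by (auto simp: I_def)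
        have "g p * v p i \<in> degle (C0 + (u + C p))" using pi by (intro degle_mult gC0 v)
        then show ?thesis using degle_mono[of "C0 + (u + C p)" "u + C'"] C1[OF pi(2)]
          by (simp add: x_def Inr pi C'_def)
      qed
      fix c j assume sum: "(\<Sum>j\<in>I. cst (c j) * x j) \<in> p0" and j: "j \<in> I"
      define a where "a = (\<Sum>i<N'. cst (c (Inl i)) * v' i)"
      define b where "b p = (\<Sum>i<N p. cst (c (Inr (p, i))) * v p i)" for p
      have sum_eq: "(\<Sum>j\<in>I. cst (c j) * x j) = f * a + (\<Sum>p\<in>A. g p * b p)"
      proof -
        have "(\<Sum>j\<in>I. cst (c j) * x j) = (\<Sum>i<N'. cst (c (Inl i)) * (f * v' i)) +
            (\<Sum>(p, i)\<in>(SIGMA p:A. {..<N p}). cst (c (Inr (p, i))) * (g p * v p i))"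
          unfolding I_def using A by (simp add: sum.Plus x_def case_prod_unfold)
        also have "(\<Sum>(p, i)\<in>(SIGMA p:A. {..<N p}). cst (c (Inr (p, i))) * (g p * v p i)) =
            (\<Sum>p\<in>A. \<Sum>i<N p. cst (c (Inr (p, i))) * (g p * v p i))"
          using A by (subst sum.Sigma) auto
        finally show ?thesis by (simp add: a_def b_def sum_distrib_left mult.left_commute)
      qed
      \<comment> \<open>Modulo \<open>p\<close> both \<open>f\<close> and the separators of the
        other primes vanish, so only \<open>g p * b p\<close> is left, and \<open>g p\<close>
        cancels.\<close>
      have bp: "b p \<in> p" if p: "p \<in> A" for p
      proof -
        note P = prime_ideal_ideal[of p] pr[OF p]
        have "f * a + (\<Sum>p\<in>A. g p * b p) = (f * a + (\<Sum>p'\<in>A - {p}. g p' * b p')) + g p * b p"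
          using A p by (simp add: sum.remove)
        moreover have "f * a + (\<Sum>p'\<in>A - {p}. g p' * b p') \<in> p"
          using P g p by (intro ideal_add ideal_sum ideal_mult_right) auto
        ultimately have "g p * b p \<in> p"
          using sum P ideal_diff[of p "f * a + (\<Sum>p\<in>A. g p * b p)" "f * a + (\<Sum>p'\<in>A - {p}. g p' * b p')"]
          unfolding sum_eq by auto
        then show ?thesis using prime_ideal_multD[of p "g p" "b p"] P g p by blast
      qed
      have cR: "c (Inr (p, i)) = 0" if "p \<in> A" "i < N p" for p i
        using free[OF that(1), of "\<lambda>i. c (Inr (p, i))"] bp[OF that(1)] that(2) by (simp add: b_def)
      then have "b p = 0" if "p \<in> A" for p using that by (simp add: b_def)
      then have "f * a \<in> p0" using sum unfolding sum_eq by simp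
      then have "a \<in> p0" using prime_ideal_multD[OF p0] f by blast
      then have cL: "c (Inl i) = 0" if "i < N'" for i using free'[of "\<lambda>i. c (Inl i)"] that by (simp add: a_def)
      show "c j = 0" using j cL cR by (auto simp: I_def)
    qed
    moreover have "W / real D * real ((u + Suc e) choose Suc e) \<le> real (card I)"
    proof -
      have "real ((u + Suc e) choose Suc e) \<le> real D * real ((u + e) choose e) + real (if D \<le> u then (u - D + Suc e) choose Suc e else 0)"
        using choose_step[OF D, of u e] by (simp only: of_nat_mult[symmetric] of_nat_add[symmetric] of_nat_le_iff)
      then have "W / real D * real ((u + Suc e) choose Suc e) \<le> W / real D * (real D * real ((u + e) choose e) + real (if D \<le> u then (u - D + Suc e) choose Suc e else 0))"
        using W by (intro mult_left_mono) auto
      also have "\<dots> = W * real ((u + e) choose e) + W / real D * real (if D \<le> u then (u - D + Suc e) choose Suc e else 0)"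
        using D by (simp add: distrib_left)
      also have "\<dots> \<le> (\<Sum>p\<in>A. real (N p)) + real N'"
        unfolding W_def sum_distrib_right using N le' by (intro add_mono sum_mono) (auto simp: W_def)
      finally show ?thesis by (simp add: cardI)
    qed
    ultimately show ?case by blast
  qed
  then show ?thesis unfolding growth_def W_def by blast
qed

section \<open>Bezout's inequality for minimal primes\<close>

text \<open>The field is infinite. If \<open>f\<close> avoids the earlier ideals but lies in
  \<open>p\<close>, and \<open>g\<close> lies outside \<open>p\<close>, then \<open>g + i f\<close>
  avoids \<open>p\<close> for every \<open>i\<close>, while an earlier ideal contains it for at most
  one \<open>i\<close>, as it does not contain \<open>f\<close>.\<close>

lemma ideal_avoidance:
  fixes V :: "('n::finite, 'k::field_char_0) mpoly set"
  assumes V: "0 \<in> V" "\<And>f g. f \<in> V \<Longrightarrow> g \<in> V \<Longrightarrow> f + g \<in> V" "\<And>c f. f \<in> V \<Longrightarrow> cst c * f \<in> V"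
    and Z: "finite Z" "\<And>p. p \<in> Z \<Longrightarrow> is_ideal p \<and> \<not> V \<subseteq> p"
  shows "\<exists>f\<in>V. \<forall>p\<in>Z. f \<notin> p"
  using Z
proof (induction Z rule: finite_induct)
  case empty
  then show ?case using V(1) by auto
next
  case (insert p Z)
  then obtain f where f: "f \<in> V" "\<forall>p\<in>Z. f \<notin> p" by auto
  show ?case
  proof (cases "f \<in> p")
    case False
    then show ?thesis using f by auto
  next
    case True
    obtain g where g: "g \<in> V" "g \<notin> p" using insert.prems[of p] by auto
    have P: "is_ideal p" using insert.prems by auto
    have uniq: "i = j" if q: "q \<in> Z" and i: "g + cst (of_nat i) * f \<in> q" and j: "g + cst (of_nat j) * f \<in> q" for q and i j :: nat
    proof (rule ccontr)
      assume "i \<noteq> j"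
      have Q: "is_ideal q" using insert.prems q by auto
      have "cst (of_nat i - of_nat j) * f = (g + cst (of_nat i) * f) - (g + cst (of_nat j) * f)"
        by (simp only: single_diff left_diff_distrib) simp
      then have "cst (of_nat i - of_nat j) * f \<in> q" using ideal_diff[OF Q i j] by simp
      then have "cst (inverse (of_nat i - of_nat j)) * (cst (of_nat i - of_nat j) * f) \<in> q" by (rule ideal_mult_left[OF Q])
      moreover have "cst (inverse (of_nat i - of_nat j :: 'k)) * (cst (of_nat i - of_nat j) * f) = f"
        using \<open>i \<noteq> j\<close> by (simp add: mult.assoc[symmetric] mult_single)
      ultimately show False using f q by simp
    qed
    define bad where "bad = (\<Union>q\<in>Z. {i::nat. g + cst (of_nat i) * f \<in> q})"
    have "finite {i::nat. g + cst (of_nat i) * f \<in> q}" if "q \<in> Z" for q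
    proof (cases "{i::nat. g + cst (of_nat i) * f \<in> q} = {}")
      case False
      then obtain i where "g + cst (of_nat i) * f \<in> q" by auto
      then have "{i::nat. g + cst (of_nat i) * f \<in> q} \<subseteq> {i}" using uniq[OF that] by auto
      then show ?thesis using finite_subset by blast
    qed auto
    then have "finite bad" using insert.hyps by (auto simp: bad_def)
    then obtain i where i: "i \<notin> bad" using ex_new_if_finite infinite_UNIV_nat by blast
    have "g + cst (of_nat i) * f \<notin> p"
    proof
      assume "g + cst (of_nat i) * f \<in> p"
      then have "g + cst (of_nat i) * f - cst (of_nat i) * f \<in> p"
        using True by (intro ideal_diff[OF P] ideal_mult_left[OF P])
      then show False using g by simp
    qed
    moreover have "g + cst (of_nat i) * f \<in> V" using V f(1) g(1) by blast
    moreover have "\<forall>q\<in>Z. g + cst (of_nat i) * f \<notin> q" using i unfolding bad_def by blast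
    ultimately show ?thesis by blast
  qed
qed

text \<open>After \<open>i\<close> sections the invariant bounds sums of arbitrary admissible
  weights, not just the number of primes: passing from components to their parents divides by
  \<open>D\<close>, so cardinalities alone would not be inductive. With all weights 1 it gives both
  the finiteness needed to choose the next section and the final count.\<close>

theorem minimal_primes_bezout:
  fixes Q :: "('n::finite, 'k::field_char_0) mpoly set set"
  assumes Q: "finite Q" "\<And>q. q \<in> Q \<Longrightarrow> minimal_prime G q \<and> codim q = c"
    and G: "G \<subseteq> degle D" and D: "D > 0"
  shows "card Q \<le> D ^ c"
proof (cases "Q = {}")
  case False
  then obtain q0 where q0: "q0 \<in> Q" by blast
  have c_le: "c \<le> CARD('n)" using Q(2)[OF q0] by (auto simp: codim_def)
  have Qp: "prime_ideal q" if "q \<in> Q" for q using Q(2)[OF that] by (simp add: minimal_prime_def)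
  \<comment> \<open>A linear space is needed in place of \<open>G\<close>, because generic members
    are linear combinations.\<close>
  define V where "V = {f \<in> degle D. \<forall>q\<in>Q. f \<in> q}"
  have GV: "G \<subseteq> V" using G Q(2) unfolding V_def minimal_prime_def by blast
  have V: "0 \<in> V" "\<And>f g. f \<in> V \<Longrightarrow> g \<in> V \<Longrightarrow> f + g \<in> V" "\<And>a f. f \<in> V \<Longrightarrow> cst a * f \<in> V"
    unfolding V_def
    using prime_ideal_ideal[OF Qp] by (auto intro: degle_zero ideal_zero degle_add degle_scale ideal_add ideal_mult_left)
  \<comment> \<open>Only components contained in a member of \<open>Q\<close> are followed. None of
    these contains \<open>V\<close> before codimension \<open>c\<close>: minimality over
    \<open>G\<close> would make it a member of \<open>Q\<close>.\<close>
  define Z where "Z fs = {p. minimal_prime (set fs) p \<and> (\<exists>q\<in>Q. p \<subseteq> q)}" for fs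
  have Zp: "prime_ideal p" "set fs \<subseteq> p" if "p \<in> Z fs" for p fs using that by (auto simp: Z_def minimal_prime_def)
  have "\<exists>fs. length fs = i \<and> set fs \<subseteq> V \<and> (\<forall>p\<in>Z fs. codim p = i) \<and>
     (\<forall>A w. finite A \<longrightarrow> A \<subseteq> Z fs \<longrightarrow> (\<forall>p\<in>A. 0 \<le> w p \<and> growth p (CARD('n) - i) (w p)) \<longrightarrow> sum w A \<le> real (D ^ i))"
    if "i \<le> c" for i
    using that
  proof (induction i)
    case 0
    have Z0: "p = {0}" if "p \<in> Z []" for p
    proof -
      have "minimal_prime {} p" using that by (simp add: Z_def)
      moreover then have "{0} \<subseteq> p" using ideal_zero prime_ideal_ideal by (auto simp: minimal_prime_def)
      ultimately show ?thesis using prime_ideal_zero unfolding minimal_prime_def by blast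
    qed
    show ?case
    proof (intro exI[of _ "[]"] conjI allI impI ballI)
      show "codim p = 0" if "p \<in> Z []" for p using Z0[OF that] codim_zero by simp
      fix A and w :: "_ \<Rightarrow> real"
      assume A: "finite A" "A \<subseteq> Z []" "\<forall>p\<in>A. 0 \<le> w p \<and> growth p (CARD('n) - 0) (w p)"
      then have "A = {} \<or> A = {{0}}" using Z0 by blast
      then show "sum w A \<le> real (D ^ 0)"
      proof
        assume "A = {{0}}"
        then show ?thesis using A(3) growth_zero_le by auto
      qed auto
    qed auto
  next
    case (Suc i)
    then obtain fs where fs: "length fs = i" "set fs \<subseteq> V" "\<And>p. p \<in> Z fs \<Longrightarrow> codim p = i"
      and weight: "\<And>A w. finite A \<Longrightarrow> A \<subseteq> Z fs \<Longrightarrow> (\<forall>p\<in>A. 0 \<le> w p \<and> growth p (CARD('n) - i) (w p)) \<Longrightarrow> sum w A \<le> real (D ^ i)"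
      by (meson Suc_leD)
    have td: "tdeg_quot p = CARD('n) - i" if "p \<in> Z fs" for p
      using fs(3)[OF that] tdeg_quot_codim[OF Zp(1)[OF that]] by simp
    have finZ: "finite (Z fs)"
    proof (rule ccontr)
      assume "infinite (Z fs)"
      then obtain A where A: "finite A" "card A = Suc (D ^ i)" "A \<subseteq> Z fs"
        using infinite_arbitrarily_large by blast
      have "growth p (CARD('n) - i) 1" if "p \<in> A" for p
      proof -
        have p: "p \<in> Z fs" using that A by blast
        show ?thesis using growth_one[OF Zp(1)[OF p]] td[OF p] by simp
      qed
      then have "sum (\<lambda>_. 1) A \<le> real (D ^ i)" using weight[OF A(1,3), of "\<lambda>_. 1"] by auto
      then have "real (Suc (D ^ i)) \<le> real (D ^ i)" using A by simp
      then show False by linarith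
    qed
    have "\<not> V \<subseteq> p" if p: "p \<in> Z fs" for p
    proof
      assume Vp: "V \<subseteq> p"
      obtain q where q: "q \<in> Q" "p \<subseteq> q" using p by (auto simp: Z_def)
      have "p = q" using Q(2)[OF q(1)] Zp(1)[OF p] q(2) Vp GV unfolding minimal_prime_def by blast
      then show False using Q(2)[OF q(1)] fs(3)[OF p] Suc.prems by simp
    qed
    then obtain f where f: "f \<in> V" "\<And>p. p \<in> Z fs \<Longrightarrow> f \<notin> p"
      using ideal_avoidance[OF V finZ] Zp prime_ideal_ideal by metis
    have "\<exists>p0. p0 \<in> Z fs \<and> p0 \<subset> p" if p: "p \<in> Z (f # fs)" for p
    proof -
      have "f \<in> p" "set fs \<subseteq> p" using Zp(2)[OF p] by auto
      then obtain p0 where p0: "minimal_prime (set fs) p0" "p0 \<subseteq> p" using obtain_minimal_prime[OF Zp(1)[OF p]] by blast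
      then have "p0 \<in> Z fs" using p by (auto simp: Z_def)
      then show ?thesis using p0 f(2) \<open>f \<in> p\<close> by blast
    qed
    \<comment> \<open>A new prime may contain several old ones; fixing one parent for each lets the
      weights be summed without repetition.\<close>
    then obtain par where par: "\<And>p. p \<in> Z (f # fs) \<Longrightarrow> par p \<in> Z fs \<and> par p \<subset> p" by metis
    have cod: "codim p = Suc i" if p: "p \<in> Z (f # fs)" for p
    proof -
      have "i < codim p" using codim_strict_mono[of "par p" p] par[OF p] fs(3) Zp(1) p by metis
      moreover have "codim p \<le> Suc i" using codim_le_generators[of "f # fs" p] p fs(1) by (simp add: Z_def)
      ultimately show ?thesis by simp
    qed
    show ?case
    proof (intro exI[of _ "f # fs"] conjI allI impI ballI)
      show "codim p = Suc i" if "p \<in> Z (f # fs)" for p using cod[OF that] .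
      fix A and w :: "_ \<Rightarrow> real"
      assume A: "finite A" "A \<subseteq> Z (f # fs)" "\<forall>p\<in>A. 0 \<le> w p \<and> growth p (CARD('n) - Suc i) (w p)"
      \<comment> \<open>The degree bound that \<open>growth_step\<close> gives the parent from the
        children assigned to it.\<close>
      define w' where "w' p0 = (\<Sum>p\<in>{p\<in>A. par p = p0}. w p) / real D" for p0
      have e: "CARD('n) - i = Suc (CARD('n) - Suc i)" using Suc.prems c_le by simp
      have "sum w' (par ` A) \<le> real (D ^ i)"
      proof (rule weight)
        show "finite (par ` A)" using A by simp
        show "par ` A \<subseteq> Z fs" using A par by blast
        show "\<forall>p0\<in>par ` A. 0 \<le> w' p0 \<and> growth p0 (CARD('n) - i) (w' p0)"
        proof (intro ballI conjI)
          fix p0 assume p0: "p0 \<in> par ` A"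
          show "0 \<le> w' p0" using A(3) by (auto simp: w'_def intro!: divide_nonneg_nonneg sum_nonneg)
          have p0Z: "p0 \<in> Z fs" using p0 A par by blast
          show "growth p0 (CARD('n) - i) (w' p0)"
            unfolding e w'_def
          proof (rule growth_step[OF Zp(1)[OF p0Z] f(2)[OF p0Z]])
            show "f \<in> degle D" using f(1) by (simp add: V_def)
            show "prime_ideal p \<and> p0 \<subseteq> p \<and> f \<in> p" if "p \<in> {p\<in>A. par p = p0}" for p
              using that A(2) par[of p] Zp[of p "f # fs"] by auto
            show "growth p (CARD('n) - Suc i) (w p) \<and> 0 \<le> w p" if "p \<in> {p\<in>A. par p = p0}" for p
              using that A(3) by auto
            fix p p' assume p: "p \<in> {p\<in>A. par p = p0}" "p' \<in> {p\<in>A. par p = p0}" "p \<noteq> p'"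
            show "\<not> p' \<subseteq> p"
            proof
              assume "p' \<subseteq> p"
              then have "codim p' < codim p" using p A(2) Zp(1) by (intro codim_strict_mono) blast+
              moreover have "codim p = Suc i" "codim p' = Suc i" using cod p A(2) by blast+
              ultimately show False by simp
            qed
          qed (use A D in auto)
        qed
      qed
      then have "(\<Sum>p0\<in>par ` A. \<Sum>p\<in>{p\<in>A. par p = p0}. w p) / real D \<le> real (D ^ i)"
        by (simp add: w'_def sum_divide_distrib)
      also have "(\<Sum>p0\<in>par ` A. \<Sum>p\<in>{p\<in>A. par p = p0}. w p) = sum w A"
        by (rule sum.image_gen[OF A(1), symmetric])
      finally show "sum w A \<le> real (D ^ Suc i)" using D by (simp add: field_simps)
    qed (use fs f in auto)
  qed
  from this[OF order_refl] obtain fs where fs: "set fs \<subseteq> V" "\<And>p. p \<in> Z fs \<Longrightarrow> codim p = c"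
    and weight: "\<And>A w. finite A \<Longrightarrow> A \<subseteq> Z fs \<Longrightarrow> (\<forall>p\<in>A. 0 \<le> w p \<and> growth p (CARD('n) - c) (w p)) \<Longrightarrow> sum w A \<le> real (D ^ c)"
    by blast
  \<comment> \<open>After \<open>c\<close> sections the component below \<open>q\<close> has
    codimension \<open>c\<close> too, so it equals \<open>q\<close>.\<close>
  have "Q \<subseteq> Z fs"
  proof
    fix q assume q: "q \<in> Q"
    then have "set fs \<subseteq> q" using fs(1) by (auto simp: V_def)
    then obtain p where p: "minimal_prime (set fs) p" "p \<subseteq> q" using obtain_minimal_prime[OF Qp[OF q]] by blast
    then have pZ: "p \<in> Z fs" using q by (auto simp: Z_def)
    have "p = q" using codim_strict_mono[OF Zp(1)[OF pZ] Qp[OF q]] p(2) fs(2)[OF pZ] Q(2)[OF q] by (metis nat_neq_iff psubsetI)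
    then show "q \<in> Z fs" using pZ by simp
  qed
  moreover have "growth q (CARD('n) - c) 1" if "q \<in> Q" for q
    using growth_one[OF Qp[OF that]] tdeg_quot_codim[OF Qp[OF that]] Q(2)[OF that] by (metis add_diff_cancel_right')
  ultimately have "sum (\<lambda>_. 1) Q \<le> real (D ^ c)" by (intro weight Q) auto
  then have "real (card Q) \<le> real (D ^ c)" by simp
  then show ?thesis by (simp only: of_nat_le_iff)
qed simp

section \<open>Torus action and ranks of lattices\<close>

lemma mono_eval_add: "mono_eval (\<alpha> + \<beta>) z = mono_eval \<alpha> z * mono_eval \<beta> z"
  by (simp add: mono_eval_def lookup_add power_add prod.distrib)

lemma mono_eval_zero: "mono_eval 0 z = 1"
  by (simp add: mono_eval_def)

lemma mono_eval_mult: "mono_eval \<alpha> (\<lambda>j. z j * w j) = mono_eval \<alpha> z * mono_eval \<alpha> w"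
  by (simp add: mono_eval_def power_mult_distrib prod.distrib)

lemma mono_eval_one: "mono_eval \<alpha> (\<lambda>_. 1) = 1"
  by (simp add: mono_eval_def)

lemma mono_eval_nonzero: "(\<And>j. z j \<noteq> 0) \<Longrightarrow> mono_eval \<alpha> z \<noteq> (0::'k::field)"
  by (simp add: mono_eval_def)

lemma eval_hom: "mpoly_hom (\<lambda>c::'k::comm_ring_1. c) (\<lambda>\<alpha>. mono_eval \<alpha> z)"
  by unfold_locales (simp_all add: mono_eval_add mono_eval_zero)

lemma eval_eq_hom: "mpoly_eval P z = mpoly_hom.hom (\<lambda>c. c) (\<lambda>\<alpha>. mono_eval \<alpha> z) P"
  by (simp add: mpoly_eval_def mpoly_hom.hom_def[OF eval_hom])

lemmas eval_add = mpoly_hom.hom_add[OF eval_hom, folded eval_eq_hom]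
  and eval_mult = mpoly_hom.hom_mult[OF eval_hom, folded eval_eq_hom]
  and eval_one = mpoly_hom.hom_one[OF eval_hom, folded eval_eq_hom]
  and eval_zero = mpoly_hom.hom_zero[OF eval_hom, folded eval_eq_hom]
  and eval_single = mpoly_hom.hom_single[OF eval_hom, folded eval_eq_hom]

lemma act_hom: "mpoly_hom (cst :: 'k::comm_ring_1 \<Rightarrow> _) (\<lambda>\<alpha>. sgl \<alpha> (mono_eval \<alpha> z))"
  by unfold_locales (simp_all add: mono_eval_add mono_eval_zero single_add mult_single)

lemma act_eq_hom: "act z P = mpoly_hom.hom cst (\<lambda>\<alpha>. sgl \<alpha> (mono_eval \<alpha> z)) P"
  by (simp add: act_def mpoly_hom.hom_def[OF act_hom] mult_single)

lemmas act_add = mpoly_hom.hom_add[OF act_hom, folded act_eq_hom]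
  and act_mult = mpoly_hom.hom_mult[OF act_hom, folded act_eq_hom]
  and act_zero = mpoly_hom.hom_zero[OF act_hom, folded act_eq_hom]
  and act_one_poly = mpoly_hom.hom_one[OF act_hom, folded act_eq_hom]

lemma lookup_act: "lkp (act z P) \<alpha> = lkp P \<alpha> * mono_eval \<alpha> z"
  by (simp add: act_def lookup_sum lookup_single when_def in_keys_iff)

lemma act_act: "act z (act w P) = act (\<lambda>j. z j * w j) P"
  by (rule poly_mapping_eqI) (simp add: lookup_act mono_eval_mult mult_ac)

lemma act_one: "act (\<lambda>_. 1) P = P"
  by (rule poly_mapping_eqI) (simp add: lookup_act mono_eval_one)

lemma keys_act: "(\<And>j. z j \<noteq> 0) \<Longrightarrow> keys (act z P) = keys P" for z :: "_ \<Rightarrow> 'k::field"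
  by (auto simp: in_keys_iff lookup_act mono_eval_nonzero)

lemma eval_act: "(\<And>j. z j \<noteq> 0) \<Longrightarrow> mpoly_eval (act z P) w = mpoly_eval P (\<lambda>j. z j * w j)"
  for z :: "_ \<Rightarrow> 'k::field"
  by (simp add: mpoly_eval_def keys_act lookup_act mono_eval_mult mult_ac)

section \<open>Ideals of points and the torus action on primes\<close>

definition point_ideal :: "('n::finite \<Rightarrow> 'k::field) \<Rightarrow> ('n, 'k) mpoly set" where
  "point_ideal z = {f. mpoly_eval f z = 0}"

lemma prime_point_ideal: "prime_ideal (point_ideal z)"
proof -
  have "1 \<notin> point_ideal z" by (simp add: point_ideal_def eval_one)
  then have "point_ideal z \<noteq> UNIV" by blast
  then show ?thesis
    unfolding prime_ideal_def is_ideal_def point_ideal_def by (simp add: eval_zero eval_add eval_mult)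
qed

text \<open>An ideal containing all \<open>Var j - 1\<close> contains each monomial minus 1, by
  telescoping, and hence each polynomial minus its value at the identity.\<close>

lemma point_ideal_one_subset: "point_ideal (\<lambda>_. 1) \<subseteq> (maxm :: ('n::finite, 'k::field) mpoly set)"
  unfolding maxm_def ideal_gen_def
proof (intro subsetI InterI)
  fix P :: "('n, 'k) mpoly" and I :: "('n, 'k) mpoly set"
  assume P: "P \<in> point_ideal (\<lambda>_. 1)" and "I \<in> {I. is_ideal I \<and> range (\<lambda>j. Var j - 1) \<subseteq> I}"
  then have I: "is_ideal I" "\<And>j. Var j - 1 \<in> I" by auto
  have mono: "sgl \<alpha> 1 - 1 \<in> I" for \<alpha>
  proof (induction \<alpha> rule: monomial_induct)
    case zero
    then show ?case by (simp add: ideal_zero[OF I(1)])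
  next
    case (add i \<beta>)
    have "(Var i - 1) * sgl \<beta> 1 + (sgl \<beta> 1 - 1) \<in> I"
      using I(2) add by (intro ideal_add[OF I(1)] ideal_mult_right[OF I(1)])
    also have "(Var i - 1) * sgl \<beta> 1 + (sgl \<beta> 1 - 1) = sgl (sgl i 1 + \<beta>) 1 - (1 :: ('n, 'k) mpoly)"
      by (simp add: Var_def mult_single left_diff_distrib)
    finally show ?case .
  qed
  have "Q - cst (mpoly_eval Q (\<lambda>_. 1)) \<in> I" for Q
  proof (induction Q rule: mpoly_induct)
    case (single \<alpha> c)
    have "cst c * (sgl \<alpha> 1 - 1) \<in> I" using mono by (intro ideal_mult_left[OF I(1)]) blast
    then show ?case by (simp add: eval_single mono_eval_one right_diff_distrib mult_single)
  next
    case (add Q R)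
    then have "(Q - cst (mpoly_eval Q (\<lambda>_. 1))) + (R - cst (mpoly_eval R (\<lambda>_. 1))) \<in> I"
      by (rule ideal_add[OF I(1)])
    then show ?case by (simp add: eval_add single_add algebra_simps)
  qed
  from this[of P] show "P \<in> I" using P by (simp add: point_ideal_def)
qed

context
  fixes z :: "'n::finite \<Rightarrow> 'k::field"
  assumes z: "\<And>j. z j \<noteq> 0"
begin

lemma act_image_iff: "f \<in> act z ` p \<longleftrightarrow> act (\<lambda>j. inverse (z j)) f \<in> p"
proof
  assume "f \<in> act z ` p"
  then show "act (\<lambda>j. inverse (z j)) f \<in> p" using z by (auto simp: act_act act_one)
next
  assume "act (\<lambda>j. inverse (z j)) f \<in> p"
  moreover have "f = act z (act (\<lambda>j. inverse (z j)) f)" using z by (simp add: act_act act_one)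
  ultimately show "f \<in> act z ` p" by blast
qed

lemma prime_act_image:
  assumes p: "prime_ideal p"
  shows "prime_ideal (act z ` p)"
  unfolding prime_ideal_def is_ideal_def act_image_iff
proof (intro conjI allI impI ballI)
  note P = prime_ideal_ideal[OF p]
  have "1 \<notin> act z ` p" by (simp add: act_image_iff act_one_poly prime_ideal_one[OF p])
  then show "act z ` p \<noteq> UNIV" by blast
  show "act (\<lambda>j. inverse (z j)) 0 \<in> p" by (simp add: act_zero ideal_zero[OF P])
  show "act (\<lambda>j. inverse (z j)) (a + b) \<in> p" if "a \<in> act z ` p" "b \<in> act z ` p" for a b
    using that unfolding act_image_iff by (simp add: act_add ideal_add[OF P])
  show "act (\<lambda>j. inverse (z j)) (r * a) \<in> p" if "a \<in> act z ` p" for a r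
    using that unfolding act_image_iff by (simp add: act_mult ideal_mult_left[OF P])
  show "act (\<lambda>j. inverse (z j)) a \<in> p \<or> act (\<lambda>j. inverse (z j)) b \<in> p"
    if "act (\<lambda>j. inverse (z j)) (a * b) \<in> p" for a b
    using that prime_ideal_multD[OF p] by (simp add: act_mult)
qed

text \<open>Scaling the variables keeps the support of every polynomial, hence
  \<open>poly_in S\<close> and the notion of independence.\<close>

lemma codim_act_image: "codim (act z ` p) = codim p"
proof -
  have pin: "act z f \<in> poly_in S \<longleftrightarrow> f \<in> poly_in S" for f and S :: "'n set"
    by (simp add: poly_in_def keys_act z)
  have nz: "act z f = 0 \<longleftrightarrow> f = 0" for f
    using keys_act[OF z, where P = f] by (simp flip: keys_eq_empty)
  have "indep S (act z ` p) \<longleftrightarrow> indep S p" for S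
  proof -
    have "indep S (act z ` p) \<longleftrightarrow> (\<forall>f\<in>p. act z f \<in> poly_in S \<longrightarrow> act z f = 0)" unfolding indep_def by blast
    also have "\<dots> \<longleftrightarrow> indep S p" unfolding pin nz indep_def by blast
    finally show ?thesis .
  qed
  then show ?thesis by (simp add: codim_def tdeg_quot_def)
qed

end

section \<open>Ranks in the exponent lattice\<close>

lemma int_indep_card:
  fixes S :: "('m::finite \<Rightarrow> int) set"
  assumes "int_indep S"
  shows "card S \<le> CARD('m)"
proof (rule ccontr)
  interpret subdomain "UNIV :: int set" by unfold_locales auto
  assume "\<not> ?thesis"
  then have "card (UNIV :: 'm set) < card S" by simp
  then obtain c where "\<exists>s\<in>S. c s \<noteq> 0" "\<forall>l. (\<Sum>s\<in>S. c s * s l) = 0"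
    using lin_dep[of UNIV S "\<lambda>s l. s l"] assms unfolding int_indep_def by auto
  then show False using assms unfolding int_indep_def by blast
qed

lemma has_rank_exists:
  fixes G :: "('m::finite \<Rightarrow> int) set"
  shows "\<exists>r. has_rank G r"
proof -
  have "\<exists>S. (S \<subseteq> G \<and> int_indep S) \<and> (\<forall>S'. S' \<subseteq> G \<and> int_indep S' \<longrightarrow> card S' \<le> card S)"
  proof (rule ex_has_greatest_nat[of _ "{}" _ "CARD('m) + 1"])
    show "{} \<subseteq> G \<and> int_indep {}" by (simp add: int_indep_def)
  qed (use int_indep_card le_imp_less_Suc in force)
  then show ?thesis unfolding has_rank_def by blast
qed

text \<open>A maximal coordinate subspace meeting \<open>G\<close> trivially gives, for each remaining coordinate, a vector
  of \<open>G\<close> that is nonzero there and vanishes in the other remaining coordinates.\<close>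

lemma transversal_coordinates:
  fixes G :: "('m::finite \<Rightarrow> int) set"
  assumes rank: "has_rank G r"
  obtains J where "\<And>v. v \<in> G \<Longrightarrow> (\<forall>i. i \<notin> J \<longrightarrow> v i = 0) \<Longrightarrow> v = (\<lambda>_. 0)" "CARD('m) \<le> card J + r"
proof -
  define good where "good J \<longleftrightarrow> (\<forall>v\<in>G. (\<forall>i. i \<notin> J \<longrightarrow> v i = 0) \<longrightarrow> v = (\<lambda>_. 0))" for J
  have "\<exists>J. good J \<and> (\<forall>J'. good J' \<longrightarrow> card J' \<le> card J)"
  proof (rule ex_has_greatest_nat[of _ "{}" _ "CARD('m) + 1"])
    show "good {}" by (auto simp: good_def)
    show "\<forall>J. good J \<longrightarrow> card J < CARD('m) + 1" by (simp add: card_mono less_Suc_eq_le)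
  qed
  then obtain J where J: "good J" "\<And>J'. good J' \<Longrightarrow> card J' \<le> card J" by blast
  have "\<exists>v\<in>G. v i \<noteq> 0 \<and> (\<forall>k. k \<notin> J \<longrightarrow> k \<noteq> i \<longrightarrow> v k = 0)" if i: "i \<in> - J" for i
  proof -
    have "\<not> good (insert i J)" using J(2)[of "insert i J"] i by auto
    then obtain v where v: "v \<in> G" "\<forall>k. k \<notin> insert i J \<longrightarrow> v k = 0" "v \<noteq> (\<lambda>_. 0)" by (auto simp: good_def)
    have "v i \<noteq> 0"
    proof
      assume "v i = 0"
      then have "\<forall>k. k \<notin> J \<longrightarrow> v k = 0" using v(2) by (metis insertE)
      then show False using J(1) v by (auto simp: good_def)
    qed
    then show ?thesis using v by auto
  qed
  then obtain v where v: "\<And>i. i \<in> - J \<Longrightarrow> v i \<in> G \<and> v i i \<noteq> 0 \<and> (\<forall>k. k \<notin> J \<longrightarrow> k \<noteq> i \<longrightarrow> v i k = 0)" by metis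
  have inj: "inj_on v (- J)"
  proof (rule inj_onI)
    fix i k assume ik: "i \<in> - J" "k \<in> - J" "v i = v k"
    show "i = k"
    proof (rule ccontr)
      assume "i \<noteq> k"
      then have "v i k = 0" using v[OF ik(1)] ik(2) by auto
      then show False using v[OF ik(2)] ik(3) by simp
    qed
  qed
  have "int_indep (v ` (- J))"
    unfolding int_indep_def
  proof (intro conjI allI impI ballI)
    fix c s assume c: "\<forall>i. (\<Sum>s\<in>v ` (- J). c s * s i) = 0" and s: "s \<in> v ` (- J)"
    then obtain i where i: "i \<in> - J" "s = v i" by auto
    have "(\<Sum>s\<in>v ` (- J). c s * s i) = (\<Sum>k\<in>- J. c (v k) * v k i)" by (simp add: sum.reindex[OF inj])
    also have "\<dots> = c (v i) * v i i + (\<Sum>k\<in>- J - {i}. c (v k) * v k i)" using i by (simp add: sum.remove)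
    also have "(\<Sum>k\<in>- J - {i}. c (v k) * v k i) = 0" using v i by (intro sum.neutral) auto
    finally have "c (v i) * v i i = 0" using c by simp
    then show "c s = 0" using v[OF i(1)] i by simp
  qed auto
  then have "card (v ` (- J)) \<le> r" using rank v unfolding has_rank_def by blast
  then have "card (- J) \<le> r" by (simp add: card_image[OF inj])
  then have "CARD('m) \<le> card J + r" by (simp add: Compl_eq_Diff_UNIV card_Diff_subset)
  then show ?thesis using that J(1) by (auto simp: good_def)
qed

section \<open>Zero estimate\<close>

text \<open>Boxes consist of exponents rather than points: different exponents may give the same
  point, and the stabiliser lives among exponents.\<close>

definition ibox :: "nat \<Rightarrow> ('m \<Rightarrow> int) set" where
  "ibox K = {a. \<forall>i. 0 \<le> a i \<and> a i \<le> int K}"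

lemma ibox_mono: "K \<le> K' \<Longrightarrow> ibox K \<subseteq> ibox K'"
  unfolding ibox_def by (auto intro: order_trans)

lemma ibox_zero: "(\<lambda>_. 0) \<in> ibox K"
  by (simp add: ibox_def)

lemma ibox_add: "a \<in> ibox K \<Longrightarrow> b \<in> ibox L \<Longrightarrow> (\<lambda>i. a i + b i) \<in> ibox (K + L)"
  by (auto simp: ibox_def intro: add_mono)

lemma finite_ibox: "finite (ibox K :: ('m::finite \<Rightarrow> int) set)"
proof (rule finite_subset)
  show "ibox K \<subseteq> Pi\<^sub>E UNIV (\<lambda>_. {0..int K})" by (auto simp: ibox_def PiE_iff)
qed (intro finite_PiE; simp)

lemma degle_tdeg: "P \<in> degle (tdeg P)"
  unfolding degle_def tdeg_def by auto

context
  fixes x :: "'m::finite \<Rightarrow> 'n::finite \<Rightarrow> 'k::field_char_0"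
  assumes x: "\<And>i j. x i j \<noteq> 0"
begin

lemma xpow_nonzero: "xpow x a j \<noteq> 0"
  using x by (simp add: xpow_def)

lemma xpow_add: "xpow x (\<lambda>i. a i + b i) = (\<lambda>j. xpow x a j * xpow x b j)"
  using x by (simp add: xpow_def power_int_add prod.distrib)

lemma xpow_zero: "xpow x (\<lambda>_. 0) = (\<lambda>_. 1)"
  by (simp add: xpow_def)

text \<open>The value of \<open>translate a P\<close> at \<open>y\<close> is that of
  \<open>P\<close> at \<open>x^a y\<close>, so translating an ideal by \<open>a\<close> moves its
  zero set by \<open>x^(-a)\<close>.\<close>

definition translate :: "('m \<Rightarrow> int) \<Rightarrow> ('n, 'k) mpoly \<Rightarrow> ('n, 'k) mpoly" where
  "translate a = act (xpow x a)"

lemma translate_translate: "translate a (translate b P) = translate (\<lambda>i. a i + b i) P"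
  by (simp add: translate_def act_act xpow_add)

lemma translate_zero: "translate (\<lambda>_. 0) P = P"
  by (simp add: translate_def xpow_zero act_one)

lemma translate_image: "translate a ` translate b ` p = translate (\<lambda>i. a i + b i) ` p"
  by (simp add: image_image translate_translate)

lemma translate_image_iff: "f \<in> translate a ` p \<longleftrightarrow> translate (\<lambda>i. - a i) f \<in> p"
proof
  assume "f \<in> translate a ` p"
  then show "translate (\<lambda>i. - a i) f \<in> p" by (auto simp: translate_translate translate_zero)
next
  assume "translate (\<lambda>i. - a i) f \<in> p"
  moreover have "f = translate a (translate (\<lambda>i. - a i) f)" by (simp add: translate_translate translate_zero)
  ultimately show "f \<in> translate a ` p" by blast
qed

lemma eval_translate: "mpoly_eval (translate a P) (xpow x b) = mpoly_eval P (xpow x (\<lambda>i. a i + b i))"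
  by (simp add: translate_def eval_act xpow_nonzero xpow_add)

lemma prime_translate_image: "prime_ideal p \<Longrightarrow> prime_ideal (translate a ` p)"
  unfolding translate_def by (intro prime_act_image xpow_nonzero)

lemma codim_translate_image: "codim (translate a ` p) = codim p"
  unfolding translate_def by (intro codim_act_image xpow_nonzero)

lemma translate_image_point:
  assumes "p \<subseteq> point_ideal (xpow x (\<lambda>i. a i + b i))"
  shows "translate a ` p \<subseteq> point_ideal (xpow x b)"
  using assms by (auto simp: point_ideal_def eval_translate)

lemma keys_translate: "keys (translate a P) = keys P"
  unfolding translate_def by (intro keys_act xpow_nonzero)

lemma Stab_translate: "Stab x p = {a. translate a ` p = p}"
  by (simp add: Stab_def translate_def)

text \<open>\<open>K\<close> plays the role of \<open>\<lfloor>N/n\<rfloor>\<close>. The \<open>r\<close>-th ideal is generated by the translates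
  of \<open>P\<close> by the box of size \<open>r K\<close>, and it still vanishes at the points from the box of size
  \<open>(n - r) K\<close>; along this chain the minimal codimension at such points takes values in
  \<open>{1..n}\<close>, so it is constant somewhere.\<close>

lemma stationary_step:
  fixes P :: "('n, 'k) mpoly" and K :: nat
  assumes P: "P \<noteq> 0" and vanish: "\<And>a. a \<in> ibox (CARD('n) * K) \<Longrightarrow> mpoly_eval P (xpow x a) = 0"
  obtains q c G b where "prime_ideal q" "codim q = c" "c > 0" "q \<subseteq> point_ideal (xpow x b)"
    "G \<subseteq> range (\<lambda>a. translate a P)"
    "\<And>a. a \<in> ibox K \<Longrightarrow> minimal_prime G (translate (\<lambda>i. - a i) ` q)"
proof -
  let ?n = "CARD('n)"
  define G where "G r = (\<lambda>a. translate a P) ` ibox (r * K)" for r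
  \<comment> \<open>The box of translates grows with \<open>r\<close> while the box of points
    shrinks, so a shift by \<open>ibox K\<close> trades level \<open>Suc r\<close> for level
    \<open>r\<close>.\<close>
  define adm where "adm r q \<longleftrightarrow> prime_ideal q \<and> G r \<subseteq> q \<and> (\<exists>b\<in>ibox ((?n - r) * K). q \<subseteq> point_ideal (xpow x b))" for r q
  define h where "h r = (LEAST c. \<exists>q. adm r q \<and> codim q = c)" for r
  have ex: "\<exists>c q. adm r q \<and> codim q = c" if "r \<le> ?n" for r
  proof -
    have "G r \<subseteq> point_ideal (xpow x (\<lambda>_. 0))"
    proof
      fix f assume "f \<in> G r"
      then obtain a where a: "a \<in> ibox (r * K)" "f = translate a P" by (auto simp: G_def)
      have "a \<in> ibox (?n * K)" using a(1) ibox_mono[of "r * K" "?n * K"] that by auto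
      then show "f \<in> point_ideal (xpow x (\<lambda>_. 0))" using vanish by (simp add: a(2) point_ideal_def eval_translate)
    qed
    then have "adm r (point_ideal (xpow x (\<lambda>_. 0)))"
      unfolding adm_def using prime_point_ideal ibox_zero by blast
    then show ?thesis by blast
  qed
  have attained: "\<exists>q. adm r q \<and> codim q = h r" if "r \<le> ?n" for r
    unfolding h_def using LeastI_ex[OF ex[OF that]] .
  have least: "h r \<le> codim q" if "adm r q" for r q
    unfolding h_def using that by (intro Least_le) blast
  have pos: "codim q > 0" if "adm r q" for r q
  proof -
    have "translate (\<lambda>_. 0) P \<in> q" using that ibox_zero unfolding adm_def G_def by blast
    then have "P \<in> q" by (simp add: translate_zero)
    moreover have "0 \<in> q" using that ideal_zero prime_ideal_ideal unfolding adm_def by blast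
    ultimately have "{0} \<subset> q" using P by auto
    then have "codim {0::('n, 'k) mpoly} < codim q" using that prime_ideal_zero unfolding adm_def by (intro codim_strict_mono) auto
    then show ?thesis by simp
  qed
  have "\<exists>r<?n. h (Suc r) \<le> h r"
  proof (rule ccontr)
    assume "\<not> ?thesis"
    then have inc: "h r < h (Suc r)" if "r < ?n" for r using that by (meson not_le)
    have "r < h r" if "r \<le> ?n" for r
      using that
    proof (induction r)
      case 0
      then show ?case using attained[of 0] pos by force
    next
      case (Suc r)
      then show ?case using inc[of r] by simp
    qed
    then have "?n < h ?n" by simp
    moreover have "h ?n \<le> ?n" using attained[of ?n] by (auto simp: codim_def)
    ultimately show False by simp
  qed
  then obtain r where r: "r < ?n" "h (Suc r) \<le> h r" by blast
  obtain q where q: "adm (Suc r) q" "codim q = h (Suc r)" using attained[of "Suc r"] r by auto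
  obtain b where b: "b \<in> ibox ((?n - Suc r) * K)" "q \<subseteq> point_ideal (xpow x b)" using q(1) by (auto simp: adm_def)
  have qp: "prime_ideal q" using q(1) by (simp add: adm_def)
  \<comment> \<open>The shift by \<open>a\<close> leads from \<open>G r\<close> into
    \<open>G (Suc r)\<close> and the point of \<open>b\<close> becomes that of \<open>a + b\<close>,
    so every prime between \<open>G r\<close> and the translate is admissible at level
    \<open>r\<close>. Its codimension is at least \<open>h r\<close>, hence at least that of
    \<open>q\<close>, which excludes proper inclusion.\<close>
  have "minimal_prime (G r) (translate (\<lambda>i. - a i) ` q)" if a: "a \<in> ibox K" for a
  proof -
    let ?q = "translate (\<lambda>i. - a i) ` q"
    have prime: "prime_ideal ?q" by (rule prime_translate_image[OF qp])
    have sub: "G r \<subseteq> ?q"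
    proof
      fix f assume "f \<in> G r"
      then obtain a0 where a0: "a0 \<in> ibox (r * K)" "f = translate a0 P" by (auto simp: G_def)
      have "(\<lambda>i. a i + a0 i) \<in> ibox (Suc r * K)" using ibox_add[OF a a0(1)] by simp
      then have "translate a f \<in> q" using q(1) unfolding a0(2) translate_translate adm_def G_def by blast
      then show "f \<in> ?q" by (simp add: translate_image_iff)
    qed
    have pt: "?q \<subseteq> point_ideal (xpow x (\<lambda>i. a i + b i))"
      by (rule translate_image_point) (use b in simp)
    have "K + (?n - Suc r) * K = (?n - r) * K" using r(1) by (simp add: Suc_diff_Suc flip: mult_Suc)
    then have ab: "(\<lambda>i. a i + b i) \<in> ibox ((?n - r) * K)" using ibox_add[OF a b(1)] by simp
    show ?thesis unfolding minimal_prime_def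
    proof (intro conjI allI impI prime sub)
      fix p' assume p': "prime_ideal p'" "G r \<subseteq> p'" "p' \<subseteq> ?q"
      then have "adm r p'" unfolding adm_def using pt ab by blast
      then have "codim ?q \<le> codim p'" using least[of r p'] r(2) q(2) by (simp add: codim_translate_image)
      then show "p' = ?q" using codim_strict_mono[OF p'(1) prime] p'(3) by (meson not_le psubsetI)
    qed
  qed
  then show ?thesis using that[of q "codim q" b "G r"] qp pos[OF q(1)] b(2) by (auto simp: G_def)
qed

text \<open>Exponents of the box supported on \<open>J\<close> give distinct translates: if two
  agree, their difference stabilises \<open>q\<close> and is supported on \<open>J\<close>. The
  group is commutative, so the stabiliser of \<open>q\<close> is also that of its shift by
  \<open>b\<close>, the ideal to which the rank refers in the end.\<close>

lemma card_translates:
  fixes q :: "('n, 'k) mpoly set"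
  assumes J: "\<And>v. v \<in> Stab x (translate b ` q) \<Longrightarrow> (\<forall>i. i \<notin> J \<longrightarrow> v i = 0) \<Longrightarrow> v = (\<lambda>_. 0)"
  shows "(K + 1) ^ card J \<le> card ((\<lambda>a. translate (\<lambda>i. - a i) ` q) ` ibox K)"
proof -
  define emb :: "('m \<Rightarrow> int) \<Rightarrow> 'm \<Rightarrow> int" where "emb f i = (if i \<in> J then f i else 0)" for f i
  have "inj_on (\<lambda>f. translate (\<lambda>i. - emb f i) ` q) (J \<rightarrow>\<^sub>E {0..int K})"
  proof (rule inj_onI)
    fix f g assume f: "f \<in> J \<rightarrow>\<^sub>E {0..int K}" and g: "g \<in> J \<rightarrow>\<^sub>E {0..int K}"
      and eq: "translate (\<lambda>i. - emb f i) ` q = translate (\<lambda>i. - emb g i) ` q"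
    define v where "v i = emb f i - emb g i" for i
    have "translate v ` translate b ` q = translate (\<lambda>i. b i + emb f i) ` translate (\<lambda>i. - emb g i) ` q"
      by (simp add: translate_image v_def algebra_simps)
    also have "\<dots> = translate (\<lambda>i. b i + emb f i) ` translate (\<lambda>i. - emb f i) ` q" by (simp only: eq)
    also have "\<dots> = translate b ` q" by (simp add: translate_image)
    finally have "v \<in> Stab x (translate b ` q)" by (simp add: Stab_translate)
    then have "v = (\<lambda>_. 0)" using J by (simp add: v_def emb_def)
    then have "v i = 0" for i by simp
    then have "f i = g i" if "i \<in> J" for i using that by (metis v_def emb_def eq_iff_diff_eq_0)
    then show "f = g" using f g by (intro PiE_ext)
  qed
  moreover have "(\<lambda>f. translate (\<lambda>i. - emb f i) ` q) ` (J \<rightarrow>\<^sub>E {0..int K}) \<subseteq> (\<lambda>a. translate (\<lambda>i. - a i) ` q) ` ibox K"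
  proof clarify
    fix f assume "f \<in> J \<rightarrow>\<^sub>E {0..int K}"
    then have "emb f \<in> ibox K" by (auto simp: emb_def ibox_def)
    then show "translate (\<lambda>i. - emb f i) ` q \<in> (\<lambda>a. translate (\<lambda>i. - a i) ` q) ` ibox K" by (rule imageI)
  qed
  ultimately have "card (J \<rightarrow>\<^sub>E {0..int K}) \<le> card ((\<lambda>a. translate (\<lambda>i. - a i) ` q) ` ibox K)"
    by (intro card_inj_on_le) (simp_all add: finite_ibox)
  moreover have "card (J \<rightarrow>\<^sub>E {0..int K}) = (K + 1) ^ card J" by (simp add: card_PiE nat_add_distrib)
  ultimately show ?thesis by simp
qed

end

theorem theorem5p10:
  fixes x :: "'m::finite \<Rightarrow> 'n::finite \<Rightarrow> 'k::field_char_0"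
    and N :: nat
    and P :: "('n, 'k) mpoly"
  assumes "\<forall>i j. x i j \<noteq> 0"
    and "N > 0"
    and "P \<noteq> 0"
    and "real (tdeg P) < (real N / real CARD('n)) powr (real CARD('m) / real CARD('n))"
    and "\<forall>z\<in>Xset x N. mpoly_eval P z = 0"
  shows "\<exists>p n' m'. prime_ideal p \<and> p \<subseteq> maxm \<and> has_height p n' \<and> has_rank (Stab x p) m' \<and>
           real m' / real CARD('m) + real n' / real CARD('n) > 1"
proof -
  let ?n = "CARD('n)" and ?m = "CARD('m)"
  define D where "D = tdeg P"
  define K where "K = N div ?n"
  have x: "x i j \<noteq> 0" for i j using assms(1) by simp
  have vanish: "mpoly_eval P (xpow x a) = 0" if "a \<in> ibox (?n * K)" for a
  proof -
    have "a \<in> ibox N" using that ibox_mono[of "?n * K" N] by (auto simp: K_def)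
    then show ?thesis using assms(5) by (auto simp: Xset_def ibox_def)
  qed
  \<comment> \<open>A nonzero constant cannot vanish at the identity, which always belongs to
    \<open>X(N)\<close>.\<close>
  have D: "D > 0"
  proof (rule ccontr)
    assume "\<not> D > 0"
    then have deg0: "P \<in> degle 0" using degle_tdeg[of P] by (simp add: D_def)
    have "\<alpha> = 0" if "\<alpha> \<in> keys P" for \<alpha>
      using that deg0 by (intro poly_mapping_eqI) (auto simp: degle_def)
    moreover have "keys P \<noteq> {}" using assms(3) by simp
    ultimately have keys: "keys P = {0}" by blast
    then have "mpoly_eval P (xpow x (\<lambda>_. 0)) = lkp P 0" by (simp add: mpoly_eval_def mono_eval_zero)
    then have "lkp P 0 = 0" using vanish[OF ibox_zero] by simp
    then show False using keys by (metis in_keys_iff insertI1)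
  qed
  obtain q c G b where q: "prime_ideal q" "codim q = c" "c > 0" "q \<subseteq> point_ideal (xpow x b)"
    and G: "G \<subseteq> range (\<lambda>a. translate x a P)"
    and min: "\<And>a. a \<in> ibox K \<Longrightarrow> minimal_prime G (translate x (\<lambda>i. - a i) ` q)"
    using stationary_step[OF x assms(3) vanish] by metis
  \<comment> \<open>The shift by \<open>b\<close> carries the point \<open>x^b\<close> to the
    identity, the zero of \<open>maxm\<close>.\<close>
  define p where "p = translate x b ` q"
  have p: "prime_ideal p" "codim p = c"
    using q by (simp_all add: p_def prime_translate_image[OF x] codim_translate_image[OF x])
  have "p \<subseteq> point_ideal (xpow x (\<lambda>_. 0))"
    unfolding p_def by (rule translate_image_point[OF x]) (use q(4) in simp)
  then have p_max: "p \<subseteq> maxm" using point_ideal_one_subset by (auto simp: xpow_zero[OF x])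
  obtain m' where m': "has_rank (Stab x p) m'" using has_rank_exists by blast
  obtain J where J: "\<And>v. v \<in> Stab x p \<Longrightarrow> (\<forall>i. i \<notin> J \<longrightarrow> v i = 0) \<Longrightarrow> v = (\<lambda>_. 0)" and cardJ: "?m \<le> card J + m'"
    using transversal_coordinates[OF m'] by blast
  have "(K + 1) ^ card J \<le> card ((\<lambda>a. translate x (\<lambda>i. - a i) ` q) ` ibox K)"
    using card_translates[OF x J[unfolded p_def]] .
  also have "\<dots> \<le> D ^ c"
  proof (rule minimal_primes_bezout)
    show "finite ((\<lambda>a. translate x (\<lambda>i. - a i) ` q) ` ibox K)" by (simp add: finite_ibox)
    show "minimal_prime G q' \<and> codim q' = c" if "q' \<in> (\<lambda>a. translate x (\<lambda>i. - a i) ` q) ` ibox K" for q'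
      using that min q(2) codim_translate_image[OF x] by auto
    show "G \<subseteq> degle D"
      using G degle_tdeg[of P] by (force simp: D_def degle_def keys_translate[OF x])
  qed (rule D)
  finally have count: "(K + 1) ^ card J \<le> D ^ c" .
  define R where "R = real N / real ?n"
  have R0: "R > 0" using assms(2) by (simp add: R_def)
  have DR: "real D < R powr (real ?m / real ?n)" using assms(4) by (simp add: D_def R_def)
  \<comment> \<open>As \<open>D\<close> is at least 1, the strict bound forces the base above 1, so
    that powers can be compared through their exponents.\<close>
  have R1: "R > 1"
  proof (rule ccontr)
    assume "\<not> R > 1"
    then have "R powr (real ?m / real ?n) \<le> 1" using R0 by (intro powr_le1) auto
    then show False using DR D by simp
  qed
  \<comment> \<open>A side of the box has \<open>K + 1\<close> integer points, which makes up for
    the rounding in \<open>K\<close>.\<close>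
  have "R \<le> real (K + 1)"
  proof -
    have "N < (K + 1) * ?n" unfolding K_def using dividend_less_div_times[of ?n N] by (simp add: add.commute)
    then have "real N < real (K + 1) * real ?n" by (metis of_nat_less_iff of_nat_mult)
    then show ?thesis by (simp add: R_def field_simps)
  qed
  then have "R powr real (card J) \<le> real (K + 1) ^ card J"
    using R0 by (simp add: powr_realpow power_mono)
  also have "\<dots> \<le> real D ^ c" using count by (metis of_nat_le_iff of_nat_power)
  \<comment> \<open>Strictness survives the power because \<open>c > 0\<close>.\<close>
  also have "\<dots> < (R powr (real ?m / real ?n)) ^ c" using DR q(3) by (intro power_strict_mono) auto
  also have "\<dots> = R powr (real ?m / real ?n * real c)"
    using R0 by (simp add: powr_powr flip: powr_realpow)
  finally have "real (card J) < real ?m / real ?n * real c" using R1 by simp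
  moreover have "real ?m \<le> real (card J) + real m'" using cardJ by linarith
  ultimately have "real ?m < real m' + real ?m * (real c / real ?n)" by simp
  then have "1 < real m' / real ?m + real c / real ?n" by (simp add: field_simps)
  then show ?thesis using p p_max m' has_height_codim[OF p(1)] by blast
qed

end
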